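(* Let $R$ be an $\mathbb{F}_p(L_1)$-subalgebra of $\overline{K}$. The antipode $S_\infty:\overline{\mathfrak{Z}}_{\infty,R}\to\overline{\mathfrak{Z}}_{\infty,R}$ of the Hopf algebra $\overline{\mathfrak{Z}}_{\infty,R}$ satisfies, for every index $\mathfrak{s}\in\mathcal{I}$, $$S_\infty(\pi_\infty(\zeta_A(\mathfrak{s})))=\pi_\infty(\zeta_A^{\star\text{-}\mathrm{inv}}(\mathfrak{s})),\qquad S_\infty(\pi_\infty(\mathrm{Li}_{\mathfrak{s}}(\mathbf{1})))=\pi_\infty(\mathrm{Li}_{\mathfrak{s}}^{\star\text{-}\mathrm{inv}}(\mathbf{1})).$$
   Context: Let $p$ be a prime, $q$ a power of $p$, $A=\mathbb{F}_q[\theta]$, $K=\mathbb{F}_q(\theta)$, $K_\infty=\mathbb{F}_q(\!(1/\theta)\!)$, $\mathbb{C}_\infty$ the completion of an algebraic closure of $K_\infty$, and $\overline{K}\subset\mathbb{C}_\infty$ the algebraic closure of $K$. Put $L_0=1$ and $L_d=\prod_{i=1}^d(\theta-\theta^{q^i})$ for $d\ge1$; in particular $L_1=\theta-\theta^q$. $\mathbb{N}$ is the set of positive integers. The set of indices is $\mathcal{I}=\{\varnothing\}\cup\bigcup_{r\ge1}\mathbb{N}^r$. For $\mathfrak{s}=(s_1,\dots,s_r)$, $\operatorname{dep}(\mathfrak{s})=r$ and $\operatorname{wt}(\mathfrak{s})=s_1+\cdots+s_r$; $\operatorname{dep}(\varnothing)=\operatorname{wt}(\varnothing)=0$. For $0\le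 i\le r$, $\mathfrak{s}[:i]=(s_1,\dots,s_i)$ and $\mathfrak{s}[i+1:]=(s_{i+1},\dots,s_r)$, with $\mathfrak{s}[:0]=\mathfrak{s}[r+1:]=\varnothing$. For $d\ge0$, $s\in\mathbb{N}$ let $S_d(s)=\sum_{a\in A\text{ monic},\ \deg a=d}a^{-s}$. For non-empty $\mathfrak{s}=(s_1,\dots,s_r)$ define, in $\mathbb{C}_\infty$, $$\zeta_A(\mathfrak{s})=\sum_{d_1>\cdots>d_r\ge0}\prod_{i=1}^rS_{d_i}(s_i),\qquad \mathrm{Li}_{\mathfrak{s}}(\mathbf{1})=\sum_{d_1>\cdots>d_r\ge0}\prod_{i=1}^rL_{d_i}^{-s_i},$$ $$\zeta_A^{\star\text{-}\mathrm{inv}}(\mathfrak{s})=(-1)^r\sum_{0\le d_1\le\cdots\le d_r}\prod_{i=1}^rS_{d_i}(s_i),\qquad \mathrm{Li}^{\star\text{-}\mathrm{inv}}_{\mathfrak{s}}(\mathbf{1})=(-1)^r\sum_{0\le d_1\le\cdots\le d_r}\prod_{i=1}^rL_{d_i}^{-s_i},$$ and all four values equal $1$ for $\mathfrak{s}=\varnothing$. $\mathfrak{Z}_{\infty,R}\subset\mathbb{C}_\infty$ is the $R$-algebra generated by all $\zeta_A(\mathfrak{s})$, $\mathfrak{s}\in\mathcal{I}$. It is known that $\mathfrak{Z}_{\infty,R}$ is the $R$-span of the $\zeta_A(\mathfrak{s})$ and also of the $\mathrm{Li}_{\mathfrak{s}}(\mathbf{1})$, and that it is graded by weight: $\mathfrak{Z}_{\infty,R}=\bigoplus_{w\ge0}\mathfrak{Z}_{\infty,R,w}$,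 where $\mathfrak{Z}_{\infty,R,w}$ is the $R$-span of the $\zeta_A(\mathfrak{s})$ with $\operatorname{wt}(\mathfrak{s})=w$ (equivalently of the $\mathrm{Li}_{\mathfrak{s}}(\mathbf{1})$ with $\operatorname{wt}(\mathfrak{s})=w$). The $\star$-inverse values also lie in $\mathfrak{Z}_{\infty,R}$. Put $\overline{\mathfrak{Z}}_{\infty,R}=\mathfrak{Z}_{\infty,R}/\zeta_A(q-1)\mathfrak{Z}_{\infty,R}$ with quotient map $\pi_\infty$ and the induced grading. Hopf algebra structure (known theorem of Mishiba): there is a unique $R$-algebra homomorphism $\widetilde{\Delta}_\infty^{\mathrm{Li}}:\mathfrak{Z}_{\infty,R}\to\mathfrak{Z}_{\infty,R}\otimes_R\overline{\mathfrak{Z}}_{\infty,R}$ with $\widetilde{\Delta}_\infty^{\mathrm{Li}}(\mathrm{Li}_{\mathfrak{s}}(\mathbf{1}))=\sum_{i=0}^{r}\mathrm{Li}_{\mathfrak{s}[:i]}(\mathbf{1})\otimes\pi_\infty(\mathrm{Li}_{\mathfrak{s}[i+1:]}(\mathbf{1}))$ for all $\mathfrak{s}$ of depth $r$; it induces a coproduct $\Delta_\infty:\overline{\mathfrak{Z}}_{\infty,R}\to\overline{\mathfrak{Z}}_{\infty,R}\otimes_R\overline{\mathfrak{Z}}_{\infty,R}$ determined by $\Delta_\infty\circ\pi_\infty=(\pi_\infty\otimes\mathrm{id})\circ\widetilde{\Delta}_\infty^{\mathrm{Li}}$, which, with the counit given by projection onto the degree-zero part $R$, makes $\overline{\mathfrak{Z}}_{\infty,R}$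 a connected graded Hopf algebra over $R$. $S_\infty$ denotes its antipode. *)

theory Defs
  imports
    "HOL-Algebra.Algebraic_Closure_Type"
    "HOL-Algebra.Generated_Fields"
    "HOL-Computational_Algebra.Formal_Laurent_Series"
    "HOL-Analysis.Infinite_Sum"
    "HOL-Library.Cardinality"
begin

section \<open>Commutative algebras, tensor products and Hopf algebras over a commutative ring\<close>

definition algebra_hom ::
    "('r, 'x) ring_scheme \<Rightarrow> ('r, 'm, 'y) module_scheme \<Rightarrow> ('r, 'n, 'z) module_scheme \<Rightarrow> ('m \<Rightarrow> 'n) set"
  where "algebra_hom R M N =
    {f \<in> ring_hom M N. \<forall>r\<in>carrier R. \<forall>x\<in>carrier M. f (r \<odot>\<^bsub>M\<^esub> x) = r \<odot>\<^bsub>N\<^esub> f x}"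

definition linear_maps ::
    "('r, 'x) ring_scheme \<Rightarrow> ('r, 'm, 'y) module_scheme \<Rightarrow> ('r, 'n, 'z) module_scheme \<Rightarrow> ('m \<Rightarrow> 'n) set"
  where "linear_maps R M N =
    {f \<in> carrier M \<rightarrow> carrier N.
       (\<forall>x\<in>carrier M. \<forall>y\<in>carrier M. f (x \<oplus>\<^bsub>M\<^esub> y) = f x \<oplus>\<^bsub>N\<^esub> f y) \<and>
       (\<forall>r\<in>carrier R. \<forall>x\<in>carrier M. f (r \<odot>\<^bsub>M\<^esub> x) = r \<odot>\<^bsub>N\<^esub> f x)}"

text \<open>The library's quotient ring \<^term>\<open>M Quot I\<close>, together with its scalar multiplication.\<close>

definition quotient_algebra :: "('r, 'm, 'x) module_scheme \<Rightarrow> 'm set \<Rightarrow> ('r, 'm set) module"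
  where "quotient_algebra M I =
    \<lparr>carrier = carrier (M Quot I), monoid.mult = monoid.mult (M Quot I), one = one (M Quot I),
     ring.zero = ring.zero (M Quot I), add = add (M Quot I),
     module.smult = (\<lambda>r C. \<Union>x\<in>C. I +>\<^bsub>M\<^esub> (r \<odot>\<^bsub>M\<^esub> x))\<rparr>"

text \<open>The monoid algebra \<open>R[G]\<close>: finitely supported functions on \<open>G\<close> with the convolution product.\<close>

definition monoid_algebra ::
    "('r, 'x) ring_scheme \<Rightarrow> ('g, 'y) monoid_scheme \<Rightarrow> ('r, 'g \<Rightarrow> 'r) module"
  where "monoid_algebra R G =
    \<lparr>carrier = {f. (\<forall>x. f x \<in> carrier R) \<and> (\<forall>x. x \<notin> carrier G \<longrightarrow> f x = \<zero>\<^bsub>R\<^esub>) \<and> finite {x. f x \<noteq> \<zero>\<^bsub>R\<^esub>}},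
     monoid.mult = (\<lambda>f h x. \<Oplus>\<^bsub>R\<^esub>p\<in>{p. f (fst p) \<noteq> \<zero>\<^bsub>R\<^esub> \<and> h (snd p) \<noteq> \<zero>\<^bsub>R\<^esub> \<and> fst p \<otimes>\<^bsub>G\<^esub> snd p = x}.
               f (fst p) \<otimes>\<^bsub>R\<^esub> h (snd p)),
     one = (\<lambda>x. if x = \<one>\<^bsub>G\<^esub> then \<one>\<^bsub>R\<^esub> else \<zero>\<^bsub>R\<^esub>),
     ring.zero = (\<lambda>x. \<zero>\<^bsub>R\<^esub>),
     add = (\<lambda>f h x. f x \<oplus>\<^bsub>R\<^esub> h x),
     module.smult = (\<lambda>r f x. r \<otimes>\<^bsub>R\<^esub> f x)\<rparr>"

lemma (in abelian_monoid) finsum_double: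
  assumes "finite A" "finite B" "\<And>a b. f a b \<in> carrier G"
  shows "finsum G (\<lambda>a. finsum G (f a) B) A = finsum G (\<lambda>p. f (fst p) (snd p)) (A \<times> B)"
  using assms(1)
proof induction
  case empty then show ?case by simp
next
  case (insert a A)
  have e: "insert a A \<times> B = ((\<lambda>b. (a,b)) ` B) \<union> A \<times> B" by auto
  have "finsum G (\<lambda>p. f (fst p) (snd p)) (insert a A \<times> B) =
     finsum G (\<lambda>p. f (fst p) (snd p)) ((\<lambda>b. (a,b)) ` B) \<oplus> finsum G (\<lambda>p. f (fst p) (snd p)) (A \<times> B)"
    unfolding e by (rule finsum_Un_disjoint) (use insert assms in auto)
  also have "finsum G (\<lambda>p. f (fst p) (snd p)) ((\<lambda>b. (a,b)) ` B) = finsum G (f a) B"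
    by (subst finsum_reindex) (use assms in \<open>auto simp: inj_on_def\<close>)
  finally show ?case using insert assms by (simp add: Pi_def)
qed

lemma (in abelian_monoid) finsum_exchange:
  assumes "finite A" "finite B" "\<And>a b. f a b \<in> carrier G"
  shows "finsum G (\<lambda>a. finsum G (f a) B) A = finsum G (\<lambda>b. finsum G (\<lambda>a. f a b) A) B"
proof -
  have "finsum G (\<lambda>a. finsum G (f a) B) A = finsum G (\<lambda>p. f (fst p) (snd p)) (prod.swap ` (B \<times> A))"
    using assms by (subst finsum_double) (auto simp: product_swap)
  also have "\<dots> = finsum G (\<lambda>p. f (snd p) (fst p)) (B \<times> A)"
    by (subst finsum_reindex) (use assms in auto)
  also have "\<dots> = finsum G (\<lambda>b. finsum G (\<lambda>a. f a b) A) B"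
    using assms by (subst finsum_double[where f = "\<lambda>b a. f a b"]) auto
  finally show ?thesis .
qed

locale monoid_algebra_locale = R?: cring R + G: comm_monoid G for R (structure) and G (structure)
begin

abbreviation "F \<equiv> monoid_algebra R G"
abbreviation "su f \<equiv> {x. f x \<noteq> \<zero>\<^bsub>R\<^esub>}"

lemma carD: assumes "f \<in> carrier F" shows "f x \<in> carrier R" "finite (su f)" "su f \<subseteq> carrier G" "x \<notin> su f \<Longrightarrow> f x = \<zero>\<^bsub>R\<^esub>"
  using assms by (auto simp: monoid_algebra_def)

lemma carF: "carrier F = {f. (\<forall>x. f x \<in> carrier R) \<and> (\<forall>x. x \<notin> carrier G \<longrightarrow> f x = \<zero>\<^bsub>R\<^esub>) \<and> finite {x. f x \<noteq> \<zero>\<^bsub>R\<^esub>}}"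
  by (simp add: monoid_algebra_def)

lemma mult_eq:
  assumes "f \<in> carrier F" "h \<in> carrier F" "finite A" "finite B" "su f \<subseteq> A" "su h \<subseteq> B"
  shows "(f \<otimes>\<^bsub>F\<^esub> h) x = (\<Oplus>\<^bsub>R\<^esub>y\<in>A. \<Oplus>\<^bsub>R\<^esub>z\<in>B. if y \<otimes>\<^bsub>G\<^esub> z = x then f y \<otimes>\<^bsub>R\<^esub> h z else \<zero>\<^bsub>R\<^esub>)"
proof -
  note [simp] = carD(1)[OF assms(1)] carD(1)[OF assms(2)]
  have "(f \<otimes>\<^bsub>F\<^esub> h) x = (\<Oplus>\<^bsub>R\<^esub>p\<in>A\<times>B. if fst p \<otimes>\<^bsub>G\<^esub> snd p = x then f (fst p) \<otimes>\<^bsub>R\<^esub> h (snd p) else \<zero>\<^bsub>R\<^esub>)"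
    unfolding monoid_algebra_def monoid.simps
    by (rule R.add.finprod_mono_neutral_cong_left) (use assms in \<open>auto\<close>)
  also have "\<dots> = (\<Oplus>\<^bsub>R\<^esub>y\<in>A. \<Oplus>\<^bsub>R\<^esub>z\<in>B. if y \<otimes>\<^bsub>G\<^esub> z = x then f y \<otimes>\<^bsub>R\<^esub> h z else \<zero>\<^bsub>R\<^esub>)"
    using assms by (subst R.finsum_double) auto
  finally show ?thesis .
qed

lemma mult_supp:
  assumes "f \<in> carrier F" "h \<in> carrier F"
  shows "su (f \<otimes>\<^bsub>F\<^esub> h) \<subseteq> (\<lambda>p. fst p \<otimes>\<^bsub>G\<^esub> snd p) ` (su f \<times> su h)"
proof
  fix x assume x: "x \<in> su (f \<otimes>\<^bsub>F\<^esub> h)"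
  show "x \<in> (\<lambda>p. fst p \<otimes>\<^bsub>G\<^esub> snd p) ` (su f \<times> su h)"
  proof (rule ccontr)
    assume "x \<notin> (\<lambda>p. fst p \<otimes>\<^bsub>G\<^esub> snd p) ` (su f \<times> su h)"
    hence "{p. f (fst p) \<noteq> \<zero>\<^bsub>R\<^esub> \<and> h (snd p) \<noteq> \<zero>\<^bsub>R\<^esub> \<and> fst p \<otimes>\<^bsub>G\<^esub> snd p = x} = {}" by force
    hence "(f \<otimes>\<^bsub>F\<^esub> h) x = \<zero>\<^bsub>R\<^esub>" unfolding monoid_algebra_def monoid.simps by (simp only: R.finsum_empty)
    thus False using x by simp
  qed
qed

lemma mult_closed: assumes "f \<in> carrier F" "h \<in> carrier F" shows "f \<otimes>\<^bsub>F\<^esub> h \<in> carrier F"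
proof -
  note [simp] = carD(1)[OF assms(1)] carD(1)[OF assms(2)]
  have 1: "(f \<otimes>\<^bsub>F\<^esub> h) x \<in> carrier R" for x
    unfolding monoid_algebra_def monoid.simps by (rule R.finsum_closed) auto
  have 2: "finite (su (f \<otimes>\<^bsub>F\<^esub> h))"
    by (rule finite_subset[OF mult_supp[OF assms]]) (use carD(2)[OF assms(1)] carD(2)[OF assms(2)] in auto)
  have 3: "su (f \<otimes>\<^bsub>F\<^esub> h) \<subseteq> carrier G"
    using mult_supp[OF assms] carD(3)[OF assms(1)] carD(3)[OF assms(2)] by fastforce
  show ?thesis
    unfolding carF using 1 2 3 by auto
qed

lemma mult_comm: assumes "f \<in> carrier F" "h \<in> carrier F" shows "f \<otimes>\<^bsub>F\<^esub> h = h \<otimes>\<^bsub>F\<^esub> f"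
proof
  fix x
  note c[simp] = carD(1)[OF assms(1)] carD(1)[OF assms(2)]
  note fi = carD(2)[OF assms(1)] carD(2)[OF assms(2)]
  note su = carD(3)[OF assms(1)] carD(3)[OF assms(2)]
  have "(f \<otimes>\<^bsub>F\<^esub> h) x = (\<Oplus>\<^bsub>R\<^esub>y\<in>su f. \<Oplus>\<^bsub>R\<^esub>z\<in>su h. if y \<otimes>\<^bsub>G\<^esub> z = x then f y \<otimes>\<^bsub>R\<^esub> h z else \<zero>\<^bsub>R\<^esub>)"
    by (rule mult_eq) (use assms fi in auto)
  also have "\<dots> = (\<Oplus>\<^bsub>R\<^esub>z\<in>su h. \<Oplus>\<^bsub>R\<^esub>y\<in>su f. if y \<otimes>\<^bsub>G\<^esub> z = x then f y \<otimes>\<^bsub>R\<^esub> h z else \<zero>\<^bsub>R\<^esub>)"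
    by (rule R.finsum_exchange) (use fi in auto)
  also have "\<dots> = (\<Oplus>\<^bsub>R\<^esub>z\<in>su h. \<Oplus>\<^bsub>R\<^esub>y\<in>su f. if z \<otimes>\<^bsub>G\<^esub> y = x then h z \<otimes>\<^bsub>R\<^esub> f y else \<zero>\<^bsub>R\<^esub>)"
    by (intro R.finsum_cong') (use su in \<open>auto simp: G.m_comm R.m_comm subset_iff\<close>)
  also have "\<dots> = (h \<otimes>\<^bsub>F\<^esub> f) x"
    by (rule mult_eq[symmetric]) (use assms fi in auto)
  finally show "(f \<otimes>\<^bsub>F\<^esub> h) x = (h \<otimes>\<^bsub>F\<^esub> f) x" .
qed

lemma triple:
  assumes "f \<in> carrier F" "g \<in> carrier F" "h \<in> carrier F"
  shows "((f \<otimes>\<^bsub>F\<^esub> g) \<otimes>\<^bsub>F\<^esub> h) x = (\<Oplus>\<^bsub>R\<^esub>a\<in>su f. \<Oplus>\<^bsub>R\<^esub>b\<in>su g. \<Oplus>\<^bsub>R\<^esub>c\<in>su h.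
     if a \<otimes>\<^bsub>G\<^esub> b \<otimes>\<^bsub>G\<^esub> c = x then f a \<otimes>\<^bsub>R\<^esub> g b \<otimes>\<^bsub>R\<^esub> h c else \<zero>\<^bsub>R\<^esub>)"
proof -
  note c[simp] = carD(1)[OF assms(1)] carD(1)[OF assms(2)] carD(1)[OF assms(3)]
  note fi[simp] = carD(2)[OF assms(1)] carD(2)[OF assms(2)] carD(2)[OF assms(3)]
  define W where "W = (\<lambda>p. fst p \<otimes>\<^bsub>G\<^esub> snd p) ` (su f \<times> su g)"
  have [simp]: "finite W" by (simp add: W_def)
  let ?t = "\<lambda>a b c. f a \<otimes>\<^bsub>R\<^esub> g b \<otimes>\<^bsub>R\<^esub> h c"
  have "((f \<otimes>\<^bsub>F\<^esub> g) \<otimes>\<^bsub>F\<^esub> h) x = (\<Oplus>\<^bsub>R\<^esub>w\<in>W. \<Oplus>\<^bsub>R\<^esub>c\<in>su h. if w \<otimes>\<^bsub>G\<^esub> c = x then (f \<otimes>\<^bsub>F\<^esub> g) w \<otimes>\<^bsub>R\<^esub> h c else \<zero>\<^bsub>R\<^esub>)"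
    by (rule mult_eq) (use assms mult_closed mult_supp in \<open>auto simp: W_def\<close>)
  also have "\<dots> = (\<Oplus>\<^bsub>R\<^esub>w\<in>W. \<Oplus>\<^bsub>R\<^esub>c\<in>su h. \<Oplus>\<^bsub>R\<^esub>a\<in>su f. \<Oplus>\<^bsub>R\<^esub>b\<in>su g. if a \<otimes>\<^bsub>G\<^esub> b = w \<and> w \<otimes>\<^bsub>G\<^esub> c = x then ?t a b c else \<zero>\<^bsub>R\<^esub>)"
  proof (intro R.finsum_cong' refl)
    fix w c
    show "(if w \<otimes>\<^bsub>G\<^esub> c = x then (f \<otimes>\<^bsub>F\<^esub> g) w \<otimes>\<^bsub>R\<^esub> h c else \<zero>\<^bsub>R\<^esub>) =
      (\<Oplus>\<^bsub>R\<^esub>a\<in>su f. \<Oplus>\<^bsub>R\<^esub>b\<in>su g. if a \<otimes>\<^bsub>G\<^esub> b = w \<and> w \<otimes>\<^bsub>G\<^esub> c = x then ?t a b c else \<zero>\<^bsub>R\<^esub>)"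
    proof (cases "w \<otimes>\<^bsub>G\<^esub> c = x")
      case True
      have "(f \<otimes>\<^bsub>F\<^esub> g) w \<otimes>\<^bsub>R\<^esub> h c = (\<Oplus>\<^bsub>R\<^esub>a\<in>su f. \<Oplus>\<^bsub>R\<^esub>b\<in>su g. if a \<otimes>\<^bsub>G\<^esub> b = w then f a \<otimes>\<^bsub>R\<^esub> g b else \<zero>\<^bsub>R\<^esub>) \<otimes>\<^bsub>R\<^esub> h c"
        by (subst mult_eq[where A = "su f" and B = "su g"]) (use assms in auto)
      also have "\<dots> = (\<Oplus>\<^bsub>R\<^esub>a\<in>su f. (\<Oplus>\<^bsub>R\<^esub>b\<in>su g. if a \<otimes>\<^bsub>G\<^esub> b = w then f a \<otimes>\<^bsub>R\<^esub> g b else \<zero>\<^bsub>R\<^esub>) \<otimes>\<^bsub>R\<^esub> h c)"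
        by (rule R.finsum_ldistr) (auto intro!: R.finsum_closed)
      also have "\<dots> = (\<Oplus>\<^bsub>R\<^esub>a\<in>su f. \<Oplus>\<^bsub>R\<^esub>b\<in>su g. (if a \<otimes>\<^bsub>G\<^esub> b = w then f a \<otimes>\<^bsub>R\<^esub> g b else \<zero>\<^bsub>R\<^esub>) \<otimes>\<^bsub>R\<^esub> h c)"
        by (intro R.finsum_cong' refl R.finsum_ldistr) (auto intro!: R.finsum_closed)
      also have "\<dots> = (\<Oplus>\<^bsub>R\<^esub>a\<in>su f. \<Oplus>\<^bsub>R\<^esub>b\<in>su g. if a \<otimes>\<^bsub>G\<^esub> b = w \<and> w \<otimes>\<^bsub>G\<^esub> c = x then ?t a b c else \<zero>\<^bsub>R\<^esub>)"
        by (intro R.finsum_cong' refl) (use True in \<open>auto intro!: R.finsum_closed\<close>)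
      finally show ?thesis using True by simp
    qed simp
  qed (auto intro!: R.finsum_closed)
  also have "\<dots> = (\<Oplus>\<^bsub>R\<^esub>c\<in>su h. \<Oplus>\<^bsub>R\<^esub>w\<in>W. \<Oplus>\<^bsub>R\<^esub>a\<in>su f. \<Oplus>\<^bsub>R\<^esub>b\<in>su g. if a \<otimes>\<^bsub>G\<^esub> b = w \<and> w \<otimes>\<^bsub>G\<^esub> c = x then ?t a b c else \<zero>\<^bsub>R\<^esub>)"
    by (rule R.finsum_exchange) (auto intro!: R.finsum_closed)
  also have "\<dots> = (\<Oplus>\<^bsub>R\<^esub>c\<in>su h. \<Oplus>\<^bsub>R\<^esub>a\<in>su f. \<Oplus>\<^bsub>R\<^esub>w\<in>W. \<Oplus>\<^bsub>R\<^esub>b\<in>su g. if a \<otimes>\<^bsub>G\<^esub> b = w \<and> w \<otimes>\<^bsub>G\<^esub> c = x then ?t a b c else \<zero>\<^bsub>R\<^esub>)"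
    by (intro R.finsum_cong' refl R.finsum_exchange) (auto intro!: R.finsum_closed)
  also have "\<dots> = (\<Oplus>\<^bsub>R\<^esub>c\<in>su h. \<Oplus>\<^bsub>R\<^esub>a\<in>su f. \<Oplus>\<^bsub>R\<^esub>b\<in>su g. \<Oplus>\<^bsub>R\<^esub>w\<in>W. if a \<otimes>\<^bsub>G\<^esub> b = w \<and> w \<otimes>\<^bsub>G\<^esub> c = x then ?t a b c else \<zero>\<^bsub>R\<^esub>)"
    by (intro R.finsum_cong' refl R.finsum_exchange) (auto intro!: R.finsum_closed)
  also have "\<dots> = (\<Oplus>\<^bsub>R\<^esub>c\<in>su h. \<Oplus>\<^bsub>R\<^esub>a\<in>su f. \<Oplus>\<^bsub>R\<^esub>b\<in>su g. if a \<otimes>\<^bsub>G\<^esub> b \<otimes>\<^bsub>G\<^esub> c = x then ?t a b c else \<zero>\<^bsub>R\<^esub>)"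
  proof (intro R.finsum_cong' refl)
    fix a b c assume ab: "a \<in> su f" "b \<in> su g"
    have "(\<Oplus>\<^bsub>R\<^esub>w\<in>W. if a \<otimes>\<^bsub>G\<^esub> b = w \<and> w \<otimes>\<^bsub>G\<^esub> c = x then ?t a b c else \<zero>\<^bsub>R\<^esub>)
      = (\<Oplus>\<^bsub>R\<^esub>w\<in>W. if a \<otimes>\<^bsub>G\<^esub> b = w then (if w \<otimes>\<^bsub>G\<^esub> c = x then ?t a b c else \<zero>\<^bsub>R\<^esub>) else \<zero>\<^bsub>R\<^esub>)"
      by (rule R.finsum_cong') auto
    also have "\<dots> = (if a \<otimes>\<^bsub>G\<^esub> b \<otimes>\<^bsub>G\<^esub> c = x then ?t a b c else \<zero>\<^bsub>R\<^esub>)"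
      by (rule R.finsum_singleton) (use ab in \<open>force simp: W_def\<close>)+
    finally show "(\<Oplus>\<^bsub>R\<^esub>w\<in>W. if a \<otimes>\<^bsub>G\<^esub> b = w \<and> w \<otimes>\<^bsub>G\<^esub> c = x then ?t a b c else \<zero>\<^bsub>R\<^esub>) = \<dots>" .
  qed (auto intro!: R.finsum_closed)
  also have "\<dots> = (\<Oplus>\<^bsub>R\<^esub>a\<in>su f. \<Oplus>\<^bsub>R\<^esub>c\<in>su h. \<Oplus>\<^bsub>R\<^esub>b\<in>su g. if a \<otimes>\<^bsub>G\<^esub> b \<otimes>\<^bsub>G\<^esub> c = x then ?t a b c else \<zero>\<^bsub>R\<^esub>)"
    by (rule R.finsum_exchange) (auto intro!: R.finsum_closed)
  also have "\<dots> = (\<Oplus>\<^bsub>R\<^esub>a\<in>su f. \<Oplus>\<^bsub>R\<^esub>b\<in>su g. \<Oplus>\<^bsub>R\<^esub>c\<in>su h. if a \<otimes>\<^bsub>G\<^esub> b \<otimes>\<^bsub>G\<^esub> c = x then ?t a b c else \<zero>\<^bsub>R\<^esub>)"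
    by (intro R.finsum_cong' refl R.finsum_exchange) (auto intro!: R.finsum_closed)
  finally show ?thesis .
qed

lemma mult_assoc:
  assumes "f \<in> carrier F" "g \<in> carrier F" "h \<in> carrier F"
  shows "(f \<otimes>\<^bsub>F\<^esub> g) \<otimes>\<^bsub>F\<^esub> h = f \<otimes>\<^bsub>F\<^esub> (g \<otimes>\<^bsub>F\<^esub> h)"
proof
  fix x
  note c[simp] = carD(1)[OF assms(1)] carD(1)[OF assms(2)] carD(1)[OF assms(3)]
  note fi[simp] = carD(2)[OF assms(1)] carD(2)[OF assms(2)] carD(2)[OF assms(3)]
  note su = carD(3)[OF assms(1)] carD(3)[OF assms(2)] carD(3)[OF assms(3)]
  have "(f \<otimes>\<^bsub>F\<^esub> (g \<otimes>\<^bsub>F\<^esub> h)) x = ((g \<otimes>\<^bsub>F\<^esub> h) \<otimes>\<^bsub>F\<^esub> f) x"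
    using mult_comm mult_closed assms by metis
  also have "\<dots> = (\<Oplus>\<^bsub>R\<^esub>b\<in>su g. \<Oplus>\<^bsub>R\<^esub>c\<in>su h. \<Oplus>\<^bsub>R\<^esub>a\<in>su f.
     if b \<otimes>\<^bsub>G\<^esub> c \<otimes>\<^bsub>G\<^esub> a = x then g b \<otimes>\<^bsub>R\<^esub> h c \<otimes>\<^bsub>R\<^esub> f a else \<zero>\<^bsub>R\<^esub>)"
    using assms by (intro triple)
  also have "\<dots> = (\<Oplus>\<^bsub>R\<^esub>b\<in>su g. \<Oplus>\<^bsub>R\<^esub>c\<in>su h. \<Oplus>\<^bsub>R\<^esub>a\<in>su f.
     if a \<otimes>\<^bsub>G\<^esub> b \<otimes>\<^bsub>G\<^esub> c = x then f a \<otimes>\<^bsub>R\<^esub> g b \<otimes>\<^bsub>R\<^esub> h c else \<zero>\<^bsub>R\<^esub>)"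
  proof (intro R.finsum_cong' refl)
    fix a b c assume "a \<in> su f" "b \<in> su g" "c \<in> su h"
    hence "a \<in> carrier G" "b \<in> carrier G" "c \<in> carrier G" using su by auto
    hence "b \<otimes>\<^bsub>G\<^esub> c \<otimes>\<^bsub>G\<^esub> a = a \<otimes>\<^bsub>G\<^esub> b \<otimes>\<^bsub>G\<^esub> c" 
      by (simp add: G.m_ac)
    moreover have "g b \<otimes>\<^bsub>R\<^esub> h c \<otimes>\<^bsub>R\<^esub> f a = f a \<otimes>\<^bsub>R\<^esub> g b \<otimes>\<^bsub>R\<^esub> h c" by (simp add: R.m_ac)
    ultimately show "(if b \<otimes>\<^bsub>G\<^esub> c \<otimes>\<^bsub>G\<^esub> a = x then g b \<otimes>\<^bsub>R\<^esub> h c \<otimes>\<^bsub>R\<^esub> f a else \<zero>\<^bsub>R\<^esub>)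
      = (if a \<otimes>\<^bsub>G\<^esub> b \<otimes>\<^bsub>G\<^esub> c = x then f a \<otimes>\<^bsub>R\<^esub> g b \<otimes>\<^bsub>R\<^esub> h c else \<zero>\<^bsub>R\<^esub>)" by simp
  qed (auto intro!: R.finsum_closed)
  also have "\<dots> = (\<Oplus>\<^bsub>R\<^esub>b\<in>su g. \<Oplus>\<^bsub>R\<^esub>a\<in>su f. \<Oplus>\<^bsub>R\<^esub>c\<in>su h. 
     if a \<otimes>\<^bsub>G\<^esub> b \<otimes>\<^bsub>G\<^esub> c = x then f a \<otimes>\<^bsub>R\<^esub> g b \<otimes>\<^bsub>R\<^esub> h c else \<zero>\<^bsub>R\<^esub>)"
    by (intro R.finsum_cong' refl R.finsum_exchange) (auto intro!: R.finsum_closed)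
  also have "\<dots> = (\<Oplus>\<^bsub>R\<^esub>a\<in>su f. \<Oplus>\<^bsub>R\<^esub>b\<in>su g. \<Oplus>\<^bsub>R\<^esub>c\<in>su h. 
     if a \<otimes>\<^bsub>G\<^esub> b \<otimes>\<^bsub>G\<^esub> c = x then f a \<otimes>\<^bsub>R\<^esub> g b \<otimes>\<^bsub>R\<^esub> h c else \<zero>\<^bsub>R\<^esub>)"
    by (rule R.finsum_exchange) (auto intro!: R.finsum_closed)
  also have "\<dots> = ((f \<otimes>\<^bsub>F\<^esub> g) \<otimes>\<^bsub>F\<^esub> h) x" using assms by (intro triple[symmetric])
  finally show "((f \<otimes>\<^bsub>F\<^esub> g) \<otimes>\<^bsub>F\<^esub> h) x = (f \<otimes>\<^bsub>F\<^esub> (g \<otimes>\<^bsub>F\<^esub> h)) x" ..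
qed

lemma one_closed: "\<one>\<^bsub>F\<^esub> \<in> carrier F"
  by (auto simp: monoid_algebra_def)

lemma l_one: assumes "f \<in> carrier F" shows "\<one>\<^bsub>F\<^esub> \<otimes>\<^bsub>F\<^esub> f = f"
proof
  fix x
  note c[simp] = carD(1)[OF assms(1)]
  note fi[simp] = carD(2)[OF assms(1)] 
  note su = carD(3)[OF assms(1)]
  have o: "\<one>\<^bsub>F\<^esub> = (\<lambda>x. if x = \<one>\<^bsub>G\<^esub> then \<one>\<^bsub>R\<^esub> else \<zero>\<^bsub>R\<^esub>)" by (simp add: monoid_algebra_def)
  have "(\<one>\<^bsub>F\<^esub> \<otimes>\<^bsub>F\<^esub> f) x = (\<Oplus>\<^bsub>R\<^esub>y\<in>{\<one>\<^bsub>G\<^esub>}. \<Oplus>\<^bsub>R\<^esub>z\<in>su f \<union> {x}. if y \<otimes>\<^bsub>G\<^esub> z = x then \<one>\<^bsub>F\<^esub> y \<otimes>\<^bsub>R\<^esub> f z else \<zero>\<^bsub>R\<^esub>)"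
    by (rule mult_eq) (use assms one_closed in \<open>auto simp: o\<close>)
  also have "\<dots> = (\<Oplus>\<^bsub>R\<^esub>z\<in>su f \<union> {x}. if \<one>\<^bsub>G\<^esub> \<otimes>\<^bsub>G\<^esub> z = x then f z else \<zero>\<^bsub>R\<^esub>)"
    by (subst R.finsum_insert) (auto simp: o intro!: R.finsum_closed R.finsum_cong')
  also have "\<dots> = (\<Oplus>\<^bsub>R\<^esub>z\<in>su f \<union> {x}. if x = z then f z else \<zero>\<^bsub>R\<^esub>)"
  proof (rule R.finsum_cong')
    fix z assume z: "z \<in> su f \<union> {x}"
    show "(if \<one>\<^bsub>G\<^esub> \<otimes>\<^bsub>G\<^esub> z = x then f z else \<zero>\<^bsub>R\<^esub>) = (if x = z then f z else \<zero>\<^bsub>R\<^esub>)"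
    proof (cases "f z = \<zero>\<^bsub>R\<^esub>")
      case False
      hence "z \<in> carrier G" using su by auto
      thus ?thesis by auto
    qed simp
  qed auto
  also have "\<dots> = f x" by (rule R.finsum_singleton) auto
  finally show "(\<one>\<^bsub>F\<^esub> \<otimes>\<^bsub>F\<^esub> f) x = f x" .
qed

lemma add_F: "f \<oplus>\<^bsub>F\<^esub> h = (\<lambda>x. f x \<oplus>\<^bsub>R\<^esub> h x)" by (simp add: monoid_algebra_def)
lemma smult_F: "r \<odot>\<^bsub>F\<^esub> h = (\<lambda>x. r \<otimes>\<^bsub>R\<^esub> h x)" by (simp add: monoid_algebra_def)

lemma add_closed: assumes "f \<in> carrier F" "h \<in> carrier F" shows "f \<oplus>\<^bsub>F\<^esub> h \<in> carrier F"
proof -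
  have "su (\<lambda>x. f x \<oplus>\<^bsub>R\<^esub> h x) \<subseteq> su f \<union> su h" by auto
  moreover have "finite (su f \<union> su h)" using assms carD(2) by auto
  ultimately have "finite (su (\<lambda>x. f x \<oplus>\<^bsub>R\<^esub> h x))" by (rule finite_subset)
  with assms show ?thesis by (auto simp: monoid_algebra_def)
qed

lemma smult_closed: assumes "r \<in> carrier R" "h \<in> carrier F" shows "r \<odot>\<^bsub>F\<^esub> h \<in> carrier F"
proof -
  have "su (\<lambda>x. r \<otimes>\<^bsub>R\<^esub> h x) \<subseteq> su h" using assms by auto
  moreover have "finite (su h)" using assms carD(2) by auto
  ultimately have "finite (su (\<lambda>x. r \<otimes>\<^bsub>R\<^esub> h x))" by (rule finite_subset)
  with assms show ?thesis by (auto simp: monoid_algebra_def)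
qed

lemma l_distr:
  assumes "f \<in> carrier F" "g \<in> carrier F" "h \<in> carrier F"
  shows "(f \<oplus>\<^bsub>F\<^esub> g) \<otimes>\<^bsub>F\<^esub> h = f \<otimes>\<^bsub>F\<^esub> h \<oplus>\<^bsub>F\<^esub> g \<otimes>\<^bsub>F\<^esub> h"
proof
  fix x
  note c[simp] = carD(1)[OF assms(1)] carD(1)[OF assms(2)] carD(1)[OF assms(3)]
  note fi[simp] = carD(2)[OF assms(1)] carD(2)[OF assms(2)] carD(2)[OF assms(3)]
  let ?S = "\<lambda>f. \<Oplus>\<^bsub>R\<^esub>y\<in>su f \<union> su g. \<Oplus>\<^bsub>R\<^esub>z\<in>su h. if y \<otimes>\<^bsub>G\<^esub> z = x then f y \<otimes>\<^bsub>R\<^esub> h z else \<zero>\<^bsub>R\<^esub>"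
  let ?A = "su f \<union> su g"
  let ?T = "\<lambda>f y. \<Oplus>\<^bsub>R\<^esub>z\<in>su h. if y \<otimes>\<^bsub>G\<^esub> z = x then f y \<otimes>\<^bsub>R\<^esub> h z else \<zero>\<^bsub>R\<^esub>"
  have "((f \<oplus>\<^bsub>F\<^esub> g) \<otimes>\<^bsub>F\<^esub> h) x = (\<Oplus>\<^bsub>R\<^esub>y\<in>?A. ?T (f \<oplus>\<^bsub>F\<^esub> g) y)"
    by (rule mult_eq) (use assms add_closed in \<open>auto simp: add_F\<close>)
  also have "\<dots> = (\<Oplus>\<^bsub>R\<^esub>y\<in>?A. ?T f y \<oplus>\<^bsub>R\<^esub> ?T g y)"
  proof (rule R.finsum_cong')
    fix y
    have "?T (f \<oplus>\<^bsub>F\<^esub> g) y = (\<Oplus>\<^bsub>R\<^esub>z\<in>su h. (if y \<otimes>\<^bsub>G\<^esub> z = x then f y \<otimes>\<^bsub>R\<^esub> h z else \<zero>\<^bsub>R\<^esub>) \<oplus>\<^bsub>R\<^esub> (if y \<otimes>\<^bsub>G\<^esub> z = x then g y \<otimes>\<^bsub>R\<^esub> h z else \<zero>\<^bsub>R\<^esub>))"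
      by (rule R.finsum_cong') (auto simp: add_F R.l_distr)
    also have "\<dots> = ?T f y \<oplus>\<^bsub>R\<^esub> ?T g y" by (rule R.finsum_addf) auto
    finally show "?T (f \<oplus>\<^bsub>F\<^esub> g) y = ?T f y \<oplus>\<^bsub>R\<^esub> ?T g y" .
  qed (auto intro!: R.finsum_closed R.add.m_closed)
  also have "\<dots> = (\<Oplus>\<^bsub>R\<^esub>y\<in>?A. ?T f y) \<oplus>\<^bsub>R\<^esub> (\<Oplus>\<^bsub>R\<^esub>y\<in>?A. ?T g y)"
    by (rule R.finsum_addf) (auto intro!: R.finsum_closed)
  also have "(\<Oplus>\<^bsub>R\<^esub>y\<in>?A. ?T f y) = (f \<otimes>\<^bsub>F\<^esub> h) x" by (rule mult_eq[symmetric]) (use assms in auto)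
  also have "(\<Oplus>\<^bsub>R\<^esub>y\<in>?A. ?T g y) = (g \<otimes>\<^bsub>F\<^esub> h) x" by (rule mult_eq[symmetric]) (use assms in auto)
  finally show "((f \<oplus>\<^bsub>F\<^esub> g) \<otimes>\<^bsub>F\<^esub> h) x = (f \<otimes>\<^bsub>F\<^esub> h \<oplus>\<^bsub>F\<^esub> g \<otimes>\<^bsub>F\<^esub> h) x" by (simp add: add_F)
qed

lemma smult_mult:
  assumes "r \<in> carrier R" "f \<in> carrier F" "h \<in> carrier F"
  shows "(r \<odot>\<^bsub>F\<^esub> f) \<otimes>\<^bsub>F\<^esub> h = r \<odot>\<^bsub>F\<^esub> (f \<otimes>\<^bsub>F\<^esub> h)"
proof
  fix x
  note c[simp] = carD(1)[OF assms(2)] carD(1)[OF assms(3)] assms(1)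
  note fi[simp] = carD(2)[OF assms(2)] carD(2)[OF assms(3)]
  let ?T = "\<lambda>y. \<Oplus>\<^bsub>R\<^esub>z\<in>su h. if y \<otimes>\<^bsub>G\<^esub> z = x then f y \<otimes>\<^bsub>R\<^esub> h z else \<zero>\<^bsub>R\<^esub>"
  have "((r \<odot>\<^bsub>F\<^esub> f) \<otimes>\<^bsub>F\<^esub> h) x = (\<Oplus>\<^bsub>R\<^esub>y\<in>su f. \<Oplus>\<^bsub>R\<^esub>z\<in>su h. if y \<otimes>\<^bsub>G\<^esub> z = x then (r \<odot>\<^bsub>F\<^esub> f) y \<otimes>\<^bsub>R\<^esub> h z else \<zero>\<^bsub>R\<^esub>)"
    by (rule mult_eq) (use assms smult_closed in \<open>auto simp: smult_F\<close>)
  also have "\<dots> = (\<Oplus>\<^bsub>R\<^esub>y\<in>su f. r \<otimes>\<^bsub>R\<^esub> ?T y)"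
  proof (rule R.finsum_cong')
    fix y
    have "r \<otimes>\<^bsub>R\<^esub> ?T y = (\<Oplus>\<^bsub>R\<^esub>z\<in>su h. r \<otimes>\<^bsub>R\<^esub> (if y \<otimes>\<^bsub>G\<^esub> z = x then f y \<otimes>\<^bsub>R\<^esub> h z else \<zero>\<^bsub>R\<^esub>))"
      by (rule R.finsum_rdistr) auto
    also have "\<dots> = (\<Oplus>\<^bsub>R\<^esub>z\<in>su h. if y \<otimes>\<^bsub>G\<^esub> z = x then (r \<odot>\<^bsub>F\<^esub> f) y \<otimes>\<^bsub>R\<^esub> h z else \<zero>\<^bsub>R\<^esub>)"
      by (rule R.finsum_cong') (auto simp: smult_F R.m_assoc)
    finally show "(\<Oplus>\<^bsub>R\<^esub>z\<in>su h. if y \<otimes>\<^bsub>G\<^esub> z = x then (r \<odot>\<^bsub>F\<^esub> f) y \<otimes>\<^bsub>R\<^esub> h z else \<zero>\<^bsub>R\<^esub>) = r \<otimes>\<^bsub>R\<^esub> ?T y" ..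
  qed (auto intro!: R.finsum_closed R.m_closed)
  also have "\<dots> = r \<otimes>\<^bsub>R\<^esub> (\<Oplus>\<^bsub>R\<^esub>y\<in>su f. ?T y)"
    by (rule R.finsum_rdistr[symmetric]) (auto intro!: R.finsum_closed)
  also have "(\<Oplus>\<^bsub>R\<^esub>y\<in>su f. ?T y) = (f \<otimes>\<^bsub>F\<^esub> h) x" by (rule mult_eq[symmetric]) (use assms in auto)
  finally show "((r \<odot>\<^bsub>F\<^esub> f) \<otimes>\<^bsub>F\<^esub> h) x = (r \<odot>\<^bsub>F\<^esub> (f \<otimes>\<^bsub>F\<^esub> h)) x" by (simp add: smult_F)
qed

lemma zero_F: "\<zero>\<^bsub>F\<^esub> = (\<lambda>x. \<zero>\<^bsub>R\<^esub>)" by (simp add: monoid_algebra_def)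

lemma F_abelian: "abelian_group F"
proof (rule abelian_groupI)
  show "\<zero>\<^bsub>F\<^esub> \<in> carrier F" by (auto simp: monoid_algebra_def)
  fix f assume f: "f \<in> carrier F"
  have "su (\<lambda>x. \<ominus>\<^bsub>R\<^esub> f x) = su f" using carD(1)[OF f] by auto
  hence "(\<lambda>x. \<ominus>\<^bsub>R\<^esub> f x) \<in> carrier F" using f by (auto simp: monoid_algebra_def)
  moreover have "(\<lambda>x. \<ominus>\<^bsub>R\<^esub> f x) \<oplus>\<^bsub>F\<^esub> f = \<zero>\<^bsub>F\<^esub>" using carD(1)[OF f] by (auto simp: add_F zero_F R.l_neg)
  ultimately show "\<exists>y\<in>carrier F. y \<oplus>\<^bsub>F\<^esub> f = \<zero>\<^bsub>F\<^esub>" by blast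
qed (auto simp: add_closed, auto simp: add_F zero_F carD(1) R.a_ac)

lemma F_cring: "cring F"
  by (intro cringI F_abelian comm_monoidI mult_closed one_closed mult_assoc l_one mult_comm l_distr)

lemma F_algebra: "algebra R F"
  apply (intro algebraI F_cring R.is_cring)
  apply (auto simp: smult_closed smult_mult)
  apply (auto simp: smult_F add_F carD(1) R.l_distr R.r_distr R.m_assoc)
  done

end

lemma monoid_algebra_is_algebra:
  assumes "cring R" "comm_monoid G" shows "algebra R (monoid_algebra R G)"
proof -
  interpret monoid_algebra_locale R G using assms by (simp add: monoid_algebra_locale_def)
  show ?thesis by (rule F_algebra)
qed

definition basis_vector :: "('r, 'x) ring_scheme \<Rightarrow> 'g \<Rightarrow> 'g \<Rightarrow> 'r"
  where "basis_vector R g = (\<lambda>x. if x = g then \<one>\<^bsub>R\<^esub> else \<zero>\<^bsub>R\<^esub>)"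

text \<open>
  The tensor product \<open>M \<otimes>\<^sub>R N\<close> of two commutative \<open>R\<close>-algebras is the free \<open>R\<close>-module on
  \<open>M \<times> N\<close> modulo the bilinearity relations. As an algebra this free module is the monoid
  algebra of the product of the multiplicative monoids of \<open>M\<close> and \<open>N\<close>. Multiplying a
  relation by a basis vector gives a relation, so the ideal generated by the relations is
  just their \<open>R\<close>-span.
\<close>

abbreviation tensor_free ::
    "('r, 'x) ring_scheme \<Rightarrow> ('r, 'm, 'y) module_scheme \<Rightarrow> ('r, 'n, 'z) module_scheme
      \<Rightarrow> ('r, 'm \<times> 'n \<Rightarrow> 'r) module"
  where "tensor_free R M N \<equiv> monoid_algebra R (M \<times>\<times> N)"

definition tensor_relations ::
    "('r, 'x) ring_scheme \<Rightarrow> ('r, 'm, 'y) module_scheme \<Rightarrow> ('r, 'n, 'z) module_scheme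
      \<Rightarrow> ('m \<times> 'n \<Rightarrow> 'r) set"
  where "tensor_relations R M N =
    (let F = tensor_free R M N; e = (\<lambda>x y. basis_vector R (x, y)) in
       {e (x \<oplus>\<^bsub>M\<^esub> x') y \<ominus>\<^bsub>F\<^esub> (e x y \<oplus>\<^bsub>F\<^esub> e x' y) | x x' y.
          x \<in> carrier M \<and> x' \<in> carrier M \<and> y \<in> carrier N} \<union>
       {e x (y \<oplus>\<^bsub>N\<^esub> y') \<ominus>\<^bsub>F\<^esub> (e x y \<oplus>\<^bsub>F\<^esub> e x y') | x y y'.
          x \<in> carrier M \<and> y \<in> carrier N \<and> y' \<in> carrier N} \<union>
       {e (r \<odot>\<^bsub>M\<^esub> x) y \<ominus>\<^bsub>F\<^esub> (r \<odot>\<^bsub>F\<^esub> e x y) | r x y.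
          r \<in> carrier R \<and> x \<in> carrier M \<and> y \<in> carrier N} \<union>
       {e x (r \<odot>\<^bsub>N\<^esub> y) \<ominus>\<^bsub>F\<^esub> (r \<odot>\<^bsub>F\<^esub> e x y) | r x y.
          r \<in> carrier R \<and> x \<in> carrier M \<and> y \<in> carrier N})"

definition tensor_ideal ::
    "('r, 'x) ring_scheme \<Rightarrow> ('r, 'm, 'y) module_scheme \<Rightarrow> ('r, 'n, 'z) module_scheme
      \<Rightarrow> ('m \<times> 'n \<Rightarrow> 'r) set"
  where "tensor_ideal R M N = Idl\<^bsub>tensor_free R M N\<^esub> (tensor_relations R M N)"

definition tensor_product ::
    "('r, 'x) ring_scheme \<Rightarrow> ('r, 'm, 'y) module_scheme \<Rightarrow> ('r, 'n, 'z) module_scheme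
      \<Rightarrow> ('r, ('m \<times> 'n \<Rightarrow> 'r) set) module"
  where "tensor_product R M N = quotient_algebra (tensor_free R M N) (tensor_ideal R M N)"

definition pure_tensor ::
    "('r, 'x) ring_scheme \<Rightarrow> ('r, 'm, 'y) module_scheme \<Rightarrow> ('r, 'n, 'z) module_scheme
      \<Rightarrow> 'm \<Rightarrow> 'n \<Rightarrow> ('m \<times> 'n \<Rightarrow> 'r) set"
  where "pure_tensor R M N x y = tensor_ideal R M N +>\<^bsub>tensor_free R M N\<^esub> basis_vector R (x, y)"

text \<open>
  The linear map \<open>M \<otimes>\<^sub>R N \<rightarrow> P\<close> induced by an \<open>R\<close>-bilinear map \<open>b\<close>. An element of the
  tensor product is a set of representing formal combinations; for bilinear \<open>b\<close> the result
  is the same for each of them.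
\<close>

definition tensor_lift ::
    "('r, 'x) ring_scheme \<Rightarrow> ('r, 'p, 'y) module_scheme \<Rightarrow> ('m \<Rightarrow> 'n \<Rightarrow> 'p) \<Rightarrow> ('m \<times> 'n \<Rightarrow> 'r) set \<Rightarrow> 'p"
  where "tensor_lift R P b C =
    (let f = (SOME f. f \<in> C) in
       \<Oplus>\<^bsub>P\<^esub>p\<in>{p. f p \<noteq> \<zero>\<^bsub>R\<^esub>}. f p \<odot>\<^bsub>P\<^esub> b (fst p) (snd p))"

text \<open>\<open>g \<otimes> h\<close>, where \<open>M\<close> and \<open>N\<close> are the codomains of \<open>g\<close> and \<open>h\<close>.\<close>

definition tensor_map ::
    "('r, 'x) ring_scheme \<Rightarrow> ('r, 'm, 'y) module_scheme \<Rightarrow> ('r, 'n, 'z) module_scheme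
      \<Rightarrow> ('a \<Rightarrow> 'm) \<Rightarrow> ('b \<Rightarrow> 'n) \<Rightarrow> ('a \<times> 'b \<Rightarrow> 'r) set \<Rightarrow> ('m \<times> 'n \<Rightarrow> 'r) set"
  where "tensor_map R M N g h =
    tensor_lift R (tensor_product R M N) (\<lambda>x y. pure_tensor R M N (g x) (h y))"

text \<open>The associator \<open>(M \<otimes> M) \<otimes> M \<rightarrow> M \<otimes> (M \<otimes> M)\<close>.\<close>

definition tensor_assoc ::
    "('r, 'x) ring_scheme \<Rightarrow> ('r, 'm, 'y) module_scheme
      \<Rightarrow> (('m \<times> 'm \<Rightarrow> 'r) set \<times> 'm \<Rightarrow> 'r) set \<Rightarrow> ('m \<times> ('m \<times> 'm \<Rightarrow> 'r) set \<Rightarrow> 'r) set"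
  where "tensor_assoc R M =
    (let MM = tensor_product R M M; T = tensor_product R M MM in
       tensor_lift R T (\<lambda>C z. tensor_lift R T
         (\<lambda>x y. pure_tensor R M MM x (pure_tensor R M M y z)) C))"

locale hopf_algebra = algebra +
  fixes comult :: "'c \<Rightarrow> ('c \<times> 'c \<Rightarrow> 'a) set" and counit :: "'c \<Rightarrow> 'a" and antipode :: "'c \<Rightarrow> 'c"
  assumes comult_hom: "comult \<in> algebra_hom R M (tensor_product R M M)"
    and counit_hom: "counit \<in> ring_hom M R"
    and counit_smult: "\<lbrakk>r \<in> carrier R; x \<in> carrier M\<rbrakk> \<Longrightarrow> counit (r \<odot>\<^bsub>M\<^esub> x) = r \<otimes>\<^bsub>R\<^esub> counit x"
    and coassoc: "x \<in> carrier M \<Longrightarrow>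
      tensor_assoc R M (tensor_map R (tensor_product R M M) M comult (\<lambda>y. y) (comult x)) =
      tensor_map R M (tensor_product R M M) (\<lambda>y. y) comult (comult x)"
    and counit_left: "x \<in> carrier M \<Longrightarrow> tensor_lift R M (\<lambda>y z. counit y \<odot>\<^bsub>M\<^esub> z) (comult x) = x"
    and counit_right: "x \<in> carrier M \<Longrightarrow> tensor_lift R M (\<lambda>y z. counit z \<odot>\<^bsub>M\<^esub> y) (comult x) = x"
    and antipode_linear: "antipode \<in> linear_maps R M M"
    and antipode_left: "x \<in> carrier M \<Longrightarrow>
      tensor_lift R M (\<lambda>y z. antipode y \<otimes>\<^bsub>M\<^esub> z) (comult x) = counit x \<odot>\<^bsub>M\<^esub> \<one>\<^bsub>M\<^esub>"
    and antipode_right: "x \<in> carrier M \<Longrightarrow>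
      tensor_lift R M (\<lambda>y z. y \<otimes>\<^bsub>M\<^esub> antipode z) (comult x) = counit x \<odot>\<^bsub>M\<^esub> \<one>\<^bsub>M\<^esub>"


section \<open>The field \<open>\<complex>\<^sub>\<infinity>\<close>\<close>

text \<open>
  \<open>F\<^sub>q\<close> is a finite field type \<open>'k\<close>, so \<open>q = CARD('k)\<close> and \<open>p = CHAR('k)\<close>. The field
  \<open>K\<^sub>\<infinity> = F\<^sub>q((1/\<theta>))\<close> is the type \<open>'k fls\<close> with \<open>fls_X\<close> in the role of \<open>1/\<theta>\<close>, and its
  library metric is the one of the absolute value normalised by \<open>\<bar>\<theta>\<bar> = 2\<close>.

  \<open>j\<close> exhibits \<open>'c\<close> as the completion of the algebraic closure of \<open>K\<^sub>\<infinity>\<close>: \<open>'c\<close> is a field,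
  complete for a non-archimedean absolute value \<open>\<lambda>x. dist x 0\<close> extending that of \<open>K\<^sub>\<infinity>\<close>, and
  the algebraic closure is dense in it. This determines \<open>'c\<close> up to a unique isometric
  isomorphism compatible with \<open>j\<close>.
\<close>

locale C_infinity =
  fixes j :: "'k::finite_field fls alg_closure \<Rightarrow> 'c::{field,complete_space}"
  assumes j_one: "j 1 = 1"
    and j_add: "j (x + y) = j x + j y"
    and j_mult: "j (x * y) = j x * j y"
    and dist_translate: "dist ((u::'c) + w) (v + w) = dist u v"
    and dist_mult: "dist ((u::'c) * v) 0 = dist u 0 * dist v 0"
    and dist_ultrametric: "dist (u::'c) w \<le> max (dist u v) (dist v w)"
    and j_isometry: "dist (j (to_ac f)) (j (to_ac g)) = dist f g"
    and j_dense: "closure (range j) = UNIV"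

text \<open>The embedding of \<open>A = F\<^sub>q[\<theta>]\<close> sends the polynomial variable to \<open>\<theta>\<close>.\<close>

definition emb :: "('k::finite_field fls alg_closure \<Rightarrow> 'c) \<Rightarrow> 'k poly \<Rightarrow> 'c"
  where "emb j a = j (to_ac (poly (map_poly fls_const a) fls_X_inv))"

definition theta :: "('k::finite_field fls alg_closure \<Rightarrow> 'c) \<Rightarrow> 'c"
  where "theta j = j (to_ac fls_X_inv)"

definition K_field :: "('k::finite_field fls alg_closure \<Rightarrow> 'c::field) \<Rightarrow> 'c set"
  where "K_field j = {emb j a / emb j b | a b. b \<noteq> 0}"

definition K_bar :: "('k::finite_field fls alg_closure \<Rightarrow> 'c::field) \<Rightarrow> 'c set"
  where "K_bar j = {x. \<exists>P :: 'c poly. P \<noteq> 0 \<and> set (coeffs P) \<subseteq> K_field j \<and> poly P x = 0}"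

definition L_val :: "('k::finite_field fls alg_closure \<Rightarrow> 'c::field) \<Rightarrow> nat \<Rightarrow> 'c"
  where "L_val j d = (\<Prod>i=1..d. theta j - theta j ^ (CARD('k) ^ i))"


section \<open>Multiple zeta values and Carlitz multiple polylogarithms at \<open>1\<close>\<close>

definition indices :: "nat list set"
  where "indices = {s. \<forall>n\<in>set s. 0 < n}"

definition S_val :: "('k::finite_field fls alg_closure \<Rightarrow> 'c::field) \<Rightarrow> nat \<Rightarrow> nat \<Rightarrow> 'c"
  where "S_val j d s = (\<Sum>a | lead_coeff a = 1 \<and> Polynomial.degree a = d. inverse (emb j a ^ s))"

definition nested_sum :: "(nat \<Rightarrow> nat \<Rightarrow> 'c::{field,complete_space}) \<Rightarrow> nat list \<Rightarrow> 'c"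
  where "nested_sum g s =
    (\<Sum>\<^sub>\<infinity>d\<in>{d. length d = length s \<and> sorted_wrt (>) d}. \<Prod>i<length s. g (d ! i) (s ! i))"

definition nested_sum_star_inv :: "(nat \<Rightarrow> nat \<Rightarrow> 'c::{field,complete_space}) \<Rightarrow> nat list \<Rightarrow> 'c"
  where "nested_sum_star_inv g s = (-1) ^ length s *
    (\<Sum>\<^sub>\<infinity>d\<in>{d. length d = length s \<and> sorted_wrt (\<le>) d}. \<Prod>i<length s. g (d ! i) (s ! i))"

lemma nested_sum_Nil [simp]: "nested_sum g [] = 1"
proof -
  have "{d :: nat list. length d = length ([] :: nat list) \<and> sorted_wrt (>) d} = {[]}" by auto
  then show ?thesis unfolding nested_sum_def by (simp only:) simp
qed

lemma nested_sum_star_inv_Nil [simp]: "nested_sum_star_inv g [] = 1"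
proof -
  have "{d :: nat list. length d = length ([] :: nat list) \<and> sorted_wrt (\<le>) d} = {[]}" by auto
  then show ?thesis unfolding nested_sum_star_inv_def by (simp only:) simp
qed

definition zeta_A :: "('k::finite_field fls alg_closure \<Rightarrow> 'c::{field,complete_space}) \<Rightarrow> nat list \<Rightarrow> 'c"
  where "zeta_A j = nested_sum (S_val j)"

definition Li_one :: "('k::finite_field fls alg_closure \<Rightarrow> 'c::{field,complete_space}) \<Rightarrow> nat list \<Rightarrow> 'c"
  where "Li_one j = nested_sum (\<lambda>d n. inverse (L_val j d ^ n))"

definition zeta_A_star_inv :: "('k::finite_field fls alg_closure \<Rightarrow> 'c::{field,complete_space}) \<Rightarrow> nat list \<Rightarrow> 'c"
  where "zeta_A_star_inv j = nested_sum_star_inv (S_val j)"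

definition Li_one_star_inv :: "('k::finite_field fls alg_closure \<Rightarrow> 'c::{field,complete_space}) \<Rightarrow> nat list \<Rightarrow> 'c"
  where "Li_one_star_inv j = nested_sum_star_inv (\<lambda>d n. inverse (L_val j d ^ n))"


section \<open>The algebras \<open>\<ZZ>\<^sub>\<infinity>\<^sub>,\<^sub>R\<close> and their quotients\<close>

text \<open>\<open>R\<close> is an \<open>F\<^sub>p(L\<^sub>1)\<close>-subalgebra of the algebraic closure of \<open>K\<close>.\<close>

definition coefficient_algebra :: "('k::finite_field fls alg_closure \<Rightarrow> 'c::field) \<Rightarrow> 'c set \<Rightarrow> bool"
  where "coefficient_algebra j R \<longleftrightarrow>
    subring R ring_of_type_algebra \<and> generate_field ring_of_type_algebra {L_val j 1} \<subseteq> R \<and> R \<subseteq> K_bar j"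

definition ring_on :: "'c::field set \<Rightarrow> 'c ring"
  where "ring_on R = ring_of_type_algebra\<lparr>carrier := R\<rparr>"

definition Z_alg :: "('k::finite_field fls alg_closure \<Rightarrow> 'c::{field,complete_space}) \<Rightarrow> 'c set \<Rightarrow> ('c, 'c) module"
  where "Z_alg j R =
    \<lparr>carrier = generate_ring ring_of_type_algebra (R \<union> zeta_A j ` indices),
     monoid.mult = (*), one = 1, ring.zero = 0, add = (+), module.smult = (*)\<rparr>"

text \<open>\<open>Z_graded j R w\<close> is the \<open>R\<close>-span of the zeta values of weight \<open>w\<close>.\<close>

definition Z_graded :: "('k::finite_field fls alg_closure \<Rightarrow> 'c::{field,complete_space}) \<Rightarrow> 'c set \<Rightarrow> nat \<Rightarrow> 'c set"
  where "Z_graded j R w =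
    {\<Sum>s\<in>T. r s * zeta_A j s | T r.
       finite T \<and> T \<subseteq> {s \<in> indices. sum_list s = w} \<and> (\<forall>s\<in>T. r s \<in> R)}"

definition zeta_ideal :: "('k::finite_field fls alg_closure \<Rightarrow> 'c::{field,complete_space}) \<Rightarrow> 'c set \<Rightarrow> 'c set"
  where "zeta_ideal j R = PIdl\<^bsub>Z_alg j R\<^esub> (zeta_A j [CARD('k) - 1])"

definition Zbar_alg ::
    "('k::finite_field fls alg_closure \<Rightarrow> 'c::{field,complete_space}) \<Rightarrow> 'c set \<Rightarrow> ('c, 'c set) module"
  where "Zbar_alg j R = quotient_algebra (Z_alg j R) (zeta_ideal j R)"

definition pi_inf :: "('k::finite_field fls alg_closure \<Rightarrow> 'c::{field,complete_space}) \<Rightarrow> 'c set \<Rightarrow> 'c \<Rightarrow> 'c set"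
  where "pi_inf j R z = zeta_ideal j R +>\<^bsub>Z_alg j R\<^esub> z"

text \<open>The property characterising the coaction \<open>\<ZZ>\<^sub>\<infinity>\<^sub>,\<^sub>R \<rightarrow> \<ZZ>\<^sub>\<infinity>\<^sub>,\<^sub>R \<otimes> \<ZZ>\<^sub>\<infinity>\<^sub>,\<^sub>R / \<zeta>\<^sub>A(q - 1)\<close>.\<close>

definition is_coaction ::
    "('k::finite_field fls alg_closure \<Rightarrow> 'c::{field,complete_space}) \<Rightarrow> 'c set
      \<Rightarrow> ('c \<Rightarrow> ('c \<times> 'c set \<Rightarrow> 'c) set) \<Rightarrow> bool"
  where "is_coaction j R D \<longleftrightarrow>
    D \<in> algebra_hom (ring_on R) (Z_alg j R) (tensor_product (ring_on R) (Z_alg j R) (Zbar_alg j R)) \<and>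
    (\<forall>s\<in>indices. D (Li_one j s) =
       (\<Oplus>\<^bsub>tensor_product (ring_on R) (Z_alg j R) (Zbar_alg j R)\<^esub>i\<in>{..length s}.
          pure_tensor (ring_on R) (Z_alg j R) (Zbar_alg j R)
            (Li_one j (take i s)) (pi_inf j R (Li_one j (drop i s)))))"

text \<open>
  \<open>\<Delta>\<^sub>\<infinity>\<close> is the map with \<open>\<Delta>\<^sub>\<infinity> \<circ> \<pi>\<^sub>\<infinity> = (\<pi>\<^sub>\<infinity> \<otimes> id) \<circ> D\<close> for the coaction \<open>D\<close>, and the
  counit is the projection onto the degree-zero part \<open>R\<close>.
\<close>

definition is_coproduct ::
    "('k::finite_field fls alg_closure \<Rightarrow> 'c::{field,complete_space}) \<Rightarrow> 'c set
      \<Rightarrow> ('c \<Rightarrow> ('c \<times> 'c set \<Rightarrow> 'c) set) \<Rightarrow> ('c set \<Rightarrow> ('c set \<times> 'c set \<Rightarrow> 'c) set) \<Rightarrow> bool"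
  where "is_coproduct j R D \<Delta> \<longleftrightarrow>
    (\<forall>z\<in>carrier (Z_alg j R). \<Delta> (pi_inf j R z) =
       tensor_map (ring_on R) (Zbar_alg j R) (Zbar_alg j R) (pi_inf j R) (\<lambda>y. y) (D z))"

definition is_degree_zero_projection ::
    "('k::finite_field fls alg_closure \<Rightarrow> 'c::{field,complete_space}) \<Rightarrow> 'c set \<Rightarrow> ('c set \<Rightarrow> 'c) \<Rightarrow> bool"
  where "is_degree_zero_projection j R \<epsilon> \<longleftrightarrow>
    (\<forall>x\<in>carrier (Zbar_alg j R). \<forall>y\<in>carrier (Zbar_alg j R).
       \<epsilon> (x \<oplus>\<^bsub>Zbar_alg j R\<^esub> y) = \<epsilon> x + \<epsilon> y) \<and>
    (\<forall>r\<in>R. \<epsilon> (pi_inf j R r) = r) \<and>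
    (\<forall>w>0. \<forall>z\<in>Z_graded j R w. \<epsilon> (pi_inf j R z) = 0)"

end

theory Submission
  imports Defs
begin

text \<open>
  Write \<open>y\<^sub>d = 1 / L\<^sub>d\<close> and \<open>u\<^sub>d = \<Sum>\<^bsub>e < d\<^esub> y\<^sub>e\<^bsup>q-1\<^esup>\<close>, so that \<open>u\<^sub>d\<close> tends to \<open>\<zeta>\<^sub>A(q - 1)\<close>. Since
  \<open>y\<^sub>d\<^bsup>q\<^esup> = L\<^sub>1 y\<^bsub>d+1\<^esub> u\<^bsub>d+1\<^esub>\<close>, Carlitz's generating function of the power sums shows that \<open>S\<^sub>d(s)\<close> is a
  polynomial in \<open>y\<^sub>d\<close> and \<open>u\<^sub>d\<close> over \<open>F\<^sub>p(L\<^sub>1)\<close>, divisible by \<open>y\<^sub>d\<close> and with coefficients independent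
  of \<open>d\<close>. Hence all values in question are nested sums of words in the letters \<open>y\<^sup>a u\<^sup>b\<close> with \<open>a \<ge> 1\<close>.

  On words with letters \<open>y\<^sup>a\<close> the coproduct is deconcatenation, and the star-inverse values are the
  convolution inverse of the values, so they compute the antipode. A factor \<open>u\<close> in a letter expands
  into a quasi-shuffle of the remaining word with the letter \<open>y\<^bsup>q-1\<^esup>\<close>; the corresponding expansion of
  the star-inverse values differs by a multiple of \<open>\<zeta>\<^sub>A(q - 1)\<close>, which is zero in the quotient. By
  linearity the antipode is therefore given by the star-inverse values on all words in the letters
  \<open>y\<^sup>a u\<^sup>b\<close>, in particular for the multiple zeta values.
\<close>

section \<open>Nested sums over words of sequences\<close>

text \<open>The antipode recursion works directly only for the polylogarithms: a power sum
  \<open>S_val j d s\<close> differs from \<open>y d ^ s\<close> by terms containing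
  \<open>u\<close>, so the zeta values have to be reduced to words in \<open>y\<close>. A factor
  \<open>u e\<close> in a letter is a sum over indices below \<open>e\<close>. In a strictly
  decreasing sum these are just the indices open to the tail; in a star sum the tail lives at
  indices from \<open>e\<close> on, so the factor is the full sum minus a sum over the range of the
  tail. The full sum converges to the zeta value at q - 1, which the quotient kills.

  A second obstacle is membership: the algebra is generated by R and the zeta values, so limits of
  words in \<open>y\<close> and \<open>u\<close> must be shown to lie in it before the quotient map
  can be applied. For this the expansion of power sums in \<open>y\<close> and \<open>u\<close> is
  inverted by induction on the weight, on truncated sums; the star values follow from the
  convolution identity.

  The field F_p(L_1) enters because theta^(q^i) - theta is minus the sum of L_1^(q^k) over k < i, so
  that all constants in Carlitz's formulas lie in it.\<close>

text \<open>
  A word is a list of sequences. \<open>nsum w N\<close> sums over \<open>N > d\<^sub>1 > \<dots> > d\<^sub>r\<close> and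
  \<open>nsum_star w m N\<close> is \<open>(-1)\<^sup>r\<close> times the sum over \<open>m \<le> d\<^sub>1 \<le> \<dots> \<le> d\<^sub>r < N\<close>.
\<close>

fun nsum :: "(nat \<Rightarrow> 'a::comm_ring_1) list \<Rightarrow> nat \<Rightarrow> 'a" where
  "nsum [] N = 1"
| "nsum (f # w) N = (\<Sum>e<N. f e * nsum w e)"

fun nsum_star :: "(nat \<Rightarrow> 'a::comm_ring_1) list \<Rightarrow> nat \<Rightarrow> nat \<Rightarrow> 'a" where
  "nsum_star [] m N = 1"
| "nsum_star (f # w) m N = - (\<Sum>e\<in>{m..<N}. f e * nsum_star w e N)"

text \<open>
  \<open>qsh mul g w\<close> lists the words of the quasi-shuffle product of the one-letter word \<open>g\<close> with \<open>w\<close>;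
  \<open>mul\<close> merges \<open>g\<close> into a letter.
\<close>

fun qsh :: "('b \<Rightarrow> 'b) \<Rightarrow> 'b \<Rightarrow> 'b list \<Rightarrow> 'b list list" where
  "qsh mul g [] = [[g]]"
| "qsh mul g (f # w) = (g # f # w) # (mul f # w) # map ((#) f) (qsh mul g w)"

abbreviation qshuffle :: "(nat \<Rightarrow> 'a::comm_ring_1) \<Rightarrow> (nat \<Rightarrow> 'a) list \<Rightarrow> (nat \<Rightarrow> 'a) list list"
  where "qshuffle g \<equiv> qsh (\<lambda>f d. f d * g d) g"

lemma sum_sum_list_swap: "(\<Sum>e\<in>A. \<Sum>x\<leftarrow>xs. f e x :: 'a::comm_monoid_add) = (\<Sum>x\<leftarrow>xs. \<Sum>e\<in>A. f e x)"
  by (induction xs) (simp_all add: sum.distrib)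

text \<open>The index of \<open>g\<close> is larger than, equal to or smaller than the first index
  of the word, which is its largest one; these cases are the three kinds of words in the recursion
  of \<open>qsh\<close>.\<close>

lemma nsum_qshuffle:
  "(\<Sum>e<N. g e) * nsum w N = (\<Sum>v\<leftarrow>qshuffle g w. nsum v N)"
proof (induction w arbitrary: N)
  case Nil
  then show ?case by simp
next
  case (Cons f w)
  have IH: "(\<Sum>v\<leftarrow>qshuffle g w. nsum (f # v) N) = (\<Sum>e<N. f e * ((\<Sum>e'<e. g e') * nsum w e))" for N
    by (simp add: Cons sum_list_const_mult flip: sum_sum_list_swap)
  have "(\<Sum>e<N. g e) * nsum (f # w) N =
    (\<Sum>e<N. g e * nsum (f # w) e) + (\<Sum>e<N. f e * g e * nsum w e)
      + (\<Sum>e<N. f e * ((\<Sum>e'<e. g e') * nsum w e))"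
    by (induction N) (simp_all add: algebra_simps)
  then show ?case by (simp add: comp_def IH[simplified] add.assoc)
qed

text \<open>The tail \<open>w\<close> and the partial sum of \<open>g\<close> have the same bound
  \<open>e\<close>, so \<open>nsum_qshuffle\<close> applies to their product; the prefix
  \<open>p\<close> is carried along.\<close>

lemma nsum_qshuffle_insert:
  "nsum (p @ (\<lambda>e. f e * (\<Sum>e'<e. g e')) # w) N = (\<Sum>v\<leftarrow>qshuffle g w. nsum (p @ f # v) N)"
proof (induction p arbitrary: N)
  case Nil
  show ?case
    by (simp add: mult.assoc nsum_qshuffle sum_list_const_mult flip: sum_sum_list_swap)
next
  case (Cons h p)
  then show ?case by (simp add: sum_list_const_mult flip: sum_sum_list_swap)
qed

text \<open>The same list of words serves for weak inequalities: a tie between \<open>g\<close> and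
  a letter is counted in both orders, and the merged word, shorter by one, enters with the opposite
  sign and removes one of the two.\<close>

lemma nsum_star_qshuffle:
  assumes "m \<le> N"
  shows "(\<Sum>v\<leftarrow>qshuffle g w. nsum_star v m N) = - (\<Sum>e\<in>{m..<N}. g e) * nsum_star w m N"
  using assms
proof (induction w arbitrary: m)
  case Nil
  then show ?case by simp
next
  case (Cons f w)
  have "(\<Sum>v\<leftarrow>qshuffle g w. nsum_star (f # v) m N) = - (\<Sum>e\<in>{m..<N}. f e * (\<Sum>v\<leftarrow>qshuffle g w. nsum_star v e N))"
    by (simp add: sum_list_const_mult flip: sum_sum_list_swap uminus_sum_list_map[unfolded comp_def])
  also have "\<dots> = (\<Sum>e\<in>{m..<N}. f e * (\<Sum>e'\<in>{e..<N}. g e') * nsum_star w e N)"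
    unfolding sum_negf[symmetric] by (intro sum.cong refl) (use Cons.IH in \<open>auto simp: mult_ac\<close>)
  finally have IH: "(\<Sum>v\<leftarrow>qshuffle g w. nsum_star (f # v) m N) = (\<Sum>e\<in>{m..<N}. f e * (\<Sum>e'\<in>{e..<N}. g e') * nsum_star w e N)" .
  have "- (\<Sum>e\<in>{m..<N}. g e * nsum_star (f # w) e N) - (\<Sum>e\<in>{m..<N}. f e * g e * nsum_star w e N)
      + (\<Sum>e\<in>{m..<N}. f e * (\<Sum>e'\<in>{e..<N}. g e') * nsum_star w e N)
     = - (\<Sum>e\<in>{m..<N}. g e) * nsum_star (f # w) m N"
    using \<open>m \<le> N\<close>
  \<comment> \<open>A star sum is peeled at its lower bound, so the induction descends from
    \<open>N\<close> to \<open>m\<close>.\<close>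
  proof (induction rule: inc_induct)
    case base
    show ?case by simp
  next
    case (step k)
    have s: "(\<Sum>e\<in>{k..<N}. h e) = h k + (\<Sum>e\<in>{Suc k..<N}. h e)" for h :: "nat \<Rightarrow> 'a"
      using step by (simp add: sum.atLeast_Suc_lessThan)
    show ?case using step.IH
      unfolding nsum_star.simps s by (simp add: algebra_simps)
  qed
  then show ?case using IH by (simp add: comp_def algebra_simps)
qed

text \<open>Behind the letter \<open>f\<close> at index \<open>e\<close> the shuffled
  \<open>g\<close> ranges from \<open>e\<close> up to \<open>N\<close>, the complement of the
  partial sum below \<open>e\<close>. The full sum up to \<open>N\<close> is left over as the
  correction term.\<close>

lemma nsum_star_qshuffle_insert:
  assumes "m \<le> N"
  shows "(\<Sum>v\<leftarrow>qshuffle g w. nsum_star (p @ f # v) m N) =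
    nsum_star (p @ (\<lambda>e. f e * (\<Sum>e'<e. g e')) # w) m N - (\<Sum>e<N. g e) * nsum_star (p @ f # w) m N"
  using assms
proof (induction p arbitrary: m)
  case Nil
  have s: "(\<Sum>e'\<in>{e..<N}. g e') = (\<Sum>e'<N. g e') - (\<Sum>e'<e. g e')" if "e < N" for e
  proof -
    have "{..<N} = {..<e} \<union> {e..<N}" "{..<e} \<inter> {e..<N} = {}" using that by auto
    then have "(\<Sum>e'<N. g e') = (\<Sum>e'<e. g e') + (\<Sum>e'\<in>{e..<N}. g e')"
      by (simp add: sum.union_disjoint)
    then show ?thesis by simp
  qed
  have "(\<Sum>v\<leftarrow>qshuffle g w. nsum_star (f # v) m N) = - (\<Sum>e\<in>{m..<N}. f e * (\<Sum>v\<leftarrow>qshuffle g w. nsum_star v e N))"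
    by (simp add: sum_list_const_mult flip: sum_sum_list_swap uminus_sum_list_map[unfolded comp_def])
  also have "\<dots> = (\<Sum>e\<in>{m..<N}. f e * ((\<Sum>e'<N. g e') - (\<Sum>e'<e. g e')) * nsum_star w e N)"
    unfolding sum_negf[symmetric]
    by (intro sum.cong refl) (auto simp: nsum_star_qshuffle s algebra_simps)
  finally have *: "(\<Sum>v\<leftarrow>qshuffle g w. nsum_star (f # v) m N) =
      (\<Sum>e\<in>{m..<N}. f e * ((\<Sum>e'<N. g e') - (\<Sum>e'<e. g e')) * nsum_star w e N)" .
  define G where "G e = (\<Sum>e'<e. g e')" for e
  show ?case using * unfolding append.simps nsum_star.simps G_def[symmetric]
    by (simp add: algebra_simps sum_subtractf sum_distrib_left)
next
  case (Cons h p)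
  have "(\<Sum>v\<leftarrow>qshuffle g w. nsum_star ((h # p) @ f # v) m N) =
      - (\<Sum>e\<in>{m..<N}. h e * (\<Sum>v\<leftarrow>qshuffle g w. nsum_star (p @ f # v) e N))"
    by (simp add: sum_list_const_mult flip: sum_sum_list_swap uminus_sum_list_map[unfolded comp_def])
  also have "\<dots> = - (\<Sum>e\<in>{m..<N}. h e * (nsum_star (p @ (\<lambda>e. f e * (\<Sum>e'<e. g e')) # w) e N
      - (\<Sum>e<N. g e) * nsum_star (p @ f # w) e N))"
    using Cons.IH by simp
  finally show ?case by (simp add: algebra_simps sum_subtractf sum_distrib_left)
qed

text \<open>Splitting off the first letter turns the terms with positive \<open>i\<close> into the
  same convolution for \<open>w\<close> with lower bound \<open>e\<close>, hence the general
  \<open>m\<close>. At \<open>m = 0\<close> the right-hand side vanishes on nonempty words, so the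
  star sums are the convolution inverse of the ordinary ones.\<close>

lemma nsum_star_nsum_convolution:
  assumes "m \<le> N"
  shows "(\<Sum>i\<le>length w. nsum_star (take i w) m N * nsum (drop i w) N) = nsum w m"
  using assms
proof (induction w arbitrary: m)
  case Nil
  then show ?case by simp
next
  case (Cons f w)
  have split: "{..<N} = {..<m} \<union> {m..<N}" "{..<m} \<inter> {m..<N} = {}" using Cons.prems by auto
  have "(\<Sum>i\<le>length w. nsum_star (take (Suc i) (f # w)) m N * nsum (drop (Suc i) (f # w)) N) =
     - (\<Sum>e\<in>{m..<N}. f e * (\<Sum>i\<le>length w. nsum_star (take i w) e N * nsum (drop i w) N))"
    by (simp add: sum_distrib_left sum_distrib_right sum_negf mult.assoc) (rule sum.swap)
  also have "\<dots> = - (\<Sum>e\<in>{m..<N}. f e * nsum w e)"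
    using Cons by simp
  finally show ?case
    unfolding length_Cons sum.atMost_Suc_shift
    by (simp add: split sum.union_disjoint)
qed

lemma nsum_linear:
  "nsum (p @ (\<lambda>d. f d + r * h d) # w) N = nsum (p @ f # w) N + r * nsum (p @ h # w) N"
  by (induction p arbitrary: N) (simp_all add: algebra_simps sum.distrib sum_distrib_left)

lemma nsum_star_linear:
  "nsum_star (p @ (\<lambda>d. f d + r * h d) # w) m N =
    nsum_star (p @ f # w) m N + r * nsum_star (p @ h # w) m N"
  by (induction p arbitrary: m) (simp_all add: algebra_simps sum.distrib sum_distrib_left)

lemma nsum_zero: "nsum (p @ (\<lambda>d. 0) # w) N = 0"
  by (induction p arbitrary: N) simp_all

lemma nsum_star_zero: "nsum_star (p @ (\<lambda>d. 0) # w) m N = 0"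
  by (induction p arbitrary: m) simp_all

text \<open>Lets a shuffle be computed on exponent pairs, where an induction measure is available,
  and then be read as a list of words of sequences.\<close>

lemma map_qsh:
  assumes "\<And>a. h (mul a) = mul' (h a)"
  shows "map (map h) (qsh mul g w) = qsh mul' (h g) (map h w)"
proof (induction w)
  case (Cons f w)
  have "map (map h) (map ((#) f) (qsh mul g w)) = map ((#) (h f)) (map (map h) (qsh mul g w))"
    by simp
  then show ?case by (simp only: qsh.simps list.map Cons assms)
qed simp

section \<open>Linear maps out of tensor products\<close>

locale monoid_algebra_eval = monoid_algebra_locale R G + P: module R P
  for R :: "('r, 'x) ring_scheme" (structure) and G :: "('g, 'y) monoid_scheme" (structure)
    and P :: "('r, 'p, 'z) module_scheme" (structure)
begin

definition ev :: "('g \<Rightarrow> 'p) \<Rightarrow> ('g \<Rightarrow> 'r) \<Rightarrow> 'p"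
  where "ev \<beta> f = (\<Oplus>\<^bsub>P\<^esub>p\<in>su f. f p \<odot>\<^bsub>P\<^esub> \<beta> p)"

lemma ev_superset:
  assumes "f \<in> carrier F" "\<And>p. \<beta> p \<in> carrier P" "finite A" "su f \<subseteq> A"
  shows "ev \<beta> f = (\<Oplus>\<^bsub>P\<^esub>p\<in>A. f p \<odot>\<^bsub>P\<^esub> \<beta> p)"
  unfolding ev_def
  by (rule P.add.finprod_mono_neutral_cong_left) (use assms carD(1)[OF assms(1)] in auto)

lemma ev_closed:
  assumes "f \<in> carrier F" "\<And>p. \<beta> p \<in> carrier P" shows "ev \<beta> f \<in> carrier P"
  unfolding ev_def by (rule P.finsum_closed) (use assms carD(1)[OF assms(1)] in auto)

lemma ev_cong:
  assumes "f \<in> carrier F" "\<And>p. p \<in> carrier G \<Longrightarrow> \<beta> p = \<beta>' p" "\<And>p. p \<in> carrier G \<Longrightarrow> \<beta>' p \<in> carrier P"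
  shows "ev \<beta> f = ev \<beta>' f"
  unfolding ev_def
  by (rule P.finsum_cong') (use assms carD(1,3)[OF assms(1)] in auto)

lemma ev_add:
  assumes "f \<in> carrier F" "h \<in> carrier F" "\<And>p. \<beta> p \<in> carrier P"
  shows "ev \<beta> (f \<oplus>\<^bsub>F\<^esub> h) = ev \<beta> f \<oplus>\<^bsub>P\<^esub> ev \<beta> h"
proof -
  note c[simp] = carD(1)[OF assms(1)] carD(1)[OF assms(2)]
  let ?A = "su f \<union> su h"
  have A: "finite ?A" using assms carD(2) by auto
  have "ev \<beta> (f \<oplus>\<^bsub>F\<^esub> h) = (\<Oplus>\<^bsub>P\<^esub>p\<in>?A. (f \<oplus>\<^bsub>F\<^esub> h) p \<odot>\<^bsub>P\<^esub> \<beta> p)"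
    by (rule ev_superset) (use assms A add_closed in \<open>auto simp: add_F\<close>)
  also have "\<dots> = (\<Oplus>\<^bsub>P\<^esub>p\<in>?A. f p \<odot>\<^bsub>P\<^esub> \<beta> p \<oplus>\<^bsub>P\<^esub> h p \<odot>\<^bsub>P\<^esub> \<beta> p)"
    by (rule P.finsum_cong') (use assms in \<open>auto simp: add_F P.smult_l_distr\<close>)
  also have "\<dots> = (\<Oplus>\<^bsub>P\<^esub>p\<in>?A. f p \<odot>\<^bsub>P\<^esub> \<beta> p) \<oplus>\<^bsub>P\<^esub> (\<Oplus>\<^bsub>P\<^esub>p\<in>?A. h p \<odot>\<^bsub>P\<^esub> \<beta> p)"
    by (rule P.finsum_addf) (use assms in auto)
  also have "\<dots> = ev \<beta> f \<oplus>\<^bsub>P\<^esub> ev \<beta> h"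
    using ev_superset[OF assms(1,3) A] ev_superset[OF assms(2,3) A] by auto
  finally show ?thesis .
qed

lemma ev_smult:
  assumes "r \<in> carrier R" "f \<in> carrier F" "\<And>p. \<beta> p \<in> carrier P"
  shows "ev \<beta> (r \<odot>\<^bsub>F\<^esub> f) = r \<odot>\<^bsub>P\<^esub> ev \<beta> f"
proof -
  note c[simp] = carD(1)[OF assms(2)] assms(1,3)
  have A: "finite (su f)" using assms carD(2) by auto
  have "ev \<beta> (r \<odot>\<^bsub>F\<^esub> f) = (\<Oplus>\<^bsub>P\<^esub>p\<in>su f. (r \<odot>\<^bsub>F\<^esub> f) p \<odot>\<^bsub>P\<^esub> \<beta> p)"
    by (rule ev_superset) (use assms A smult_closed in \<open>auto simp: smult_F\<close>)
  also have "\<dots> = (\<Oplus>\<^bsub>P\<^esub>p\<in>su f. r \<odot>\<^bsub>P\<^esub> (f p \<odot>\<^bsub>P\<^esub> \<beta> p))"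
    by (rule P.finsum_cong') (auto simp: smult_F P.smult_assoc1)
  also have "\<dots> = r \<odot>\<^bsub>P\<^esub> ev \<beta> f"
    unfolding ev_def by (rule P.finsum_smult_ldistr[symmetric]) (use A in auto)
  finally show ?thesis .
qed

lemma ev_minus:
  assumes "f \<in> carrier F" "h \<in> carrier F" "\<And>p. \<beta> p \<in> carrier P"
  shows "ev \<beta> (f \<ominus>\<^bsub>F\<^esub> h) = ev \<beta> f \<ominus>\<^bsub>P\<^esub> ev \<beta> h"
proof -
  interpret F: cring F by (rule F_cring)
  have "ev \<beta> (f \<ominus>\<^bsub>F\<^esub> h) \<oplus>\<^bsub>P\<^esub> ev \<beta> h = ev \<beta> (f \<ominus>\<^bsub>F\<^esub> h \<oplus>\<^bsub>F\<^esub> h)"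
    using assms by (intro ev_add[symmetric]) auto
  also have "f \<ominus>\<^bsub>F\<^esub> h \<oplus>\<^bsub>F\<^esub> h = f"
    using assms F.minus_eq F.add.inv_solve_right' by (simp add: F.a_assoc F.l_neg)
  finally have *: "ev \<beta> (f \<ominus>\<^bsub>F\<^esub> h) \<oplus>\<^bsub>P\<^esub> ev \<beta> h = ev \<beta> f" .
  have c: "ev \<beta> (f \<ominus>\<^bsub>F\<^esub> h) \<in> carrier P" "ev \<beta> h \<in> carrier P"
    using assms by (auto intro!: ev_closed)
  show ?thesis unfolding *[symmetric] using c by (simp add: P.minus_eq P.a_assoc P.r_neg)
qed

lemma basis_vector_closed: "g \<in> carrier G \<Longrightarrow> basis_vector R g \<in> carrier F"
  by (auto simp: carF basis_vector_def)

lemma ev_basis_vector: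
  assumes "\<And>p. \<beta> p \<in> carrier P" "g \<in> carrier G"
  shows "ev \<beta> (basis_vector R g) = \<beta> g"
proof -
  have "ev \<beta> (basis_vector R g) = (\<Oplus>\<^bsub>P\<^esub>p\<in>{g}. basis_vector R g p \<odot>\<^bsub>P\<^esub> \<beta> p)"
    by (rule ev_superset) (use assms basis_vector_closed in \<open>auto simp: basis_vector_def\<close>)
  then show ?thesis using assms by (simp add: basis_vector_def)
qed

text \<open>Expresses the value at a product through translates of \<open>\<beta>\<close>, which is
  what makes \<open>stable_kernel\<close> absorb multiplication.\<close>

lemma ev_mult:
  assumes "f \<in> carrier F" "h \<in> carrier F" and b[simp]: "\<And>p. \<beta> p \<in> carrier P"
  shows "ev \<beta> (f \<otimes>\<^bsub>F\<^esub> h) = (\<Oplus>\<^bsub>P\<^esub>k\<in>su f. f k \<odot>\<^bsub>P\<^esub> ev (\<lambda>l. \<beta> (k \<otimes>\<^bsub>G\<^esub> l)) h)"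
proof -
  note c[simp] = carD(1)[OF assms(1)] carD(1)[OF assms(2)]
  note fi[simp] = carD(2)[OF assms(1)] carD(2)[OF assms(2)]
  define W where "W = (\<lambda>p. fst p \<otimes>\<^bsub>G\<^esub> snd p) ` (su f \<times> su h)"
  have W[simp]: "finite W" by (simp add: W_def)
  let ?t = "\<lambda>w k l. if k \<otimes>\<^bsub>G\<^esub> l = w then (f k \<otimes>\<^bsub>R\<^esub> h l) \<odot>\<^bsub>P\<^esub> \<beta> w else \<zero>\<^bsub>P\<^esub>"
  have ldistr: "(\<Oplus>\<^bsub>R\<^esub>i\<in>A. g i) \<odot>\<^bsub>P\<^esub> x = (\<Oplus>\<^bsub>P\<^esub>i\<in>A. g i \<odot>\<^bsub>P\<^esub> x)"
    if "finite A" "\<And>i. g i \<in> carrier R" "x \<in> carrier P" for A :: "'g set" and g x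
    using that(1)
  proof induction
    case empty then show ?case using that by simp
  next
    case (insert i A)
    then show ?case using that
      by (simp add: P.smult_l_distr Pi_def)
  qed
  have "ev \<beta> (f \<otimes>\<^bsub>F\<^esub> h) = (\<Oplus>\<^bsub>P\<^esub>w\<in>W. (f \<otimes>\<^bsub>F\<^esub> h) w \<odot>\<^bsub>P\<^esub> \<beta> w)"
    by (rule ev_superset) (use assms mult_closed mult_supp in \<open>auto simp: W_def\<close>)
  also have "\<dots> = (\<Oplus>\<^bsub>P\<^esub>w\<in>W. \<Oplus>\<^bsub>P\<^esub>k\<in>su f. \<Oplus>\<^bsub>P\<^esub>l\<in>su h. ?t w k l)"
  proof (intro P.finsum_cong' refl)
    fix w
    have "(f \<otimes>\<^bsub>F\<^esub> h) w \<odot>\<^bsub>P\<^esub> \<beta> w = (\<Oplus>\<^bsub>R\<^esub>k\<in>su f. \<Oplus>\<^bsub>R\<^esub>l\<in>su h. if k \<otimes>\<^bsub>G\<^esub> l = w then f k \<otimes>\<^bsub>R\<^esub> h l else \<zero>\<^bsub>R\<^esub>) \<odot>\<^bsub>P\<^esub> \<beta> w"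
      by (subst mult_eq[where A = "su f" and B = "su h"]) (use assms in auto)
    also have "\<dots> = (\<Oplus>\<^bsub>P\<^esub>k\<in>su f. (\<Oplus>\<^bsub>R\<^esub>l\<in>su h. if k \<otimes>\<^bsub>G\<^esub> l = w then f k \<otimes>\<^bsub>R\<^esub> h l else \<zero>\<^bsub>R\<^esub>) \<odot>\<^bsub>P\<^esub> \<beta> w)"
      by (rule ldistr) (auto intro!: R.finsum_closed)
    also have "\<dots> = (\<Oplus>\<^bsub>P\<^esub>k\<in>su f. \<Oplus>\<^bsub>P\<^esub>l\<in>su h. (if k \<otimes>\<^bsub>G\<^esub> l = w then f k \<otimes>\<^bsub>R\<^esub> h l else \<zero>\<^bsub>R\<^esub>) \<odot>\<^bsub>P\<^esub> \<beta> w)"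
      by (intro P.finsum_cong' refl ldistr) (auto intro!: P.finsum_closed)
    also have "\<dots> = (\<Oplus>\<^bsub>P\<^esub>k\<in>su f. \<Oplus>\<^bsub>P\<^esub>l\<in>su h. ?t w k l)"
      by (intro P.finsum_cong' refl) (auto intro!: P.finsum_closed)
    finally show "(f \<otimes>\<^bsub>F\<^esub> h) w \<odot>\<^bsub>P\<^esub> \<beta> w = (\<Oplus>\<^bsub>P\<^esub>k\<in>su f. \<Oplus>\<^bsub>P\<^esub>l\<in>su h. ?t w k l)" .
  qed (auto intro!: P.finsum_closed)
  also have "\<dots> = (\<Oplus>\<^bsub>P\<^esub>k\<in>su f. \<Oplus>\<^bsub>P\<^esub>w\<in>W. \<Oplus>\<^bsub>P\<^esub>l\<in>su h. ?t w k l)"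
    by (rule P.finsum_exchange) (auto intro!: P.finsum_closed)
  also have "\<dots> = (\<Oplus>\<^bsub>P\<^esub>k\<in>su f. f k \<odot>\<^bsub>P\<^esub> ev (\<lambda>l. \<beta> (k \<otimes>\<^bsub>G\<^esub> l)) h)"
  proof (intro P.finsum_cong' refl)
    fix k assume k: "k \<in> su f"
    have "(\<Oplus>\<^bsub>P\<^esub>w\<in>W. \<Oplus>\<^bsub>P\<^esub>l\<in>su h. ?t w k l) = (\<Oplus>\<^bsub>P\<^esub>l\<in>su h. \<Oplus>\<^bsub>P\<^esub>w\<in>W. ?t w k l)"
      by (rule P.finsum_exchange) auto
    also have "\<dots> = (\<Oplus>\<^bsub>P\<^esub>l\<in>su h. f k \<odot>\<^bsub>P\<^esub> (h l \<odot>\<^bsub>P\<^esub> \<beta> (k \<otimes>\<^bsub>G\<^esub> l)))"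
    proof (intro P.finsum_cong' refl)
      fix l assume l: "l \<in> su h"
      have "k \<otimes>\<^bsub>G\<^esub> l \<in> W" using k l unfolding W_def by force
      then have "(\<Oplus>\<^bsub>P\<^esub>w\<in>W. if k \<otimes>\<^bsub>G\<^esub> l = w then (f k \<otimes>\<^bsub>R\<^esub> h l) \<odot>\<^bsub>P\<^esub> \<beta> w else \<zero>\<^bsub>P\<^esub>) = (f k \<otimes>\<^bsub>R\<^esub> h l) \<odot>\<^bsub>P\<^esub> \<beta> (k \<otimes>\<^bsub>G\<^esub> l)"
        by (intro P.finsum_singleton) auto
      then show "(\<Oplus>\<^bsub>P\<^esub>w\<in>W. ?t w k l) = f k \<odot>\<^bsub>P\<^esub> (h l \<odot>\<^bsub>P\<^esub> \<beta> (k \<otimes>\<^bsub>G\<^esub> l))"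
        by (simp add: P.smult_assoc1)
    qed auto
    also have "\<dots> = f k \<odot>\<^bsub>P\<^esub> ev (\<lambda>l. \<beta> (k \<otimes>\<^bsub>G\<^esub> l)) h"
      unfolding ev_def by (rule P.finsum_smult_ldistr[symmetric]) auto
    finally show "(\<Oplus>\<^bsub>P\<^esub>w\<in>W. \<Oplus>\<^bsub>P\<^esub>l\<in>su h. ?t w k l) = f k \<odot>\<^bsub>P\<^esub> ev (\<lambda>l. \<beta> (k \<otimes>\<^bsub>G\<^esub> l)) h" .
  qed (auto intro!: ev_closed assms)
  finally show ?thesis .
qed

text \<open>
  The kernel of \<open>ev \<beta>\<close> is only a submodule, but the elements all of whose translates lie in it form
  an ideal.
\<close>

definition stable_kernel :: "('g \<Rightarrow> 'p) \<Rightarrow> ('g \<Rightarrow> 'r) set"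
  where "stable_kernel \<beta> = {f \<in> carrier F. \<forall>k\<in>carrier G. ev (\<lambda>l. \<beta> (k \<otimes>\<^bsub>G\<^esub> l)) f = \<zero>\<^bsub>P\<^esub>}"

lemma stable_kernel_ideal:
  assumes b[simp]: "\<And>p. \<beta> p \<in> carrier P"
  shows "ideal (stable_kernel \<beta>) F"
proof -
  interpret F: cring F by (rule F_cring)
  have zero: "ev \<beta>' \<zero>\<^bsub>F\<^esub> = \<zero>\<^bsub>P\<^esub>" for \<beta>'
    unfolding ev_def zero_F by simp
  have left: "h \<otimes>\<^bsub>F\<^esub> f \<in> stable_kernel \<beta>" if h: "h \<in> carrier F" and f: "f \<in> stable_kernel \<beta>" for f h
  proof -
    have fF: "f \<in> carrier F" using f by (simp add: stable_kernel_def)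
    have "ev (\<lambda>l. \<beta> (k \<otimes>\<^bsub>G\<^esub> l)) (h \<otimes>\<^bsub>F\<^esub> f) = \<zero>\<^bsub>P\<^esub>" if k: "k \<in> carrier G" for k
    proof -
      have "ev (\<lambda>l. \<beta> (k \<otimes>\<^bsub>G\<^esub> l)) (h \<otimes>\<^bsub>F\<^esub> f)
        = (\<Oplus>\<^bsub>P\<^esub>m\<in>su h. h m \<odot>\<^bsub>P\<^esub> ev (\<lambda>l. \<beta> (k \<otimes>\<^bsub>G\<^esub> (m \<otimes>\<^bsub>G\<^esub> l))) f)"
        by (rule ev_mult[OF h fF]) simp
      also have "\<dots> = (\<Oplus>\<^bsub>P\<^esub>m\<in>su h. \<zero>\<^bsub>P\<^esub>)"
      proof (intro P.finsum_cong' refl)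
        fix m assume m: "m \<in> su h"
        then have mG: "m \<in> carrier G" using carD(3)[OF h] by auto
        have "ev (\<lambda>l. \<beta> (k \<otimes>\<^bsub>G\<^esub> (m \<otimes>\<^bsub>G\<^esub> l))) f = ev (\<lambda>l. \<beta> ((k \<otimes>\<^bsub>G\<^esub> m) \<otimes>\<^bsub>G\<^esub> l)) f"
          by (rule ev_cong[OF fF]) (use k mG in \<open>auto simp: G.m_assoc\<close>)
        also have "\<dots> = \<zero>\<^bsub>P\<^esub>" using f k mG by (auto simp: stable_kernel_def)
        finally show "h m \<odot>\<^bsub>P\<^esub> ev (\<lambda>l. \<beta> (k \<otimes>\<^bsub>G\<^esub> (m \<otimes>\<^bsub>G\<^esub> l))) f = \<zero>\<^bsub>P\<^esub>"
          using carD(1)[OF h] by simp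
      qed auto
      finally show ?thesis by simp
    qed
    then show ?thesis using h fF by (auto simp: stable_kernel_def)
  qed
  show ?thesis
  proof (rule idealI[OF F.ring_axioms])
    show "subgroup (stable_kernel \<beta>) (add_monoid F)"
    proof (rule F.add.subgroupI)
      show "stable_kernel \<beta> \<subseteq> carrier F" by (auto simp: stable_kernel_def)
      show "stable_kernel \<beta> \<noteq> {}" using zero F.zero_closed unfolding stable_kernel_def by blast
    next
      fix f assume "f \<in> stable_kernel \<beta>"
      then have f: "f \<in> carrier F" "\<And>k. k \<in> carrier G \<Longrightarrow> ev (\<lambda>l. \<beta> (k \<otimes>\<^bsub>G\<^esub> l)) f = \<zero>\<^bsub>P\<^esub>"
        by (auto simp: stable_kernel_def)
      have "ev (\<lambda>l. \<beta> (k \<otimes>\<^bsub>G\<^esub> l)) (\<ominus>\<^bsub>F\<^esub> f) = \<zero>\<^bsub>P\<^esub>" if k: "k \<in> carrier G" for k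
      proof -
        have "ev (\<lambda>l. \<beta> (k \<otimes>\<^bsub>G\<^esub> l)) (\<zero>\<^bsub>F\<^esub> \<ominus>\<^bsub>F\<^esub> f) = \<zero>\<^bsub>P\<^esub>"
          using ev_minus[OF F.zero_closed f(1), of "\<lambda>l. \<beta> (k \<otimes>\<^bsub>G\<^esub> l)"] f k zero by (simp add: P.minus_eq)
        then show ?thesis using f(1) by (simp add: F.minus_eq)
      qed
      then show "\<ominus>\<^bsub>F\<^esub> f \<in> stable_kernel \<beta>"
        using f(1) by (auto simp: stable_kernel_def)
    next
      fix f h assume "f \<in> stable_kernel \<beta>" "h \<in> stable_kernel \<beta>"
      then show "f \<oplus>\<^bsub>F\<^esub> h \<in> stable_kernel \<beta>"
        by (auto simp: stable_kernel_def ev_add)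
    qed
    fix f h assume "f \<in> stable_kernel \<beta>" "h \<in> carrier F"
    then have "f \<in> carrier F" "h \<in> carrier F" "h \<otimes>\<^bsub>F\<^esub> f \<in> stable_kernel \<beta>"
      by (simp add: stable_kernel_def, simp, intro left)
    then show "h \<otimes>\<^bsub>F\<^esub> f \<in> stable_kernel \<beta>" "f \<otimes>\<^bsub>F\<^esub> h \<in> stable_kernel \<beta>"
      by (simp_all add: F.m_comm)
  qed
qed

end

section \<open>Quotients of algebras by ideals\<close>

lemma (in algebra) ideal_smult_closed:
  assumes "ideal I M" "r \<in> carrier R" "x \<in> I" shows "r \<odot>\<^bsub>M\<^esub> x \<in> I"
proof -
  interpret I: ideal I M by fact
  have "r \<odot>\<^bsub>M\<^esub> x = (r \<odot>\<^bsub>M\<^esub> \<one>\<^bsub>M\<^esub>) \<otimes>\<^bsub>M\<^esub> x"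
    using assms I.a_subset by (subst smult_assoc2) auto
  then show ?thesis using assms by (auto intro: I.I_l_closed)
qed

text \<open>The scalar multiple is a union over the coset. Two representatives differ by an element
  of \<open>I\<close>, which is closed under scalars, so all cosets in the union coincide.\<close>

lemma (in algebra) quotient_algebra_smult:
  assumes "ideal I M" "r \<in> carrier R" "x \<in> carrier M"
  shows "r \<odot>\<^bsub>quotient_algebra M I\<^esub> (I +>\<^bsub>M\<^esub> x) = I +>\<^bsub>M\<^esub> (r \<odot>\<^bsub>M\<^esub> x)"
proof -
  interpret I: ideal I M by fact
  have *: "I +>\<^bsub>M\<^esub> (r \<odot>\<^bsub>M\<^esub> x') = I +>\<^bsub>M\<^esub> (r \<odot>\<^bsub>M\<^esub> x)" if x': "x' \<in> I +>\<^bsub>M\<^esub> x" for x'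
  proof -
    obtain i where i: "i \<in> I" "x' = i \<oplus>\<^bsub>M\<^esub> x" using x' by (auto simp: a_r_coset_def')
    have iM: "i \<in> carrier M" using i I.a_subset by auto
    have "r \<odot>\<^bsub>M\<^esub> x' = (r \<odot>\<^bsub>M\<^esub> i) \<oplus>\<^bsub>M\<^esub> (r \<odot>\<^bsub>M\<^esub> x)"
      using i iM assms by (simp add: smult_r_distr)
    then have "r \<odot>\<^bsub>M\<^esub> x' \<in> I +>\<^bsub>M\<^esub> (r \<odot>\<^bsub>M\<^esub> x)"
      using ideal_smult_closed[OF assms(1,2) i(1)] by (auto simp: a_r_coset_def')
    then show ?thesis using assms I.a_subgroup
      by (intro a_repr_independence[symmetric]) auto
  qed
  have "(\<Union>x'\<in>I +>\<^bsub>M\<^esub> x. I +>\<^bsub>M\<^esub> (r \<odot>\<^bsub>M\<^esub> x')) = (\<Union>x'\<in>I +>\<^bsub>M\<^esub> x. I +>\<^bsub>M\<^esub> (r \<odot>\<^bsub>M\<^esub> x))"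
    by (intro SUP_cong refl *)
  also have "\<dots> = I +>\<^bsub>M\<^esub> (r \<odot>\<^bsub>M\<^esub> x)"
    using I.a_rcos_self[OF assms(3)] by auto
  finally show ?thesis by (simp add: quotient_algebra_def)
qed

lemma quotient_algebra_simps:
  "carrier (quotient_algebra M I) = carrier (M Quot I)"
  "monoid.mult (quotient_algebra M I) = monoid.mult (M Quot I)"
  "one (quotient_algebra M I) = one (M Quot I)"
  "ring.zero (quotient_algebra M I) = ring.zero (M Quot I)"
  "add (quotient_algebra M I) = add (M Quot I)"
  by (simp_all add: quotient_algebra_def)

lemma (in algebra) quotient_algebra_coset_cases:
  assumes "C \<in> carrier (quotient_algebra M I)"
  obtains x where "x \<in> carrier M" "C = I +>\<^bsub>M\<^esub> x"
  using assms by (auto simp: quotient_algebra_simps FactRing_def A_RCOSETS_def')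

lemma (in algebra) quotient_algebra_is_algebra:
  assumes "ideal I M" shows "algebra R (quotient_algebra M I)"
    and "a_r_coset M I \<in> ring_hom M (quotient_algebra M I)"
proof -
  interpret I: ideal I M by fact
  interpret Q: cring "M Quot I" by (rule I.quotient_is_cring) (rule is_cring)
  interpret H: ring_hom_ring M "M Quot I" "a_r_coset M I" by (rule I.rcos_ring_hom_ring)
  let ?Q = "quotient_algebra M I"
  note s = quotient_algebra_simps
  have cr: "cring ?Q"
  proof (intro cringI abelian_groupI comm_monoidI)
    fix x assume "x \<in> carrier ?Q"
    then show "\<exists>y\<in>carrier ?Q. y \<oplus>\<^bsub>?Q\<^esub> x = \<zero>\<^bsub>?Q\<^esub>"
      unfolding s by (intro bexI[of _ "\<ominus>\<^bsub>M Quot I\<^esub> x"]) (simp_all add: Q.l_neg)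
  qed (simp_all add: s Q.a_ac Q.m_ac Q.l_distr Q.r_distr)
  show hom: "a_r_coset M I \<in> ring_hom M ?Q"
    using H.homh by (simp add: ring_hom_def s)
  note smult = quotient_algebra_smult[OF assms]
  have coset_add: "(I +>\<^bsub>M\<^esub> x) \<oplus>\<^bsub>?Q\<^esub> (I +>\<^bsub>M\<^esub> y) = I +>\<^bsub>M\<^esub> (x \<oplus>\<^bsub>M\<^esub> y)"
    and coset_mult: "(I +>\<^bsub>M\<^esub> x) \<otimes>\<^bsub>?Q\<^esub> (I +>\<^bsub>M\<^esub> y) = I +>\<^bsub>M\<^esub> (x \<otimes>\<^bsub>M\<^esub> y)"
    and closed: "I +>\<^bsub>M\<^esub> x \<in> carrier ?Q"
    if "x \<in> carrier M" "y \<in> carrier M" for x y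
    using that H.hom_add H.hom_mult H.hom_closed by (simp_all add: s)
  show "algebra R ?Q"
  proof (intro algebraI R.is_cring cr)
    fix a x assume a: "a \<in> carrier R" and "x \<in> carrier ?Q"
    then obtain x' where x: "x' \<in> carrier M" "x = I +>\<^bsub>M\<^esub> x'" by (elim quotient_algebra_coset_cases)
    show "a \<odot>\<^bsub>?Q\<^esub> x \<in> carrier ?Q" using a x by (simp add: smult closed)
  next
    fix a b x assume a: "a \<in> carrier R" and b: "b \<in> carrier R" and "x \<in> carrier ?Q"
    then obtain x' where x: "x' \<in> carrier M" "x = I +>\<^bsub>M\<^esub> x'" by (elim quotient_algebra_coset_cases)
    show "(a \<oplus> b) \<odot>\<^bsub>?Q\<^esub> x = a \<odot>\<^bsub>?Q\<^esub> x \<oplus>\<^bsub>?Q\<^esub> b \<odot>\<^bsub>?Q\<^esub> x"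
      using a b x by (simp add: smult coset_add smult_l_distr del: H.hom_add)
    show "a \<otimes> b \<odot>\<^bsub>?Q\<^esub> x = a \<odot>\<^bsub>?Q\<^esub> (b \<odot>\<^bsub>?Q\<^esub> x)"
      using a b x by (simp add: smult smult_assoc1)
 next
    fix x assume "x \<in> carrier ?Q"
    then obtain x' where x: "x' \<in> carrier M" "x = I +>\<^bsub>M\<^esub> x'" by (elim quotient_algebra_coset_cases)
    show "\<one> \<odot>\<^bsub>?Q\<^esub> x = x" using x by (simp add: smult)
  next
    fix a x y assume a: "a \<in> carrier R" and "x \<in> carrier ?Q" "y \<in> carrier ?Q"
    then obtain x' y' where x: "x' \<in> carrier M" "x = I +>\<^bsub>M\<^esub> x'" and y: "y' \<in> carrier M" "y = I +>\<^bsub>M\<^esub> y'"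
      by (elim quotient_algebra_coset_cases)
    show "a \<odot>\<^bsub>?Q\<^esub> (x \<oplus>\<^bsub>?Q\<^esub> y) = a \<odot>\<^bsub>?Q\<^esub> x \<oplus>\<^bsub>?Q\<^esub> a \<odot>\<^bsub>?Q\<^esub> y"
      using a x y by (simp add: smult coset_add smult_r_distr del: H.hom_add)
    show "a \<odot>\<^bsub>?Q\<^esub> x \<otimes>\<^bsub>?Q\<^esub> y = a \<odot>\<^bsub>?Q\<^esub> (x \<otimes>\<^bsub>?Q\<^esub> y)"
      using a x y by (simp add: smult coset_mult smult_assoc2 del: H.hom_mult)
  qed
qed

section \<open>The tensor product and its bilinearity relations\<close>

locale tensor_product_locale = M: algebra R M + N: algebra R N
  for R :: "('r, 'x) ring_scheme" and M :: "('r, 'm, 'y) module_scheme"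
    and N :: "('r, 'n, 'z) module_scheme"
begin

abbreviation "TF \<equiv> tensor_free R M N"
abbreviation "TI \<equiv> tensor_ideal R M N"
abbreviation "TP \<equiv> tensor_product R M N"
abbreviation "pt \<equiv> pure_tensor R M N"

sublocale monoid_algebra_locale R "M \<times>\<times> N"
proof -
  have "comm_monoid (M \<times>\<times> N)"
    using DirProd_monoid[OF M.is_monoid N.is_monoid]
    by (auto intro!: monoid.monoid_comm_monoidI simp: M.m_comm N.m_comm)
  then show "monoid_algebra_locale R (M \<times>\<times> N)"
    using M.R.is_cring by (simp add: monoid_algebra_locale_def)
qed

sublocale F: algebra R TF by (rule F_algebra)

lemma tensor_relations_subset: "tensor_relations R M N \<subseteq> carrier TF"
proof -
  have e: "basis_vector R (x, y) \<in> carrier TF" if "x \<in> carrier M" "y \<in> carrier N" for x y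
    using that by (auto simp: carF basis_vector_def)
  show ?thesis
    unfolding tensor_relations_def Let_def by (auto intro!: e F.minus_closed F.add.m_closed)
qed

lemma tensor_ideal_ideal: "ideal TI TF"
  unfolding tensor_ideal_def by (rule F.genideal_ideal) (rule tensor_relations_subset)

sublocale I: ideal TI TF by (rule tensor_ideal_ideal)

sublocale T: algebra R TP
  unfolding tensor_product_def by (rule F.quotient_algebra_is_algebra) (rule tensor_ideal_ideal)

sublocale H: ring_hom_ring TF TP "a_r_coset TF TI"
  using F.quotient_algebra_is_algebra(2)[OF tensor_ideal_ideal] T.ring_axioms F.ring_axioms
  unfolding tensor_product_def by (intro ring_hom_ringI2)

lemma coset_cases:
  assumes "C \<in> carrier TP"
  obtains f where "f \<in> carrier TF" "C = TI +>\<^bsub>TF\<^esub> f"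
  using F.quotient_algebra_coset_cases assms unfolding tensor_product_def by blast

lemma pt_closed: "x \<in> carrier M \<Longrightarrow> y \<in> carrier N \<Longrightarrow> pt x y \<in> carrier TP"
  unfolding pure_tensor_def by (rule H.hom_closed) (auto simp: carF basis_vector_def)

lemma coset_eqI:
  assumes "f \<in> carrier TF" "h \<in> carrier TF" "f \<ominus>\<^bsub>TF\<^esub> h \<in> TI"
  shows "TI +>\<^bsub>TF\<^esub> f = TI +>\<^bsub>TF\<^esub> h"
  using assms by (metis F.quotient_eq_iff_same_a_r_cos tensor_ideal_ideal)

lemma basis_closed: "x \<in> carrier M \<Longrightarrow> y \<in> carrier N \<Longrightarrow> basis_vector R (x, y) \<in> carrier TF"
  by (auto simp: carF basis_vector_def)

lemma relation_in_ideal: "f \<in> tensor_relations R M N \<Longrightarrow> f \<in> TI"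
  unfolding tensor_ideal_def using F.genideal_self[OF tensor_relations_subset] by blast

lemma tensor_relations_mem:
  assumes "x \<in> carrier M" "y \<in> carrier N"
  shows "x' \<in> carrier M \<Longrightarrow> basis_vector R (x \<oplus>\<^bsub>M\<^esub> x', y)
      \<ominus>\<^bsub>TF\<^esub> (basis_vector R (x, y) \<oplus>\<^bsub>TF\<^esub> basis_vector R (x', y)) \<in> tensor_relations R M N"
    and "y' \<in> carrier N \<Longrightarrow> basis_vector R (x, y \<oplus>\<^bsub>N\<^esub> y')
      \<ominus>\<^bsub>TF\<^esub> (basis_vector R (x, y) \<oplus>\<^bsub>TF\<^esub> basis_vector R (x, y')) \<in> tensor_relations R M N"
    and "r \<in> carrier R \<Longrightarrow> basis_vector R (r \<odot>\<^bsub>M\<^esub> x, y)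
      \<ominus>\<^bsub>TF\<^esub> (r \<odot>\<^bsub>TF\<^esub> basis_vector R (x, y)) \<in> tensor_relations R M N"
    and "r \<in> carrier R \<Longrightarrow> basis_vector R (x, r \<odot>\<^bsub>N\<^esub> y)
      \<ominus>\<^bsub>TF\<^esub> (r \<odot>\<^bsub>TF\<^esub> basis_vector R (x, y)) \<in> tensor_relations R M N"
  unfolding tensor_relations_def Let_def using assms
     apply -
     apply (rule UnI1, rule UnI1, rule UnI1, intro CollectI exI conjI; (rule refl)?; assumption)
    apply (rule UnI1, rule UnI1, rule UnI2, intro CollectI exI conjI; (rule refl)?; assumption)
   apply (rule UnI1, rule UnI2, intro CollectI exI conjI; (rule refl)?; assumption)
  apply (rule UnI2, intro CollectI exI conjI; (rule refl)?; assumption)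
  done

lemma tensor_relationsE:
  assumes "f \<in> tensor_relations R M N"
  obtains
    (add_left) x x' y where "x \<in> carrier M" "x' \<in> carrier M" "y \<in> carrier N"
      "f = basis_vector R (x \<oplus>\<^bsub>M\<^esub> x', y)
        \<ominus>\<^bsub>TF\<^esub> (basis_vector R (x, y) \<oplus>\<^bsub>TF\<^esub> basis_vector R (x', y))"
  | (add_right) x y y' where "x \<in> carrier M" "y \<in> carrier N" "y' \<in> carrier N"
      "f = basis_vector R (x, y \<oplus>\<^bsub>N\<^esub> y')
        \<ominus>\<^bsub>TF\<^esub> (basis_vector R (x, y) \<oplus>\<^bsub>TF\<^esub> basis_vector R (x, y'))"
  | (smult_left) r x y where "r \<in> carrier R" "x \<in> carrier M" "y \<in> carrier N"
      "f = basis_vector R (r \<odot>\<^bsub>M\<^esub> x, y) \<ominus>\<^bsub>TF\<^esub> (r \<odot>\<^bsub>TF\<^esub> basis_vector R (x, y))"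
  | (smult_right) r x y where "r \<in> carrier R" "x \<in> carrier M" "y \<in> carrier N"
      "f = basis_vector R (x, r \<odot>\<^bsub>N\<^esub> y) \<ominus>\<^bsub>TF\<^esub> (r \<odot>\<^bsub>TF\<^esub> basis_vector R (x, y))"
  using assms unfolding tensor_relations_def Let_def
  by (elim UnE CollectE exE conjE; simp add: that)

lemma pt_add_left:
  assumes "x \<in> carrier M" "x' \<in> carrier M" "y \<in> carrier N"
  shows "pt (x \<oplus>\<^bsub>M\<^esub> x') y = pt x y \<oplus>\<^bsub>TP\<^esub> pt x' y"
  unfolding pure_tensor_def H.hom_add[OF basis_closed basis_closed, OF assms(1,3) assms(2,3), symmetric]
  by (intro coset_eqI relation_in_ideal tensor_relations_mem F.a_closed basis_closed M.a_closed assms)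

lemma pt_add_right:
  assumes "x \<in> carrier M" "y \<in> carrier N" "y' \<in> carrier N"
  shows "pt x (y \<oplus>\<^bsub>N\<^esub> y') = pt x y \<oplus>\<^bsub>TP\<^esub> pt x y'"
  unfolding pure_tensor_def H.hom_add[OF basis_closed basis_closed, OF assms(1,2) assms(1,3), symmetric]
  by (intro coset_eqI relation_in_ideal tensor_relations_mem F.a_closed basis_closed N.a_closed assms)

lemma pt_smult:
  assumes "r \<in> carrier R" "x \<in> carrier M" "y \<in> carrier N"
  shows "pt (r \<odot>\<^bsub>M\<^esub> x) y = r \<odot>\<^bsub>TP\<^esub> pt x y"
    and "pt x (r \<odot>\<^bsub>N\<^esub> y) = r \<odot>\<^bsub>TP\<^esub> pt x y"
proof -
  have sm: "r \<odot>\<^bsub>TP\<^esub> pt x y = TI +>\<^bsub>TF\<^esub> (r \<odot>\<^bsub>TF\<^esub> basis_vector R (x, y))"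
    unfolding pure_tensor_def tensor_product_def
    by (intro F.quotient_algebra_smult tensor_ideal_ideal basis_closed assms)
  show "pt (r \<odot>\<^bsub>M\<^esub> x) y = r \<odot>\<^bsub>TP\<^esub> pt x y"
    unfolding sm unfolding pure_tensor_def
    by (intro coset_eqI relation_in_ideal tensor_relations_mem F.smult_closed basis_closed M.smult_closed assms)
  show "pt x (r \<odot>\<^bsub>N\<^esub> y) = r \<odot>\<^bsub>TP\<^esub> pt x y"
    unfolding sm unfolding pure_tensor_def
    by (intro coset_eqI relation_in_ideal tensor_relations_mem F.smult_closed basis_closed N.smult_closed assms)
qed

end

section \<open>The linear map induced by a bilinear map\<close>

locale tensor_lift_locale = tensor_product_locale R M N + P: module R P
  for R :: "('r, 'x) ring_scheme" and M :: "('r, 'm, 'y) module_scheme"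
    and N :: "('r, 'n, 'z) module_scheme" and P :: "('r, 'p, 'w) module_scheme" +
  fixes b :: "'m \<Rightarrow> 'n \<Rightarrow> 'p"
  assumes b_closed: "\<lbrakk>x \<in> carrier M; y \<in> carrier N\<rbrakk> \<Longrightarrow> b x y \<in> carrier P"
    and b_add_left: "\<lbrakk>x \<in> carrier M; x' \<in> carrier M; y \<in> carrier N\<rbrakk> \<Longrightarrow>
      b (x \<oplus>\<^bsub>M\<^esub> x') y = b x y \<oplus>\<^bsub>P\<^esub> b x' y"
    and b_add_right: "\<lbrakk>x \<in> carrier M; y \<in> carrier N; y' \<in> carrier N\<rbrakk> \<Longrightarrow>
      b x (y \<oplus>\<^bsub>N\<^esub> y') = b x y \<oplus>\<^bsub>P\<^esub> b x y'"
    and b_smult_left: "\<lbrakk>r \<in> carrier R; x \<in> carrier M; y \<in> carrier N\<rbrakk> \<Longrightarrow>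
      b (r \<odot>\<^bsub>M\<^esub> x) y = r \<odot>\<^bsub>P\<^esub> b x y"
    and b_smult_right: "\<lbrakk>r \<in> carrier R; x \<in> carrier M; y \<in> carrier N\<rbrakk> \<Longrightarrow>
      b x (r \<odot>\<^bsub>N\<^esub> y) = r \<odot>\<^bsub>P\<^esub> b x y"
begin

sublocale monoid_algebra_eval R "M \<times>\<times> N" P ..

text \<open>Extended by zero outside the carriers, because the lemmas on \<open>ev\<close> take a
  function with values in \<open>carrier P\<close> everywhere.\<close>

definition b_tot :: "'m \<times> 'n \<Rightarrow> 'p"
  where "b_tot p = (if p \<in> carrier M \<times> carrier N then b (fst p) (snd p) else \<zero>\<^bsub>P\<^esub>)"

lemma b_tot_closed [simp]: "b_tot p \<in> carrier P"
  by (auto simp: b_tot_def b_closed)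

text \<open>Multiplication by a fixed element is linear, so a translate of a bilinearity relation is
  again one. Hence \<open>ev b_tot\<close> kills all translates, and minimality of the generated
  ideal applies.\<close>

lemma ideal_subset_stable_kernel: "TI \<subseteq> stable_kernel b_tot"
  unfolding tensor_ideal_def
proof (rule F.genideal_minimal)
  show "ideal (stable_kernel b_tot) TF" by (rule stable_kernel_ideal) simp
  have ev: "ev (\<lambda>l. b_tot (k \<otimes>\<^bsub>M \<times>\<times> N\<^esub> l)) (basis_vector R (x, y)) = b (fst k \<otimes>\<^bsub>M\<^esub> x) (snd k \<otimes>\<^bsub>N\<^esub> y)"
    if "k \<in> carrier M \<times> carrier N" "x \<in> carrier M" "y \<in> carrier N" for k x y
    using that by (subst ev_basis_vector) (auto simp: mult_DirProd', simp add: b_tot_def)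
  show "tensor_relations R M N \<subseteq> stable_kernel b_tot"
  proof
    fix f assume f: "f \<in> tensor_relations R M N"
    then have "f \<in> carrier TF" using tensor_relations_subset by blast
    moreover have "ev (\<lambda>l. b_tot (k \<otimes>\<^bsub>M \<times>\<times> N\<^esub> l)) f = \<zero>\<^bsub>P\<^esub>" if k: "k \<in> carrier M \<times> carrier N" for k
    proof -
      have k': "fst k \<in> carrier M" "snd k \<in> carrier N" using k by auto
      note ev_simps = ev_minus ev_add ev_smult basis_closed ev[OF k] k' P.minus_eq P.r_neg b_closed
      from f show ?thesis
      proof (cases rule: tensor_relationsE)
        case add_left
        then show ?thesis by (simp add: ev_simps M.r_distr b_add_left)
      next
        case add_right
        then show ?thesis by (simp add: ev_simps N.r_distr b_add_right)
      next
        case (smult_left r x y)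
        then have "fst k \<otimes>\<^bsub>M\<^esub> (r \<odot>\<^bsub>M\<^esub> x) = r \<odot>\<^bsub>M\<^esub> (fst k \<otimes>\<^bsub>M\<^esub> x)"
          using k' M.m_comm[of "fst k" "r \<odot>\<^bsub>M\<^esub> x"] M.m_comm[of "fst k" x]
          by (simp add: M.smult_assoc2)
        then show ?thesis using smult_left by (simp add: ev_simps b_smult_left)
      next
        case (smult_right r x y)
        then have "snd k \<otimes>\<^bsub>N\<^esub> (r \<odot>\<^bsub>N\<^esub> y) = r \<odot>\<^bsub>N\<^esub> (snd k \<otimes>\<^bsub>N\<^esub> y)"
          using k' N.m_comm[of "snd k" "r \<odot>\<^bsub>N\<^esub> y"] N.m_comm[of "snd k" y]
          by (simp add: N.smult_assoc2)
        then show ?thesis using smult_right by (simp add: ev_simps b_smult_right)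
      qed
    qed
    ultimately show "f \<in> stable_kernel b_tot" by (auto simp: stable_kernel_def)
  qed
qed

text \<open>The representative picked by the choice operator differs from \<open>f\<close> by an
  element of the ideal, on which \<open>ev b_tot\<close> vanishes; so the choice does not
  matter.\<close>

lemma tensor_lift_coset:
  assumes f: "f \<in> carrier TF"
  shows "tensor_lift R P b (TI +>\<^bsub>TF\<^esub> f) = ev b_tot f"
proof -
  define h where "h = (SOME h. h \<in> TI +>\<^bsub>TF\<^esub> f)"
  have "h \<in> TI +>\<^bsub>TF\<^esub> f" unfolding h_def using I.a_rcos_self[OF f] by (auto simp: some_in_eq)
  then obtain i where i: "i \<in> TI" "h = i \<oplus>\<^bsub>TF\<^esub> f" by (auto simp: a_r_coset_def')
  have iF: "i \<in> carrier TF" using i I.a_subset by auto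
  have hF: "h \<in> carrier TF" using i iF f by auto
  have "tensor_lift R P b (TI +>\<^bsub>TF\<^esub> f) = ev (\<lambda>p. b (fst p) (snd p)) h"
    by (simp add: tensor_lift_def ev_def h_def Let_def)
  also have "\<dots> = ev b_tot h" by (rule ev_cong[OF hF]) (auto simp: b_tot_def b_closed)
  also have "\<dots> = ev b_tot i \<oplus>\<^bsub>P\<^esub> ev b_tot f"
    unfolding i by (rule ev_add[OF iF f]) simp
  \<comment> \<open>Membership in \<open>stable_kernel\<close> speaks of translates; translation by
    the unit gives \<open>i\<close> itself.\<close>
  also have "ev b_tot i = ev (\<lambda>l. b_tot (\<one>\<^bsub>M \<times>\<times> N\<^esub> \<otimes>\<^bsub>M \<times>\<times> N\<^esub> l)) i"
    by (rule ev_cong[OF iF]) auto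
  also have "\<dots> = \<zero>\<^bsub>P\<^esub>"
    using ideal_subset_stable_kernel i(1) G.one_closed unfolding stable_kernel_def by blast
  finally show ?thesis using ev_closed[OF f] by simp
qed

lemma tensor_lift_pt:
  "x \<in> carrier M \<Longrightarrow> y \<in> carrier N \<Longrightarrow> tensor_lift R P b (pt x y) = b x y"
  unfolding pure_tensor_def
  by (subst tensor_lift_coset) (simp_all add: basis_closed ev_basis_vector, simp add: b_tot_def)

lemma tensor_lift_closed: "C \<in> carrier TP \<Longrightarrow> tensor_lift R P b C \<in> carrier P"
  by (erule coset_cases) (simp add: tensor_lift_coset ev_closed)

lemma tensor_lift_add:
  assumes "C \<in> carrier TP" "C' \<in> carrier TP"
  shows "tensor_lift R P b (C \<oplus>\<^bsub>TP\<^esub> C') = tensor_lift R P b C \<oplus>\<^bsub>P\<^esub> tensor_lift R P b C'"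
  using assms
  by (elim coset_cases) (simp add: tensor_lift_coset ev_add flip: H.hom_add)

lemma tensor_lift_finsum_pt:
  assumes "finite A" "x \<in> A \<rightarrow> carrier M" "y \<in> A \<rightarrow> carrier N"
  shows "tensor_lift R P b (\<Oplus>\<^bsub>TP\<^esub>i\<in>A. pt (x i) (y i)) = (\<Oplus>\<^bsub>P\<^esub>i\<in>A. b (x i) (y i))"
  using assms
proof induction
  case empty
  have "tensor_lift R P b \<zero>\<^bsub>TP\<^esub> \<oplus>\<^bsub>P\<^esub> tensor_lift R P b \<zero>\<^bsub>TP\<^esub> = tensor_lift R P b \<zero>\<^bsub>TP\<^esub>"
    by (simp flip: tensor_lift_add)
  then show ?case using tensor_lift_closed[OF T.zero_closed]
    by (simp add: P.add.l_cancel_one)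
next
  case (insert i A)
  have "(\<lambda>i. pt (x i) (y i)) \<in> A \<rightarrow> carrier TP" using insert by (auto intro!: pt_closed)
  then have "(\<Oplus>\<^bsub>TP\<^esub>i\<in>A. pt (x i) (y i)) \<in> carrier TP" by (rule T.finsum_closed)
  moreover have "(\<lambda>i. b (x i) (y i)) \<in> A \<rightarrow> carrier P" using insert by (auto intro!: b_closed)
  ultimately show ?case
    using insert by (simp add: T.finsum_insert P.finsum_insert pt_closed b_closed Pi_def
        tensor_lift_add tensor_lift_pt)
qed

end

section \<open>Convergence of nested sums in an ultrametric field\<close>

context C_infinity
begin

abbreviation v :: "'c \<Rightarrow> real" where "v x \<equiv> dist x 0"

lemma dist_eq_v: "dist x y = v (x - y)"
  using dist_translate[of "x - y" y 0] by simp

lemma v_add_le: "v (x + y) \<le> max (v x) (v y)"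
  using dist_ultrametric[of "x + y" 0 y] dist_translate[of x y 0] by simp

lemma v_1 [simp]: "v 1 = 1"
  using dist_mult[of 1 1] by simp

lemma v_power: "v (x ^ n) = v x ^ n"
  by (induction n) (simp_all add: dist_mult)

lemma v_uminus [simp]: "v (- x) = v x"
  using dist_translate[of "- x" x 0] by (simp add: dist_commute)

lemma v_inverse: "v (inverse x) = inverse (v x)"
proof (cases "x = 0")
  case False
  then have "v x * v (inverse x) = 1" by (simp flip: dist_mult)
  then show ?thesis by (rule inverse_unique[symmetric])
qed simp

lemma v_sum_le:
  assumes "\<And>i. i \<in> A \<Longrightarrow> v (f i) \<le> B" "0 \<le> B"
  shows "v (sum f A) \<le> B"
  using assms(1)
proof (induction A rule: infinite_finite_induct)
  case (insert i A)
  then have "v (f i) \<le> B" "v (sum f A) \<le> B" by simp_all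
  then show ?case using insert by (auto intro: order.trans[OF v_add_le])
qed (use assms(2) in simp_all)

lemma tendsto_iff_v:
  fixes x :: 'c
  shows "tendsto U x F \<longleftrightarrow> tendsto (\<lambda>n. v (U n - x)) 0 F"
  unfolding dist_eq_v[symmetric] by (rule tendsto_dist_iff)

text \<open>The type is only a field with a complete metric, so continuity of the ring operations is
  derived from the axioms of the absolute value.\<close>

lemma tendsto_add_C:
  fixes U W :: "'b \<Rightarrow> 'c"
  assumes "tendsto U x F" "tendsto W y F" shows "tendsto (\<lambda>n. U n + W n) (x + y) F"
proof -
  have "tendsto (\<lambda>n. v (U n - x) + v (W n - y)) (0 + 0) F"
    by (intro tendsto_add tendsto_iff_v[THEN iffD1] assms)
  moreover have "v (U n + W n - (x + y)) \<le> v (U n - x) + v (W n - y)" for n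
  proof -
    have "U n + W n - (x + y) = (U n - x) + (W n - y)" by (rule add_diff_add)
    also have "v \<dots> \<le> max (v (U n - x)) (v (W n - y))" by (rule v_add_le)
    also have "\<dots> \<le> v (U n - x) + v (W n - y)" by (simp add: max_def)
    finally show ?thesis .
  qed
  ultimately have "tendsto (\<lambda>n. v (U n + W n - (x + y))) 0 F"
    using tendsto_sandwich[of "\<lambda>_. 0" "\<lambda>n. v (U n + W n - (x + y))" F "\<lambda>n. v (U n - x) + v (W n - y)" 0]
    by simp
  then show ?thesis by (rule tendsto_iff_v[THEN iffD2])
qed

lemma tendsto_mult_left_C:
  fixes U :: "'b \<Rightarrow> 'c"
  assumes "tendsto U x F" shows "tendsto (\<lambda>n. c * U n) (c * x) F"
proof -
  have "tendsto (\<lambda>n. v c * v (U n - x)) (v c * 0) F"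
    by (intro tendsto_mult_left tendsto_iff_v[THEN iffD1] assms)
  then show ?thesis
    by (intro tendsto_iff_v[THEN iffD2]) (simp add: dist_mult right_diff_distrib[symmetric])
qed

lemma tendsto_null_mult_C:
  fixes U W :: "'b \<Rightarrow> 'c"
  assumes "tendsto U 0 F" "\<And>n. v (W n) \<le> B"
  shows "tendsto (\<lambda>n. U n * W n) 0 F"
proof -
  have "tendsto (\<lambda>n. v (U n) * B) (0 * B) F"
    using tendsto_iff_v[THEN iffD1, OF assms(1)] by (intro tendsto_mult_right) simp
  moreover have "v (U n * W n) \<le> v (U n) * B" for n
    by (simp add: dist_mult assms(2) mult_left_mono)
  ultimately have "tendsto (\<lambda>n. v (U n * W n - 0)) 0 F"
    using tendsto_sandwich[of "\<lambda>_. 0" "\<lambda>n. v (U n * W n)" F "\<lambda>n. v (U n) * B" 0] by simp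
  then show ?thesis by (rule tendsto_iff_v[THEN iffD2])
qed

lemma convergent_v_bounded:
  fixes U :: "nat \<Rightarrow> 'c"
  assumes "U \<longlonglongrightarrow> x" shows "\<exists>B>0. \<forall>n. v (U n) \<le> B"
proof -
  have "Bseq (\<lambda>n. v (U n - x))"
    by (intro convergent_imp_Bseq convergentI[OF tendsto_iff_v[THEN iffD1]] assms)
  then obtain K where K: "K > 0" "\<And>n. v (U n - x) \<le> K"
    by (auto elim: BseqE)
  have "v (U n) \<le> max K (v x)" for n
    using v_add_le[of "U n - x" x] K(2)[of n] by auto
  then show ?thesis using K(1) by (intro exI[of _ "max K (v x)"]) auto
qed

lemma tendsto_mult_C:
  fixes U W :: "nat \<Rightarrow> 'c"
  assumes "U \<longlonglongrightarrow> x" "W \<longlonglongrightarrow> y" shows "(\<lambda>n. U n * W n) \<longlonglongrightarrow> x * y"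
proof -
  obtain B where B: "\<And>n. v (W n) \<le> B" using convergent_v_bounded[OF assms(2)] by blast
  have "(\<lambda>n. U n + - x) \<longlonglongrightarrow> x + - x" by (intro tendsto_add_C[OF assms(1)] tendsto_const)
  then have "(\<lambda>n. (U n - x) * W n) \<longlonglongrightarrow> 0" by (intro tendsto_null_mult_C[where B = B] B) simp
  then have "(\<lambda>n. (U n - x) * W n + x * W n) \<longlonglongrightarrow> 0 + x * y"
    by (rule tendsto_add_C[OF _ tendsto_mult_left_C[OF assms(2)]])
  then show ?thesis by (simp add: algebra_simps)
qed

lemma tendsto_sum_C:
  fixes U :: "'a \<Rightarrow> 'b \<Rightarrow> 'c"
  assumes "\<And>i. i \<in> A \<Longrightarrow> tendsto (U i) (x i) F" shows "tendsto (\<lambda>n. \<Sum>i\<in>A. U i n) (\<Sum>i\<in>A. x i) F"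
  using assms by (induction A rule: infinite_finite_induct) (simp_all add: tendsto_add_C)

lemma tendsto_sum_list_C:
  fixes U :: "'a \<Rightarrow> 'b \<Rightarrow> 'c"
  assumes "\<And>i. i \<in> set xs \<Longrightarrow> tendsto (U i) (x i) F"
  shows "tendsto (\<lambda>n. \<Sum>i\<leftarrow>xs. U i n) (\<Sum>i\<leftarrow>xs. x i) F"
  using assms by (induction xs) (simp_all add: tendsto_add_C)

text \<open>By the ultrametric inequality a tail is bounded by its largest term, so small terms
  suffice for summability. This has to be shown, because \<open>infsum\<close> is 0 by default on
  families that are not summable.\<close>

lemma tendsto_infsum_exhaustion:
  assumes fin: "\<And>N. finite (A' N)" and sub: "\<And>N. A' N \<subseteq> A" and mono: "\<And>M N. M \<le> N \<Longrightarrow> A' M \<subseteq> A' N"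
    and small: "\<And>\<epsilon>. \<epsilon> > 0 \<Longrightarrow> \<exists>N. \<forall>x\<in>A - A' N. v (f x) < \<epsilon>"
  shows "(\<lambda>N. sum f (A' N)) \<longlonglongrightarrow> infsum f A"
proof -
  have key: "\<exists>N. \<forall>U. finite U \<and> A' N \<subseteq> U \<and> U \<subseteq> A \<longrightarrow> dist (sum f U) (sum f (A' N)) < \<epsilon>"
    if e: "\<epsilon> > 0" for \<epsilon>
  proof -
    \<comment> \<open>Half of \<open>\<epsilon>\<close>, since the bound obtained for the sum is not
      strict.\<close>
    obtain N where N: "\<And>x. x \<in> A - A' N \<Longrightarrow> v (f x) < \<epsilon> / 2" using small[of "\<epsilon> / 2"] e by auto
    have "dist (sum f U) (sum f (A' N)) < \<epsilon>" if U: "finite U" "A' N \<subseteq> U" "U \<subseteq> A" for U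
    proof -
      have "sum f U - sum f (A' N) = sum f (U - A' N)" using U fin by (simp add: sum_diff)
      moreover have "v (sum f (U - A' N)) \<le> \<epsilon> / 2"
        using N U e by (intro v_sum_le) (auto intro: less_imp_le)
      ultimately show ?thesis using e by (simp add: dist_eq_v[of "sum f U"])
    qed
    then show ?thesis by blast
  qed
  have "Cauchy (\<lambda>N. sum f (A' N))"
  proof (rule metric_CauchyI)
    fix \<epsilon> :: real assume e: "\<epsilon> > 0"
    obtain N where N: "\<And>U. finite U \<Longrightarrow> A' N \<subseteq> U \<Longrightarrow> U \<subseteq> A \<Longrightarrow> dist (sum f U) (sum f (A' N)) < \<epsilon>"
      using key[OF e] by blast
    have "dist (sum f (A' m)) (sum f (A' n)) < \<epsilon>" if "m \<ge> N" "n \<ge> N" for m n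
      using dist_ultrametric[of "sum f (A' m)" "sum f (A' n)" "sum f (A' N)"]
        N[of "A' m"] N[of "A' n"] fin sub mono that by (auto simp: dist_commute)
    then show "\<exists>M. \<forall>m\<ge>M. \<forall>n\<ge>M. dist (sum f (A' m)) (sum f (A' n)) < \<epsilon>" by blast
  qed
  then obtain x where x: "(\<lambda>N. sum f (A' N)) \<longlonglongrightarrow> x"
    using Cauchy_convergent convergent_def by blast
  have "(f has_sum x) A"
    unfolding has_sum_def
  proof (rule tendstoI)
    fix \<epsilon> :: real assume e: "\<epsilon> > 0"
    obtain N where N: "\<And>U. finite U \<Longrightarrow> A' N \<subseteq> U \<Longrightarrow> U \<subseteq> A \<Longrightarrow> dist (sum f U) (sum f (A' N)) < \<epsilon>"
      using key[OF e] by blast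
    have "eventually (\<lambda>M. dist (sum f (A' M)) x < \<epsilon>) sequentially" using x e by (rule tendstoD)
    then obtain M where M: "M \<ge> N" "dist (sum f (A' M)) x < \<epsilon>"
      unfolding eventually_sequentially by (meson nle_le)
    have "dist (sum f U) x < \<epsilon>" if U: "finite U" "A' N \<subseteq> U" "U \<subseteq> A" for U
      using dist_ultrametric[of "sum f U" x "sum f (A' M)"] M N[OF U] N[of "A' M"]
        dist_ultrametric[of "sum f U" "sum f (A' M)" "sum f (A' N)"] fin sub mono[OF M(1)]
      by (auto simp: dist_commute)
    then show "\<forall>\<^sub>F U in finite_subsets_at_top A. dist (sum f U) x < \<epsilon>"
      unfolding eventually_finite_subsets_at_top using fin[of N] sub[of N]
      by (intro exI[of _ "A' N"]) simp
  qed
  then show ?thesis using x by (simp add: infsumI)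
qed

section \<open>Nested sums as sums over lists of indices\<close>

definition word_term :: "(nat \<Rightarrow> 'c) list \<Rightarrow> nat list \<Rightarrow> 'c"
  where "word_term w d = (\<Prod>i<length w. (w ! i) (d ! i))"

lemma word_term_Nil [simp]: "word_term [] d = 1"
  by (simp add: word_term_def)

lemma word_term_Cons [simp]: "word_term (f # w) (e # d) = f e * word_term w d"
  unfolding word_term_def length_Cons prod.lessThan_Suc_shift by simp

lemma finite_lists_below: "finite {d :: nat list. length d = r \<and> set d \<subseteq> {..<N}}"
  using finite_lists_length_eq[of "{..<N}" r] by (simp add: conj_commute)

lemma sum_decreasing:
  "sum (word_term w) {d. length d = length w \<and> sorted_wrt (>) d \<and> set d \<subseteq> {..<N}} = nsum w N"
proof (induction w arbitrary: N)
  case Nil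
  have "{d :: nat list. length d = length ([] :: (nat \<Rightarrow> 'c) list) \<and> sorted_wrt (>) d \<and> set d \<subseteq> {..<N}} = {[]}" by auto
  then show ?case by (simp only:) simp
next
  case (Cons f w)
  let ?D = "\<lambda>r N. {d :: nat list. length d = r \<and> sorted_wrt (>) d \<and> set d \<subseteq> {..<N}}"
  have fin: "finite (?D r N)" for r N
    by (rule finite_subset[OF _ finite_lists_below[of r N]]) auto
  have "?D (length (f # w)) N = (\<Union>e<N. (#) e ` ?D (length w) e)"
    by (auto simp: length_Suc_conv image_iff subset_iff)
  then have "sum (word_term (f # w)) (?D (length (f # w)) N) =
      (\<Sum>e<N. sum (word_term (f # w)) ((#) e ` ?D (length w) e))"
    by (simp only:, intro sum.UNION_disjoint) (use fin in auto)
  also have "\<dots> = (\<Sum>e<N. f e * sum (word_term w) (?D (length w) e))"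
    by (simp add: sum.reindex inj_on_def sum_distrib_left)
  finally show ?case by (simp only: Cons nsum.simps)
qed

lemma sum_nondecreasing:
  "(-1) ^ length w * sum (word_term w) {d. length d = length w \<and> sorted_wrt (\<le>) d \<and> set d \<subseteq> {m..<N}}
    = nsum_star w m N"
proof (induction w arbitrary: m)
  case Nil
  have "{d :: nat list. length d = length ([] :: (nat \<Rightarrow> 'c) list) \<and> sorted_wrt (\<le>) d \<and> set d \<subseteq> {m..<N}} = {[]}" by auto
  then show ?case by (simp only:) simp
next
  case (Cons f w)
  let ?D = "\<lambda>r m. {d :: nat list. length d = r \<and> sorted_wrt (\<le>) d \<and> set d \<subseteq> {m..<N}}"
  have fin: "finite (?D r m)" for r m
    by (rule finite_subset[OF _ finite_lists_below[of r N]]) auto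
  have "?D (length (f # w)) m = (\<Union>e\<in>{m..<N}. (#) e ` ?D (length w) e)"
    by (auto simp: length_Suc_conv image_iff subset_iff)
  then have "sum (word_term (f # w)) (?D (length (f # w)) m) =
      (\<Sum>e\<in>{m..<N}. sum (word_term (f # w)) ((#) e ` ?D (length w) e))"
    by (simp only:, intro sum.UNION_disjoint) (use fin in auto)
  also have "\<dots> = (\<Sum>e\<in>{m..<N}. f e * sum (word_term w) (?D (length w) e))"
    by (simp add: sum.reindex inj_on_def sum_distrib_left)
  finally have "(-1) ^ length (f # w) * sum (word_term (f # w)) (?D (length (f # w)) m) =
      - (\<Sum>e\<in>{m..<N}. f e * ((-1) ^ length w * sum (word_term w) (?D (length w) e)))"
    by (simp add: sum_distrib_left sum_negf mult_ac)
  then show ?case by (simp only: Cons nsum_star.simps)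
qed

definition null_word :: "(nat \<Rightarrow> 'c) list \<Rightarrow> bool"
  where "null_word w \<longleftrightarrow> (\<forall>f\<in>set w. f \<longlonglongrightarrow> 0)"

lemma null_word_simps [simp]:
  "null_word []" "null_word (f # w) \<longleftrightarrow> f \<longlonglongrightarrow> 0 \<and> null_word w"
  "null_word (w @ w') \<longleftrightarrow> null_word w \<and> null_word w'"
  by (auto simp: null_word_def)

lemma word_term_bounded:
  assumes "null_word w" shows "\<exists>B>0. \<forall>d. length d = length w \<longrightarrow> v (word_term w d) \<le> B"
  using assms
proof (induction w)
  case Nil
  then show ?case by (intro exI[of _ 1]) auto
next
  case (Cons f w)
  then obtain B where B: "B > 0" "\<And>d. length d = length w \<Longrightarrow> v (word_term w d) \<le> B" by auto
  obtain C where C: "C > 0" "\<And>n. v (f n) \<le> C" using Cons.prems convergent_v_bounded[of f 0] by fastforce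
  have "v (word_term (f # w) d) \<le> C * B" if l: "length d = length (f # w)" for d
  proof -
    obtain e d' where d: "d = e # d'" "length d' = length w" using l by (cases d) auto
    show ?thesis using B C d by (simp add: dist_mult mult_mono less_imp_le)
  qed
  then show ?case using B C by (intro exI[of _ "C * B"]) auto
qed

text \<open>A large index sits either at the head, whose letter is then small against the bound
  \<open>B\<close> of the tail, or in the tail, which is then small against the bound
  \<open>C\<close> of the letter.\<close>

lemma word_term_small:
  assumes "null_word w" "\<epsilon> > 0"
  shows "\<exists>N. \<forall>d. length d = length w \<and> \<not> set d \<subseteq> {..<N} \<longrightarrow> v (word_term w d) < \<epsilon>"
  using assms
proof (induction w arbitrary: \<epsilon>)
  case Nil
  then show ?case by simp
next
  case (Cons f w)
  obtain B where B: "B > 0" "\<And>d. length d = length w \<Longrightarrow> v (word_term w d) \<le> B"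
    using Cons.prems word_term_bounded[of w] by auto
  obtain C where C: "C > 0" "\<And>n. v (f n) \<le> C" using Cons.prems convergent_v_bounded[of f 0] by fastforce
  have "\<forall>\<^sub>F n in sequentially. v (f n) < \<epsilon> / B" using Cons.prems B by (intro tendstoD) auto
  then obtain N1 where N1: "\<And>n. n \<ge> N1 \<Longrightarrow> v (f n) < \<epsilon> / B" unfolding eventually_sequentially by blast
  obtain N2 where N2: "\<And>d. length d = length w \<Longrightarrow> \<not> set d \<subseteq> {..<N2} \<Longrightarrow> v (word_term w d) < \<epsilon> / C"
    using Cons.IH[of "\<epsilon> / C"] Cons.prems C by auto
  have "v (word_term (f # w) d) < \<epsilon>" if d: "length d = length (f # w)" "\<not> set d \<subseteq> {..<max N1 N2}" for d
  proof -
    obtain e d' where d': "d = e # d'" "length d' = length w" using d by (cases d) auto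
    have eq: "v (word_term (f # w) d) = v (f e) * v (word_term w d')" using d' by (simp add: dist_mult)
    show ?thesis
    proof (cases "e \<ge> N1")
      case True
      have "v (f e) * v (word_term w d') \<le> v (f e) * B" using B d' by (simp add: mult_left_mono)
      also have "\<dots> < \<epsilon>" using N1[OF True] B by (simp add: field_simps)
      finally show ?thesis using eq by simp
    next
      case False
      then have "\<not> set d' \<subseteq> {..<N2}" using d d' by (auto simp: subset_iff not_less)
      then have "v (word_term w d') < \<epsilon> / C" using N2 d' by blast
      then have "C * v (word_term w d') < \<epsilon>" using C by (simp add: field_simps)
      moreover have "v (f e) * v (word_term w d') \<le> C * v (word_term w d')" using C by (simp add: mult_right_mono)
      ultimately show ?thesis using eq by simp
    qed
  qed
  then show ?case by blast
qed

definition nlim :: "(nat \<Rightarrow> 'c) list \<Rightarrow> 'c"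
  where "nlim w = (\<Sum>\<^sub>\<infinity>d\<in>{d. length d = length w \<and> sorted_wrt (>) d}. word_term w d)"

definition nlim_star :: "(nat \<Rightarrow> 'c) list \<Rightarrow> 'c"
  where "nlim_star w = (-1) ^ length w * (\<Sum>\<^sub>\<infinity>d\<in>{d. length d = length w \<and> sorted_wrt (\<le>) d}. word_term w d)"

lemma nsum_tendsto:
  assumes "null_word w" shows "nsum w \<longlonglongrightarrow> nlim w"
proof -
  have "(\<lambda>N. sum (word_term w) {d. length d = length w \<and> sorted_wrt (>) d \<and> set d \<subseteq> {..<N}}) \<longlonglongrightarrow> nlim w"
    unfolding nlim_def
  proof (rule tendsto_infsum_exhaustion)
    show "finite {d :: nat list. length d = length w \<and> sorted_wrt (>) d \<and> set d \<subseteq> {..<N}}" for N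
      by (rule finite_subset[OF _ finite_lists_below[of "length w" N]]) auto
    show "\<exists>N. \<forall>x\<in>{d. length d = length w \<and> sorted_wrt (>) d} -
        {d. length d = length w \<and> sorted_wrt (>) d \<and> set d \<subseteq> {..<N}}. v (word_term w x) < \<epsilon>" if "\<epsilon> > 0" for \<epsilon>
      using word_term_small[OF assms that] by auto
  qed auto
  then show ?thesis by (simp only: sum_decreasing)
qed

lemma nsum_star_tendsto:
  assumes "null_word w" shows "nsum_star w 0 \<longlonglongrightarrow> nlim_star w"
proof -
  have eq: "{0..<N} = {..<N}" for N :: nat by auto
  have "(\<lambda>N. sum (word_term w) {d. length d = length w \<and> sorted_wrt (\<le>) d \<and> set d \<subseteq> {..<N}}) \<longlonglongrightarrow>
      (\<Sum>\<^sub>\<infinity>d\<in>{d. length d = length w \<and> sorted_wrt (\<le>) d}. word_term w d)"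
  proof (rule tendsto_infsum_exhaustion)
    show "finite {d :: nat list. length d = length w \<and> sorted_wrt (\<le>) d \<and> set d \<subseteq> {..<N}}" for N
      by (rule finite_subset[OF _ finite_lists_below[of "length w" N]]) auto
    show "\<exists>N. \<forall>x\<in>{d. length d = length w \<and> sorted_wrt (\<le>) d} -
        {d. length d = length w \<and> sorted_wrt (\<le>) d \<and> set d \<subseteq> {..<N}}. v (word_term w x) < \<epsilon>" if "\<epsilon> > 0" for \<epsilon>
      using word_term_small[OF assms that] by auto
  qed auto
  from tendsto_mult_left_C[OF this, of "(-1) ^ length w"] show ?thesis
    unfolding nlim_star_def[symmetric] by (simp only: sum_nondecreasing flip: eq)
qed

lemma nested_sum_eq: "nested_sum g s = nlim (map (\<lambda>n d. g d n) s)"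
  unfolding nested_sum_def nlim_def length_map by (intro infsum_cong) (auto simp: word_term_def intro!: prod.cong)

lemma nested_sum_star_inv_eq: "nested_sum_star_inv g s = nlim_star (map (\<lambda>n d. g d n) s)"
  unfolding nested_sum_star_inv_def nlim_star_def length_map
  by (intro arg_cong[of _ _ "\<lambda>x. (-1) ^ length s * x"] infsum_cong) (auto simp: word_term_def intro!: prod.cong)

end

section \<open>The Carlitz polynomials and power sums\<close>

text \<open>The polynomial (1 + X)^q - X^q - 1 vanishes at all q elements of the field but has
  degree below q, so all its coefficients are 0.\<close>

lemma of_nat_choose_card_finite_field:
  assumes "0 < k" "k < CARD('a)" shows "of_nat (CARD('a) choose k) = (0 :: 'a::finite_field)"
proof -
  let ?P = "[:1, 1:] ^ CARD('a) - Polynomial.monom 1 CARD('a) - 1 :: 'a poly"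
  have P: "poly ?P c = 0" for c
    by (simp add: poly_monom finite_field_power_card_eq_same)
  have "Polynomial.degree ?P \<le> CARD('a)"
    by (intro degree_diff_le) (simp_all add: degree_power_eq degree_monom_le)
  moreover have "Polynomial.coeff ?P CARD('a) = 0"
    by (simp add: coeff_linear_poly_power)
  ultimately have "?P = 0 \<or> Polynomial.degree ?P < CARD('a)"
    by (metis le_neq_implies_less leading_coeff_0_iff)
  moreover have "?P = 0" if "Polynomial.degree ?P < CARD('a)"
  proof (rule ccontr)
    assume "?P \<noteq> 0"
    from card_poly_roots_bound[OF this] have "CARD('a) \<le> Polynomial.degree ?P" using P by simp
    then show False using that by simp
  qed
  ultimately have "Polynomial.coeff ?P k = 0" by (metis coeff_0)
  then show ?thesis using assms by (simp add: coeff_linear_poly_power)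
qed

section \<open>Constants, Frobenius and absolute values\<close>

context C_infinity
begin

definition cst :: "'k \<Rightarrow> 'c" where "cst c = j (to_ac (fls_const c))"

abbreviation \<theta> :: 'c where "\<theta> \<equiv> theta j"

lemma q_ge_2: "CARD('k) \<ge> 2"
proof -
  have "card {0, 1 :: 'k} \<le> CARD('k)" by (rule card_mono) auto
  then show ?thesis by simp
qed

lemma q_pos [simp]: "CARD('k) > 0"
  using q_ge_2 by linarith

lemma j_0 [simp]: "j 0 = 0"
  by (metis add.right_neutral add_left_cancel j_add)

lemma cst_0 [simp]: "cst 0 = 0" and cst_1 [simp]: "cst 1 = 1"
  and cst_add: "cst (a + b) = cst a + cst b" and cst_mult: "cst (a * b) = cst a * cst b"
  by (simp_all add: cst_def j_one j_mult[symmetric] j_add[symmetric] to_ac_mult[symmetric] to_ac_add[symmetric]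
      fls_plus_const fls_const_mult_const del: to_ac_mult to_ac_add)

lemma cst_power: "cst (a ^ n) = cst a ^ n"
  by (induction n) (simp_all add: cst_mult)

lemma cst_diff: "cst (a - b) = cst a - cst b"
  using cst_add[of "a - b" b] by simp

lemma cst_of_nat: "cst (of_nat n) = of_nat n"
  by (induction n) (simp_all add: cst_add)

lemma cst_power_q: "cst c ^ CARD('k) ^ i = cst c"
  by (simp add: finite_field_power_card_power_eq_same flip: cst_power)

lemma v_cst_le: "v (cst c) \<le> 1"
  using j_isometry[of "fls_const c" 0] by (simp add: cst_def dist_fls_def)

lemma v_theta: "v \<theta> = 2"
  using j_isometry[of fls_X_inv 0] by (simp add: theta_def dist_fls_def)

lemma frobenius_add: "(x + y :: 'c) ^ CARD('k) = x ^ CARD('k) + y ^ CARD('k)"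
proof -
  have "(x + y) ^ CARD('k) = (\<Sum>k\<le>CARD('k). of_nat (CARD('k) choose k) * x ^ k * y ^ (CARD('k) - k))"
    by (rule binomial_ring)
  also have "\<dots> = (\<Sum>k\<in>{0, CARD('k)}. of_nat (CARD('k) choose k) * x ^ k * y ^ (CARD('k) - k))"
  proof (intro sum.mono_neutral_right ballI)
    fix k assume "k \<in> {..CARD('k)} - {0, CARD('k)}"
    then have "of_nat (CARD('k) choose k) = (0 :: 'c)"
      using of_nat_choose_card_finite_field[where 'a = 'k, of k] by (subst cst_of_nat[symmetric]) simp
    then show "of_nat (CARD('k) choose k) * x ^ k * y ^ (CARD('k) - k) = 0" by simp
  qed auto
  also have "\<dots> = x ^ CARD('k) + y ^ CARD('k)" using q_ge_2 by (simp add: add.commute)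
  finally show ?thesis .
qed

lemma of_nat_q: "of_nat CARD('k) = (0 :: 'c)"
  using of_nat_choose_card_finite_field[where 'a = 'k, of 1] q_ge_2 by (subst cst_of_nat[symmetric]) simp

lemma frobenius_pow_add: "(x + y :: 'c) ^ CARD('k) ^ i = x ^ CARD('k) ^ i + y ^ CARD('k) ^ i"
  by (induction i) (simp_all add: power_mult frobenius_add mult.commute[of "CARD('k)"])

lemma frobenius_pow_diff: "(x - y :: 'c) ^ CARD('k) ^ i = x ^ CARD('k) ^ i - y ^ CARD('k) ^ i"
  using frobenius_pow_add[of "x - y" y i] by simp

lemma frobenius_diff: "(x - y :: 'c) ^ CARD('k) = x ^ CARD('k) - y ^ CARD('k)"
  using frobenius_pow_diff[of x y 1] by simp

lemma frobenius_sum: "(\<Sum>i\<in>I. f i :: 'c) ^ CARD('k) = (\<Sum>i\<in>I. f i ^ CARD('k))"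
  by (induction I rule: infinite_finite_induct) (simp_all add: frobenius_add)

lemma emb_0 [simp]: "emb j 0 = 0"
  by (simp add: emb_def)

lemma emb_pCons: "emb j (pCons c a) = cst c + \<theta> * emb j a"
  by (simp add: emb_def cst_def theta_def map_poly_pCons j_add j_mult)

lemma emb_diff: "emb j (a - b) = emb j a - emb j b"
  by (induction a b rule: poly_induct2) (simp_all add: emb_pCons cst_diff right_diff_distrib)

lemma v_add_eq:
  assumes "v x < v y" shows "v (x + y) = v y"
proof (rule antisym)
  show "v (x + y) \<le> v y" using v_add_le[of x y] assms by (simp add: max_def split: if_splits)
  show "v y \<le> v (x + y)" using v_add_le[of "x + y" "- x"] assms by (simp add: max_def split: if_splits)
qed

text \<open>A nonzero constant has absolute value 1, since it and its inverse are both bounded by 1;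
  in positive degree the leading term dominates. This yields injectivity of
  \<open>emb j\<close>.\<close>

lemma v_emb: "a \<noteq> 0 \<Longrightarrow> v (emb j a) = 2 ^ Polynomial.degree a"
proof (induction a rule: pCons_induct)
  case (pCons c a)
  show ?case
  proof (cases "a = 0")
    case True
    then have "c \<noteq> 0" using pCons by auto
    then have "v (cst c) * v (cst (inverse c)) = 1" by (simp flip: dist_mult cst_mult)
    moreover have "v (cst c) * v (cst (inverse c)) \<le> v (cst c) * 1"
      using v_cst_le by (intro mult_left_mono) auto
    ultimately have "v (cst c) = 1" using v_cst_le[of c] by linarith
    then show ?thesis using True by (simp add: emb_pCons)
  next
    case False
    then have e: "v (\<theta> * emb j a) = 2 ^ Suc (Polynomial.degree a)"
      using pCons by (simp add: dist_mult v_theta)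
    have "(1::real) < 2 ^ Suc (Polynomial.degree a)" by (rule one_less_power) auto
    then have "v (cst c) < v (\<theta> * emb j a)" using v_cst_le[of c] e by linarith
    then show ?thesis using e False by (simp add: emb_pCons v_add_eq)
  qed
qed simp

lemma emb_eq_0_iff: "emb j a = 0 \<longleftrightarrow> a = 0"
  using v_emb[of a] by force

lemma inj_emb: "inj (emb j)"
  by (rule injI) (metis emb_diff emb_eq_0_iff right_minus_eq)

lemma v_bracket: "i > 0 \<Longrightarrow> v (\<theta> - \<theta> ^ CARD('k) ^ i) = 2 ^ CARD('k) ^ i"
proof -
  assume "i > 0"
  then have "CARD('k) ^ 1 \<le> CARD('k) ^ i" using q_pos by (intro power_increasing) auto
  then have "1 < CARD('k) ^ i" using q_ge_2 by simp
  then have "(2::real) ^ 1 < 2 ^ CARD('k) ^ i" by (intro power_strict_increasing) auto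
  then have "v \<theta> < v (- (\<theta> ^ CARD('k) ^ i))" by (simp add: v_theta v_power)
  from v_add_eq[OF this] show ?thesis by (simp add: v_theta v_power)
qed

lemma bracket_nonzero: "i > 0 \<Longrightarrow> \<theta> - \<theta> ^ CARD('k) ^ i \<noteq> 0"
  using v_bracket[of i] by force

section \<open>The sequences \<open>y\<close> and \<open>u\<close> and their Frobenius
  relations\<close>

definition y :: "nat \<Rightarrow> 'c" where "y d = inverse (L_val j d)"

definition u :: "nat \<Rightarrow> 'c" where "u d = (\<Sum>e<d. y e ^ (CARD('k) - 1))"

abbreviation L1 :: 'c where "L1 \<equiv> L_val j 1"

lemma L_0 [simp]: "L_val j 0 = 1" and L_Suc: "L_val j (Suc d) = L_val j d * (\<theta> - \<theta> ^ CARD('k) ^ Suc d)"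
  by (simp_all add: L_val_def)

lemma L1_eq: "L1 = \<theta> - \<theta> ^ CARD('k)"
  using L_Suc[of 0] by simp

lemma L_nonzero: "L_val j d \<noteq> 0"
proof (induction d)
  case (Suc d)
  then show ?case using bracket_nonzero[of "Suc d"] by (simp only: L_Suc) simp
qed simp

lemma L_power: "L_val j (Suc d) ^ CARD('k) = L_val j d ^ CARD('k) * (\<theta> ^ CARD('k) - \<theta> ^ CARD('k) ^ Suc (Suc d))"
  unfolding L_Suc power_mult_distrib frobenius_diff by (simp flip: power_mult add: mult.commute)

lemma y_u_0 [simp]: "y 0 = 1" "u 0 = 0"
  by (simp_all add: y_def u_def)

lemma u_Suc: "u (Suc d) = u d + y d ^ (CARD('k) - 1)"
  by (simp add: u_def)

lemma y_tendsto_0: "y \<longlonglongrightarrow> 0"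
proof -
  have L: "(2::real) ^ d \<le> v (L_val j d)" for d
  proof (induction d)
    case (Suc d)
    have "(2::real) ^ 1 \<le> 2 ^ CARD('k) ^ Suc d"
      using q_pos by (intro power_increasing) (simp_all del: power_Suc)
    then have "v (\<theta> - \<theta> ^ CARD('k) ^ Suc d) \<ge> 2" using v_bracket[of "Suc d"] by simp
    then have "v (L_val j d) * v (\<theta> - \<theta> ^ CARD('k) ^ Suc d) \<ge> 2 ^ d * 2"
      using Suc by (intro mult_mono) auto
    then show ?case by (simp only: L_Suc dist_mult power_Suc2)
  qed simp
  have "v (y d) \<le> inverse 2 ^ d" for d
    unfolding y_def v_inverse power_inverse by (rule le_imp_inverse_le[OF L]) simp
  then have "(\<lambda>d. v (y d)) \<longlonglongrightarrow> 0"
    using tendsto_sandwich[of "\<lambda>_. 0" "\<lambda>d. v (y d)" sequentially "\<lambda>d. inverse (2 :: real) ^ d" 0]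
    by (simp add: LIMSEQ_realpow_zero)
  then show ?thesis using tendsto_iff_v[of y 0] by simp
qed

text \<open>A closed form for the partial sums: u_(d+1) = L_(d+1) / (L_1 L_d^q).\<close>

lemma L1_u: "L1 * L_val j d ^ CARD('k) * u (Suc d) = L_val j (Suc d)"
proof (induction d)
  case 0
  show ?case by (simp add: u_Suc)
next
  case (Suc d)
  let ?l = "L_val j (Suc d)"
  have qS: "CARD('k) = Suc (CARD('k) - 1)" using q_pos by simp
  have "?l ^ CARD('k) * y (Suc d) ^ (CARD('k) - 1) = ?l * (?l ^ (CARD('k) - 1) * y (Suc d) ^ (CARD('k) - 1))"
    by (subst (1) qS) (simp only: power_Suc mult.assoc)
  also have "\<dots> = ?l" using L_nonzero[of "Suc d"] by (simp add: y_def flip: power_mult_distrib)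
  finally have yl: "?l ^ CARD('k) * y (Suc d) ^ (CARD('k) - 1) = ?l" .
  have "L1 * ?l ^ CARD('k) * u (Suc (Suc d)) = L1 * ?l ^ CARD('k) * u (Suc d) + L1 * (?l ^ CARD('k) * y (Suc d) ^ (CARD('k) - 1))"
    by (simp only: u_Suc[of "Suc d"]) (simp only: distrib_left mult.assoc)
  also have "L1 * ?l ^ CARD('k) * u (Suc d) =
      (L1 * L_val j d ^ CARD('k) * u (Suc d)) * (\<theta> ^ CARD('k) - \<theta> ^ CARD('k) ^ Suc (Suc d))"
    unfolding L_power by (simp only: mult_ac)
  also have "L1 * L_val j d ^ CARD('k) * u (Suc d) = ?l" by (rule Suc)
  \<comment> \<open>The brackets theta^q - theta^(q^(d+2)) and L_1 = theta - theta^q add up to the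
    last factor of L_(d+2).\<close>
  finally show ?case unfolding yl L_Suc[of "Suc d"] L1_eq by (simp add: algebra_simps)
qed

lemma y_frobenius: "y d ^ CARD('k) = L1 * y (Suc d) * u (Suc d)"
proof -
  have "L1 * y (Suc d) * u (Suc d) * L_val j d ^ CARD('k) = y (Suc d) * (L1 * L_val j d ^ CARD('k) * u (Suc d))"
    by (simp only: mult_ac)
  also have "\<dots> = 1" unfolding L1_u using L_nonzero[of "Suc d"] by (simp add: y_def)
  also have "1 = y d ^ CARD('k) * L_val j d ^ CARD('k)"
    using L_nonzero[of d] by (simp add: y_def flip: power_mult_distrib)
  finally show ?thesis using L_nonzero[of d] by simp
qed

text \<open>\<open>u d\<close> is \<open>u (Suc d)\<close> minus a power of \<open>y d\<close>,
  whose q-th power \<open>y_frobenius\<close> moves to index \<open>Suc d\<close>. Thus q-th powers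
  at \<open>d\<close> become polynomials in \<open>y\<close> and \<open>u\<close> at
  \<open>Suc d\<close>.\<close>

lemma u_frobenius: "u d ^ CARD('k) = u (Suc d) ^ CARD('k) - (L1 * y (Suc d) * u (Suc d)) ^ (CARD('k) - 1)"
proof -
  have "u (Suc d) ^ CARD('k) = u d ^ CARD('k) + (y d ^ CARD('k)) ^ (CARD('k) - 1)"
    by (simp add: u_Suc frobenius_add mult.commute flip: power_mult)
  then show ?thesis unfolding y_frobenius by simp
qed

text \<open>
  \<open>Dc i\<close> is Carlitz's \<open>D\<^sub>i\<close>, and \<open>carlitz d x\<close> is \<open>e\<^sub>d(x) / D\<^sub>d\<close> for \<open>e\<^sub>d(x) = \<Prod>\<^bsub>deg a < d\<^esub> (x - a)\<close>; its coefficient of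
  \<open>x\<^bsup>q^i\<^esup>\<close> is \<open>gc d i\<close>.
\<close>

fun Dc :: "nat \<Rightarrow> 'c" where
  "Dc 0 = 1"
| "Dc (Suc i) = (\<theta> ^ CARD('k) ^ Suc i - \<theta>) * Dc i ^ CARD('k)"

lemma Dc_nonzero: "Dc i \<noteq> 0"
proof (induction i)
  case (Suc i)
  then show ?case using bracket_nonzero[of "Suc i"] by auto
qed simp

definition gc :: "nat \<Rightarrow> nat \<Rightarrow> 'c"
  where "gc d i = (if i \<le> d then y (d - i) ^ CARD('k) ^ i / Dc i else 0)"

definition carlitz :: "nat \<Rightarrow> 'c \<Rightarrow> 'c"
  where "carlitz d x = (\<Sum>i\<le>d. gc d i * x ^ CARD('k) ^ i)"

lemma gc_Suc_Suc: "gc (Suc d) (Suc i) * (\<theta> ^ CARD('k) ^ Suc i - \<theta>) = gc d i ^ CARD('k)"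
proof (cases "i \<le> d")
  case True
  have "\<theta> ^ CARD('k) ^ Suc i - \<theta> \<noteq> 0" using bracket_nonzero[of "Suc i"] by auto
  then show ?thesis using True Dc_nonzero[of i]
    by (simp add: gc_def power_divide power_mult[symmetric] mult.commute field_simps)
qed (simp add: gc_def)

lemma gc_Suc_left: "gc d i = gc (Suc d) i * (\<theta> ^ CARD('k) ^ i - \<theta> ^ CARD('k) ^ Suc d)"
proof (cases "i \<le> d")
  case True
  have "y (d - i) = y (Suc d - i) * (\<theta> - \<theta> ^ CARD('k) ^ (Suc d - i))"
    using True L_nonzero bracket_nonzero[of "Suc (d - i)"]
    by (simp add: y_def L_Suc Suc_diff_le del: power_Suc)
  then have "y (d - i) ^ CARD('k) ^ i = y (Suc d - i) ^ CARD('k) ^ i * (\<theta> ^ CARD('k) ^ i - (\<theta> ^ CARD('k) ^ (Suc d - i)) ^ CARD('k) ^ i)"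
    by (simp only: power_mult_distrib frobenius_pow_diff)
  also have "(\<theta> ^ CARD('k) ^ (Suc d - i)) ^ CARD('k) ^ i = \<theta> ^ CARD('k) ^ Suc d"
    using True by (simp flip: power_mult power_add del: power_Suc)
  finally show ?thesis using True by (simp add: gc_def)
next
  case False
  \<comment> \<open>At \<open>i = Suc d\<close> the bracket is zero, in agreement with the default
    value 0 of \<open>gc d i\<close>.\<close>
  then show ?thesis by (cases "i = Suc d") (simp_all add: gc_def)
qed

lemma carlitz_add: "carlitz d (x + z) = carlitz d x + carlitz d z"
  by (simp add: carlitz_def frobenius_pow_add distrib_left sum.distrib)

lemma carlitz_cst: "carlitz d (cst c) = cst c * carlitz d 1"
  by (simp add: carlitz_def cst_power_q sum_distrib_left mult.commute)

lemma carlitz_power: "carlitz d x ^ CARD('k) = (\<Sum>i\<le>d. gc d i ^ CARD('k) * x ^ CARD('k) ^ Suc i)"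
  by (simp add: carlitz_def frobenius_sum power_mult_distrib mult.commute flip: power_mult)

text \<open>This is \<open>gc_Suc_Suc\<close> summed over the coefficients, the term of degree one
  dropping out. Together with additivity it determines \<open>carlitz\<close> on polynomials by
  Horner's scheme.\<close>

lemma carlitz_theta: "carlitz (Suc d) (\<theta> * x) = \<theta> * carlitz (Suc d) x + carlitz d x ^ CARD('k)"
proof -
  have "carlitz (Suc d) (\<theta> * x) - \<theta> * carlitz (Suc d) x
      = (\<Sum>i\<le>Suc d. gc (Suc d) i * (\<theta> ^ CARD('k) ^ i - \<theta>) * x ^ CARD('k) ^ i)"
    by (simp add: carlitz_def sum_distrib_left power_mult_distrib algebra_simps sum_subtractf
        del: sum.atMost_Suc)
  also have "\<dots> = (\<Sum>i\<le>d. gc (Suc d) (Suc i) * (\<theta> ^ CARD('k) ^ Suc i - \<theta>) * x ^ CARD('k) ^ Suc i)"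
    unfolding sum.atMost_Suc_shift by simp
  also have "\<dots> = carlitz d x ^ CARD('k)"
    unfolding gc_Suc_Suc carlitz_power ..
  finally show ?thesis by (simp add: algebra_simps)
qed

text \<open>Combines the two recursions for \<open>gc\<close>. It is needed for the value at 1,
  where the right-hand side is 1 - 1 or 0 - 0.\<close>

lemma carlitz_Suc: "(\<theta> ^ CARD('k) ^ Suc d - \<theta>) * carlitz (Suc d) x = carlitz d x ^ CARD('k) - carlitz d x"
proof -
  have "carlitz d x ^ CARD('k) = (\<Sum>i\<le>Suc d. gc (Suc d) i * (\<theta> ^ CARD('k) ^ i - \<theta>) * x ^ CARD('k) ^ i)"
    unfolding sum.atMost_Suc_shift carlitz_power gc_Suc_Suc by simp
  moreover have "carlitz d x = (\<Sum>i\<le>Suc d. gc (Suc d) i * (\<theta> ^ CARD('k) ^ i - \<theta> ^ CARD('k) ^ Suc d) * x ^ CARD('k) ^ i)"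
  proof -
    have "carlitz d x = (\<Sum>i\<le>Suc d. gc d i * x ^ CARD('k) ^ i)" by (simp add: carlitz_def gc_def)
    then show ?thesis by (simp only: gc_Suc_left[of d])
  qed
  ultimately show ?thesis
    by (simp add: carlitz_def sum_distrib_left algebra_simps flip: sum_subtractf del: sum.atMost_Suc power_Suc)
qed

lemma carlitz_0 [simp]: "carlitz 0 x = x"
  by (simp add: carlitz_def gc_def)

lemma carlitz_1: "carlitz d 1 = (if d = 0 then 1 else 0)"
proof (induction d)
  case (Suc d)
  have "(\<theta> ^ CARD('k) ^ Suc d - \<theta>) * carlitz (Suc d) 1 = 0"
    unfolding carlitz_Suc Suc by simp
  moreover have "\<theta> ^ CARD('k) ^ Suc d - \<theta> \<noteq> 0" using bracket_nonzero[of "Suc d"] by auto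
  ultimately show ?case by simp
qed simp

text \<open>Horner's scheme: for positive \<open>d\<close> the constant coefficient is killed by
  \<open>carlitz_1\<close>, the term at \<open>Suc d'\<close> vanishes for degree reasons, and what
  remains is a q-th power of a constant, equal to that constant.\<close>

lemma carlitz_emb: "Polynomial.degree a \<le> d \<Longrightarrow> carlitz d (emb j a) = cst (Polynomial.coeff a d)"
proof (induction a arbitrary: d rule: pCons_induct)
  case 0
  then show ?case by (simp add: carlitz_def power_0_left)
next
  case (pCons c a)
  show ?case
  proof (cases d)
    case 0
    then have "a = 0" using pCons.prems by (auto split: if_splits)
    then show ?thesis using 0 by (simp add: emb_pCons)
  next
    case (Suc d')
    have deg: "Polynomial.degree a \<le> d'" using pCons.prems Suc by (cases "a = 0") auto
    have "carlitz d (emb j (pCons c a)) = \<theta> * carlitz (Suc d') (emb j a) + carlitz d' (emb j a) ^ CARD('k)"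
      using Suc by (simp add: emb_pCons carlitz_add carlitz_cst carlitz_1 carlitz_theta)
    also have "carlitz (Suc d') (emb j a) = 0"
      using pCons.IH[of "Suc d'"] deg by (simp add: coeff_eq_0)
    also have "carlitz d' (emb j a) ^ CARD('k) = cst (Polynomial.coeff a d')"
      using pCons.IH[OF deg] cst_power_q[of _ 1] by simp
    finally show ?thesis using Suc by simp
  qed
qed

definition monics :: "nat \<Rightarrow> 'k poly set"
  where "monics d = {a. lead_coeff a = 1 \<and> Polynomial.degree a = d}"

text \<open>The coefficients below the leading one are free. The count has to match the degree of
  \<open>Hp d\<close>.\<close>

lemma monics_finite_card: "finite (monics d)" "card (monics d) = CARD('k) ^ d"
proof -
  let ?L = "{xs :: 'k list. set xs \<subseteq> UNIV \<and> length xs = d}"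
  have "bij_betw (\<lambda>xs. Poly (xs @ [1])) ?L (monics d)"
  proof (rule bij_betw_byWitness[where f' = "\<lambda>a. map (Polynomial.coeff a) [0..<d]"])
    have c: "Polynomial.coeff (Poly (xs @ [1])) n = nth_default 0 (xs @ [1]) n" for xs :: "'k list" and n
      by (simp add: coeff_Poly_eq)
    have deg: "Polynomial.degree (Poly (xs @ [1 :: 'k])) = length xs" for xs
    proof (rule antisym)
      show "Polynomial.degree (Poly (xs @ [1])) \<le> length xs"
        by (rule degree_le) (simp add: nth_default_def)
      show "length xs \<le> Polynomial.degree (Poly (xs @ [1 :: 'k]))"
        by (rule le_degree) (simp add: nth_default_def nth_append)
    qed
    show "\<forall>xs\<in>?L. map (Polynomial.coeff (Poly (xs @ [1]))) [0..<d] = xs"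
      by (auto intro!: nth_equalityI simp: nth_default_def nth_append)
    show "\<forall>a\<in>monics d. Poly (map (Polynomial.coeff a) [0..<d] @ [1]) = a"
      by (auto intro!: poly_eqI simp: monics_def nth_default_def nth_append coeff_eq_0 less_Suc_eq)
    show "(\<lambda>xs. Poly (xs @ [1])) ` ?L \<subseteq> monics d"
      by (auto simp: monics_def deg nth_default_def nth_append)
    show "(\<lambda>a. map (Polynomial.coeff a) [0..<d]) ` monics d \<subseteq> ?L" by auto
  qed
  then have "card (monics d) = card ?L" "finite (monics d) \<longleftrightarrow> finite ?L"
    using bij_betw_same_card bij_betw_finite by fastforce+
  then show "finite (monics d)" "card (monics d) = CARD('k) ^ d"
    using finite_lists_length_eq[of "UNIV :: 'k set" d] card_lists_length_eq[of "UNIV :: 'k set" d] by auto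
qed

lemma S_val_eq: "S_val j d s = (\<Sum>a\<in>monics d. inverse (emb j a ^ s))"
  by (simp add: S_val_def monics_def)

end

lemma pderiv_sum: "pderiv (sum f A) = (\<Sum>x\<in>A. pderiv (f x :: 'a::idom poly))"
  by (induction A rule: infinite_finite_induct) (simp_all add: pderiv_add)

lemma prod_linear_dvd:
  fixes p :: "'a::idom poly"
  assumes "finite A" "\<And>a. a \<in> A \<Longrightarrow> poly p a = 0"
  shows "(\<Prod>a\<in>A. [:- a, 1:]) dvd p"
  using assms
proof (induction A arbitrary: p)
  case (insert a A)
  then obtain k where k: "p = (\<Prod>a\<in>A. [:- a, 1:]) * k" by (meson dvdE insertI2)
  have "poly (\<Prod>a\<in>A. [:- a, 1:]) a \<noteq> 0" using insert by (auto simp: poly_prod)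
  moreover have "poly p a = 0" using insert by simp
  ultimately have "poly k a = 0" using k by simp
  then have "[:- a, 1:] dvd k" by (simp add: poly_eq_0_iff_dvd)
  then have "(\<Prod>a\<in>A. [:- a, 1:]) * [:- a, 1:] dvd p" unfolding k by (rule mult_dvd_mono[OF dvd_refl])
  then show ?case using insert by (simp add: mult.commute)
qed simp

context C_infinity
begin

text \<open>
  \<open>1 - carlitz d\<close> vanishes exactly at the monic polynomials of degree \<open>d\<close>; its logarithmic derivative
  is, up to sign, the generating function of the power sums.
\<close>

definition Hp :: "nat \<Rightarrow> 'c poly"
  where "Hp d = 1 - (\<Sum>i\<le>d. Polynomial.monom (gc d i) (CARD('k) ^ i))"

lemma poly_Hp: "poly (Hp d) x = 1 - carlitz d x"
  by (simp add: Hp_def carlitz_def poly_sum poly_monom)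

text \<open>\<open>Hp d\<close> has degree at most q^d and as many roots. The constant stays
  unspecified because it cancels in the logarithmic derivative.\<close>

lemma Hp_factor:
  "\<exists>c. Hp d = Polynomial.smult c (\<Prod>a\<in>monics d. [:- emb j a, 1:])"
proof -
  let ?P = "\<Prod>x\<in>emb j ` monics d. [:- x, 1:]"
  have P: "?P = (\<Prod>a\<in>monics d. [:- emb j a, 1:])"
    by (rule prod.reindex_cong[OF inj_on_subset[OF inj_emb]]) auto
  have "?P dvd Hp d"
  proof (rule prod_linear_dvd)
    fix x assume "x \<in> emb j ` monics d"
    then show "poly (Hp d) x = 0"
      by (auto simp: poly_Hp carlitz_emb monics_def)
  qed (simp add: monics_finite_card)
  then obtain k where k: "Hp d = ?P * k" by (rule dvdE)
  have "Polynomial.coeff (Hp d) 0 = 1"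
    by (simp add: Hp_def coeff_sum Polynomial.coeff_monom)
  then have k0: "k \<noteq> 0" using k by auto
  have degP: "Polynomial.degree ?P = CARD('k) ^ d"
    unfolding P by (subst degree_prod_sum_eq) (auto simp: monics_finite_card)
  have "Polynomial.degree (Hp d) \<le> CARD('k) ^ d"
    unfolding Hp_def
  proof (intro degree_diff_le degree_sum_le)
    fix i assume "i \<in> {..d}"
    then have "CARD('k) ^ i \<le> CARD('k) ^ d" by (intro power_increasing) auto
    then show "Polynomial.degree (Polynomial.monom (gc d i) (CARD('k) ^ i)) \<le> CARD('k) ^ d"
      using degree_monom_le order_trans by blast
  qed auto
  moreover have "Polynomial.degree (Hp d) = CARD('k) ^ d + Polynomial.degree k"
    unfolding k using k0 degP by (subst degree_mult_eq) auto
  ultimately have "Polynomial.degree k = 0" by simp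
  then obtain c where "k = [:c:]" by (rule degree_eq_zeroE)
  then show ?thesis using k P by auto
qed

text \<open>Every exponent q^i with positive i is zero in the field, so only the linear term
  survives.\<close>

lemma pderiv_Hp: "pderiv (Hp d) = [:- y d:]"
proof -
  have "pderiv (Polynomial.monom (gc d i) (CARD('k) ^ i)) = (if i = 0 then [:y d:] else 0)" for i
    using of_nat_q by (auto simp: pderiv_monom gc_def monom_0)
  then show ?thesis by (simp add: Hp_def pderiv_diff pderiv_sum sum.delta)
qed

text \<open>The series \<open>?E a\<close> is the expansion of 1 / (a - X); summed over the roots it
  gives - Hp' / Hp, which is y / Hp by \<open>pderiv_Hp\<close>.\<close>

lemma Hp_power_sums:
  "fps_of_poly (Hp d) * Abs_fps (\<lambda>n. S_val j d (Suc n)) = fps_const (y d)"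
proof -
  let ?A = "monics d"
  let ?E = "\<lambda>a. Abs_fps (\<lambda>n. inverse (emb j a ^ Suc n))"
  let ?Q = "\<lambda>a. \<Prod>b\<in>?A - {a}. [:- emb j b, 1:]"
  obtain c where c: "Hp d = Polynomial.smult c (\<Prod>a\<in>?A. [:- emb j a, 1:])" using Hp_factor by blast
  have E: "(fps_X - fps_const (emb j a)) * ?E a = - 1" if "a \<in> ?A" for a
  proof -
    have a0: "emb j a \<noteq> 0" using that by (auto simp: emb_eq_0_iff monics_def)
    show ?thesis
    proof (rule fps_ext)
      fix n
      show "((fps_X - fps_const (emb j a)) * ?E a) $ n = (- 1) $ n"
        using a0 by (cases n) (simp_all add: left_diff_distrib)
    qed
  qed
  have Hp: "fps_of_poly (Hp d) * ?E a = - fps_const c * fps_of_poly (?Q a)" if "a \<in> ?A" for a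
  proof -
    have "Hp d = Polynomial.smult c (?Q a * [:- emb j a, 1:])"
      unfolding c using that by (subst prod.remove[of _ a]) (auto simp: monics_finite_card mult.commute)
    moreover have "fps_of_poly [:- emb j a, 1:] = fps_X - fps_const (emb j a)"
      by (simp add: fps_of_poly_linear flip: fps_const_neg)
    ultimately have "fps_of_poly (Hp d) = fps_const c * (fps_of_poly (?Q a) * (fps_X - fps_const (emb j a)))"
      by (simp only: fps_of_poly_smult fps_of_poly_mult)
    then have "fps_of_poly (Hp d) * ?E a =
        fps_const c * (fps_of_poly (?Q a) * ((fps_X - fps_const (emb j a)) * ?E a))"
      by (simp only: mult.assoc)
    then show ?thesis unfolding E[OF that] by simp
  qed
  have S: "Abs_fps (\<lambda>n. S_val j d (Suc n)) = (\<Sum>a\<in>?A. ?E a)"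
    by (rule fps_ext) (simp add: S_val_eq fps_sum_nth)
  have "fps_of_poly (Hp d) * (\<Sum>a\<in>?A. ?E a) = (\<Sum>a\<in>?A. - fps_const c * fps_of_poly (?Q a))"
    unfolding sum_distrib_left by (intro sum.cong refl Hp)
  also have "\<dots> = - fps_of_poly (Polynomial.smult c (\<Sum>a\<in>?A. ?Q a))"
    by (simp add: fps_of_poly_smult fps_of_poly_sum sum_distrib_left sum_negf flip: fps_const_neg)
  also have "Polynomial.smult c (\<Sum>a\<in>?A. ?Q a) = pderiv (Hp d)"
    unfolding c by (simp add: pderiv_smult pderiv_prod pderiv_pCons)
  finally show ?thesis by (simp add: S pderiv_Hp fps_of_poly_const)
qed

text \<open>The coefficient of x^m in \<open>carlitz d\<close>; at most one \<open>i\<close>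
  contributes, because q is at least 2.\<close>

definition Gc :: "nat \<Rightarrow> nat \<Rightarrow> 'c"
  where "Gc m d = (\<Sum>i\<le>d. if CARD('k) ^ i = m then gc d i else 0)"

lemma Gc_1: "Gc 1 d = y d"
proof -
  have "CARD('k) ^ i = 1 \<longleftrightarrow> i = 0" for i using q_ge_2 by (cases i) auto
  then show ?thesis by (simp add: Gc_def gc_def sum.delta)
qed

lemma Gc_power: "Gc (CARD('k) ^ k) d = gc d k"
proof -
  have "CARD('k) ^ i = CARD('k) ^ k \<longleftrightarrow> i = k" for i using q_ge_2 by (simp add: power_inject_exp)
  then show ?thesis by (simp add: Gc_def gc_def sum.delta)
qed

lemma Gc_other: "(\<And>k. m \<noteq> CARD('k) ^ k) \<Longrightarrow> Gc m d = 0"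
  unfolding Gc_def by (rule sum.neutral) (metis (full_types))

lemma coeff_Hp: "m > 0 \<Longrightarrow> Polynomial.coeff (Hp d) m = - Gc m d"
  by (simp add: Hp_def coeff_sum Polynomial.coeff_monom Gc_def)

text \<open>Comparison of coefficients in \<open>Hp_power_sums\<close>, the constant term of
  \<open>Hp d\<close> being 1: a recursion of Newton's type for the power sums.\<close>

lemma S_val_1: "S_val j d 1 = y d"
  and S_val_rec: "n > 0 \<Longrightarrow> S_val j d (Suc n) = (\<Sum>m=1..n. Gc m d * S_val j d (Suc n - m))"
proof -
  have H0: "Polynomial.coeff (Hp d) 0 = 1"
    by (simp add: Hp_def coeff_sum Polynomial.coeff_monom)
  have eq: "(\<Sum>i=0..n. Polynomial.coeff (Hp d) i * S_val j d (Suc n - i)) = (if n = 0 then y d else 0)" for n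
  proof -
    have "(\<Sum>i=0..n. Polynomial.coeff (Hp d) i * S_val j d (Suc n - i)) =
        (fps_of_poly (Hp d) * Abs_fps (\<lambda>n. S_val j d (Suc n))) $ n"
      unfolding fps_mult_nth by (rule sum.cong) (simp_all add: Suc_diff_le)
    then show ?thesis unfolding Hp_power_sums by simp
  qed
  show "S_val j d 1 = y d" using eq[of 0] H0 by simp
  assume "n > 0"
  then have "0 = S_val j d (Suc n) + (\<Sum>i=1..n. Polynomial.coeff (Hp d) i * S_val j d (Suc n - i))"
    using eq[of n] H0 by (simp add: sum.atLeast_Suc_atMost)
  also have "(\<Sum>i=1..n. Polynomial.coeff (Hp d) i * S_val j d (Suc n - i)) = - (\<Sum>m=1..n. Gc m d * S_val j d (Suc n - m))"
    unfolding sum_negf[symmetric] by (rule sum.cong) (simp_all add: coeff_Hp)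
  finally show "S_val j d (Suc n) = (\<Sum>m=1..n. Gc m d * S_val j d (Suc n - m))" by simp
qed

end

section \<open>Comparison of the two kinds of power sums\<close>

lemma ring_of_type_algebra_simps [simp]:
  "carrier ring_of_type_algebra = UNIV"
  "x \<otimes>\<^bsub>ring_of_type_algebra\<^esub> x' = x * x'"
  "x \<oplus>\<^bsub>ring_of_type_algebra\<^esub> x' = x + x'"
  "\<one>\<^bsub>ring_of_type_algebra\<^esub> = 1"
  "\<zero>\<^bsub>ring_of_type_algebra\<^esub> = 0"
  by (simp_all add: ring_of_type_algebra_def)

lemma a_inv_ring_of_type_algebra [simp]:
  "\<ominus>\<^bsub>ring_of_type_algebra\<^esub> (x :: 'a::comm_ring_1) = - x"
proof -
  interpret cring "ring_of_type_algebra :: 'a ring" by (rule cring_from_type_algebra)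
  show ?thesis by (rule minus_equality) simp_all
qed

lemma m_inv_ring_of_type_algebra:
  "(x :: 'a::field) \<noteq> 0 \<Longrightarrow> inv\<^bsub>ring_of_type_algebra\<^esub> x = inverse x"
proof -
  assume "x \<noteq> 0"
  interpret cring "ring_of_type_algebra :: 'a ring" by (rule cring_from_type_algebra)
  show ?thesis using \<open>x \<noteq> 0\<close> by (intro comm_inv_char) simp_all
qed

locale coefficient_C_infinity = C_infinity j
  for j :: "'k::finite_field fls alg_closure \<Rightarrow> 'c::{field,complete_space}" +
  fixes R :: "'c set"
  assumes coefficient_algebra: "coefficient_algebra j R"
begin

lemma R_0: "0 \<in> R" and R_1: "1 \<in> R" and R_uminus: "r \<in> R \<Longrightarrow> - r \<in> R"
  and R_mult: "r \<in> R \<Longrightarrow> r' \<in> R \<Longrightarrow> r * r' \<in> R"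
  using coefficient_algebra subringE[of R "ring_of_type_algebra"]
  unfolding coefficient_algebra_def by (auto simp flip: a_inv_ring_of_type_algebra)

lemma R_power: "r \<in> R \<Longrightarrow> r ^ n \<in> R"
  by (induction n) (simp_all add: R_1 R_mult)

text \<open>Frobenius gives theta^(q^(i+2)) - theta = (theta^(q^(i+1)) - theta)^q - L_1, so the
  factors of \<open>Dc\<close> are polynomials in L_1 over F_p, although theta itself need not lie
  in \<open>R\<close>.\<close>

lemma Dc_inverse_R: "inverse (Dc i) \<in> R" and L1_R: "L1 \<in> R"
proof -
  define l where "l = L1"
  let ?E = "generate_field ring_of_type_algebra {l}"
  have ER: "?E \<subseteq> R" using coefficient_algebra unfolding coefficient_algebra_def l_def by blast
  have E1: "l \<in> ?E" by (rule generate_field.incl) simp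
  then show "L1 \<in> R" using ER unfolding l_def by blast
  have mult: "x * x' \<in> ?E" and add: "x + x' \<in> ?E" and minus: "- x \<in> ?E" if "x \<in> ?E" "x' \<in> ?E" for x x'
    using that generate_field.eng_mult[of x ring_of_type_algebra "{l}" x']
      generate_field.eng_add[of x ring_of_type_algebra "{l}" x']
      generate_field.a_inv[of x ring_of_type_algebra "{l}"] by simp_all
  have one: "1 \<in> ?E" using generate_field.one[of ring_of_type_algebra "{l}"] by simp
  have pow: "x ^ n \<in> ?E" if "x \<in> ?E" for x n
    by (induction n) (simp_all add: one mult that)
  have br: "\<theta> ^ CARD('k) ^ Suc i - \<theta> \<in> ?E" for i
  proof (induction i)
    case 0
    show ?case using minus[OF E1 E1] unfolding l_def L1_eq by simp
  next
    case (Suc i)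
    have "\<theta> ^ CARD('k) ^ Suc (Suc i) - \<theta> = (\<theta> ^ CARD('k) ^ Suc i - \<theta>) ^ CARD('k) + - l"
      unfolding l_def L1_eq frobenius_diff by (simp add: mult.commute flip: power_mult)
    then show ?case using add[OF pow[OF Suc] minus[OF E1 E1]] by simp
  qed
  have "Dc i \<in> ?E" for i
  proof (induction i)
    case (Suc i)
    then show ?case unfolding Dc.simps by (intro mult br pow)
  qed (simp add: one)
  then have "inv\<^bsub>ring_of_type_algebra\<^esub> Dc i \<in> ?E"
    by (rule generate_field.m_inv) (simp add: Dc_nonzero)
  then show "inverse (Dc i) \<in> R"
    unfolding m_inv_ring_of_type_algebra[OF Dc_nonzero] using ER by blast
qed

text \<open>The coefficients do not depend on the index, so such combinations can be pulled out of
  nested sums. Adding one term at a time matches the linearity lemmas for a single letter.\<close>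

inductive_set rspan :: "(nat \<Rightarrow> 'c) set \<Rightarrow> (nat \<Rightarrow> 'c) set" for B where
  rspan_zero: "(\<lambda>_. 0) \<in> rspan B"
| rspan_step: "\<lbrakk>f \<in> rspan B; r \<in> R; b \<in> B\<rbrakk> \<Longrightarrow> (\<lambda>d. f d + r * b d) \<in> rspan B"

lemma rspan_base: "b \<in> B \<Longrightarrow> b \<in> rspan B"
  using rspan_step[OF rspan_zero R_1, of b B] by simp

lemma rspan_add_smult:
  assumes "f \<in> rspan B" "g \<in> rspan B" "r \<in> R" shows "(\<lambda>d. f d + r * g d) \<in> rspan B"
  using assms(2)
proof induction
  case rspan_zero
  then show ?case using assms by simp
next
  case (rspan_step g s b)
  have "(\<lambda>d. (f d + r * g d) + (r * s) * b d) \<in> rspan B"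
    by (intro rspan.rspan_step rspan_step.IH R_mult assms(3) rspan_step.hyps)
  then show ?case by (simp add: algebra_simps)
qed

lemma rspan_add: "f \<in> rspan B \<Longrightarrow> g \<in> rspan B \<Longrightarrow> (\<lambda>d. f d + g d) \<in> rspan B"
  using rspan_add_smult[of f B g 1] R_1 by simp

lemma rspan_smult: "g \<in> rspan B \<Longrightarrow> r \<in> R \<Longrightarrow> (\<lambda>d. r * g d) \<in> rspan B"
  using rspan_add_smult[OF rspan_zero, of g B r] by simp

lemma rspan_diff: "f \<in> rspan B \<Longrightarrow> g \<in> rspan B \<Longrightarrow> (\<lambda>d. f d - g d) \<in> rspan B"
  using rspan_add_smult[of f B g "-1"] R_uminus[OF R_1] by simp

lemma rspan_sum: "(\<And>i. i \<in> A \<Longrightarrow> f i \<in> rspan B) \<Longrightarrow> (\<lambda>d. \<Sum>i\<in>A. f i d) \<in> rspan B"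
  by (induction A rule: infinite_finite_induct) (simp_all add: rspan_zero rspan_add)

text \<open>The twist \<open>\<sigma>\<close> covers \<open>shift_frobenius\<close>, which raises
  scalars to the q-th power; elsewhere it is the identity.\<close>

lemma rspan_semilinear:
  assumes "f \<in> rspan B" and "\<And>b. b \<in> B \<Longrightarrow> \<Phi> b \<in> rspan C" and "\<Phi> (\<lambda>_. 0) = (\<lambda>_. 0)"
    and "\<And>f r b. \<Phi> (\<lambda>d. f d + r * b d) = (\<lambda>d. \<Phi> f d + \<sigma> r * \<Phi> b d)"
    and "\<And>r. r \<in> R \<Longrightarrow> \<sigma> r \<in> R"
  shows "\<Phi> f \<in> rspan C"
  using assms(1) by induction (simp_all add: assms(2-5) rspan_zero rspan_add_smult)

lemma rspan_mult_fixed: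
  assumes "f \<in> rspan B" and "\<And>b. b \<in> B \<Longrightarrow> (\<lambda>d. b d * g d) \<in> rspan C"
  shows "(\<lambda>d. f d * g d) \<in> rspan C"
  using assms by (rule rspan_semilinear[where \<sigma> = "\<lambda>r. r"]) (simp_all add: algebra_simps)

lemma rspan_mult:
  assumes "f \<in> rspan B" "g \<in> rspan B'" and "\<And>b b'. b \<in> B \<Longrightarrow> b' \<in> B' \<Longrightarrow> (\<lambda>d. b d * b' d) \<in> rspan C"
  shows "(\<lambda>d. f d * g d) \<in> rspan C"
proof (rule rspan_mult_fixed[OF assms(1)])
  fix b assume b: "b \<in> B"
  have "(\<lambda>d. g d * b d) \<in> rspan C"
    by (rule rspan_mult_fixed[OF assms(2)]) (use assms(3)[OF b] in \<open>simp add: mult.commute\<close>)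
  then show "(\<lambda>d. b d * g d) \<in> rspan C" by (simp add: mult.commute)
qed

lemma rspan_mono: "f \<in> rspan B \<Longrightarrow> B \<subseteq> C \<Longrightarrow> f \<in> rspan C"
  by (induction rule: rspan.induct) (auto intro: rspan.intros)

text \<open>
  In \<open>YU a0 b0 w\<close> the letter \<open>y\<close> has weight \<open>1\<close> and \<open>u\<close> has weight \<open>q - 1\<close>; this is the grading by
  weight of multiple zeta values.
\<close>

definition yu :: "nat \<Rightarrow> nat \<Rightarrow> nat \<Rightarrow> 'c"
  where "yu a b = (\<lambda>d. y d ^ a * u d ^ b)"

definition YU :: "nat \<Rightarrow> nat \<Rightarrow> nat \<Rightarrow> (nat \<Rightarrow> 'c) set"
  where "YU a0 b0 w = {yu a b | a b. a0 \<le> a \<and> b0 \<le> b \<and> a + (CARD('k) - 1) * b = w}"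

lemma YU_memI: "a0 \<le> a \<Longrightarrow> b0 \<le> b \<Longrightarrow> a + (CARD('k) - 1) * b = w \<Longrightarrow> yu a b \<in> rspan (YU a0 b0 w)"
  by (rule rspan_base) (auto simp: YU_def)

lemma YU_mult:
  assumes "f \<in> rspan (YU a b w)" "g \<in> rspan (YU a' b' w')"
  shows "(\<lambda>d. f d * g d) \<in> rspan (YU (a + a') (b + b') (w + w'))"
proof (rule rspan_mult[OF assms])
  fix h h' assume "h \<in> YU a b w" "h' \<in> YU a' b' w'"
  then obtain m n m' n' where *: "h = yu m n" "a \<le> m" "b \<le> n" "m + (CARD('k) - 1) * n = w"
    "h' = yu m' n'" "a' \<le> m'" "b' \<le> n'" "m' + (CARD('k) - 1) * n' = w'"
    unfolding YU_def by blast
  have "(\<lambda>d. h d * h' d) = yu (m + m') (n + n')"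
    unfolding * yu_def by (simp add: power_add mult_ac)
  then show "(\<lambda>d. h d * h' d) \<in> rspan (YU (a + a') (b + b') (w + w'))"
    using * by (auto intro!: YU_memI simp: distrib_left)
qed

lemma YU_weaken: "f \<in> rspan (YU a b w) \<Longrightarrow> a' \<le> a \<Longrightarrow> b' \<le> b \<Longrightarrow> f \<in> rspan (YU a' b' w)"
  by (erule rspan_mono) (fastforce simp: YU_def)

lemma YU_power:
  assumes "f \<in> rspan (YU 0 0 w)" shows "(\<lambda>d. f d ^ n) \<in> rspan (YU 0 0 (w * n))"
proof (induction n)
  case 0
  show ?case using YU_memI[of 0 0 0 0 0] by (simp add: yu_def)
next
  case (Suc n)
  then show ?case using YU_mult[OF assms Suc] by simp
qed

text \<open>The shift comes from \<open>y_frobenius\<close>, which expresses a q-th power at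
  \<open>e\<close> by letters at \<open>Suc e\<close>. The value 0 at index 0 agrees with
  \<open>u 0 = 0\<close>.\<close>

definition shift_frobenius :: "(nat \<Rightarrow> 'c) \<Rightarrow> nat \<Rightarrow> 'c"
  where "shift_frobenius f d = (case d of 0 \<Rightarrow> 0 | Suc e \<Rightarrow> f e ^ CARD('k))"

text \<open>Each \<open>y\<close> turns into \<open>L1 * y * u\<close> and each \<open>u\<close>
  into a combination of weight q (q - 1). So weights are multiplied by q, and a factor
  \<open>u\<close> appears as soon as a \<open>y\<close> is present.\<close>

lemma shift_frobenius_YU:
  assumes "f \<in> rspan (YU 1 0 w)"
  shows "shift_frobenius f \<in> rspan (YU 1 1 (CARD('k) * w))"
proof (rule rspan_semilinear[OF assms, where \<sigma> = "\<lambda>r. r ^ CARD('k)"])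
  let ?q = "CARD('k)"
  fix f assume "f \<in> YU 1 0 w"
  then obtain a b where f: "f = yu a b" "1 \<le> a" "a + (?q - 1) * b = w" unfolding YU_def by blast
  \<comment> \<open>From index 1 on, \<open>g\<close> and \<open>h\<close> are the q-th powers of
    \<open>y\<close> and \<open>u\<close> at the previous index.\<close>
  define g where "g = (\<lambda>d. L1 * yu 1 1 d)"
  define h where "h = (\<lambda>d. u d ^ ?q - g d ^ (?q - 1))"
  have q: "1 + (?q - 1) * 1 = ?q" using q_pos by simp
  have g: "g \<in> rspan (YU 1 1 ?q)"
    unfolding g_def by (rule rspan_smult[OF YU_memI L1_R]) (use q in auto)
  have "(\<lambda>d. g d ^ (?q - 1)) \<in> rspan (YU 0 0 (?q * (?q - 1)))"
    by (rule YU_power[OF YU_weaken[OF g]]) auto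
  moreover have "yu 0 ?q \<in> rspan (YU 0 0 (?q * (?q - 1)))"
    by (rule YU_memI) auto
  ultimately have h: "h \<in> rspan (YU 0 0 (?q * (?q - 1)))"
    unfolding h_def by (intro rspan_diff) (simp_all add: yu_def)
  have "(\<lambda>d. g d * g d ^ (a - 1)) \<in> rspan (YU (1 + 0) (1 + 0) (?q + ?q * (a - 1)))"
    by (rule YU_mult[OF g YU_power[OF YU_weaken[OF g]]]) auto
  moreover have "?q + ?q * (a - 1) = ?q * a" "(\<lambda>d. g d * g d ^ (a - 1)) = (\<lambda>d. g d ^ a)"
    using f(2) by (cases a; simp)+
  ultimately have "(\<lambda>d. g d ^ a) \<in> rspan (YU 1 1 (?q * a))" by simp
  from YU_mult[OF this YU_power[OF h, of b]]
  have "(\<lambda>d. g d ^ a * h d ^ b) \<in> rspan (YU 1 1 (?q * a + ?q * (?q - 1) * b))" by simp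
  also have "?q * a + ?q * (?q - 1) * b = ?q * w" unfolding f(3)[symmetric] by (simp add: distrib_left)
  also have "(\<lambda>d. g d ^ a * h d ^ b) = shift_frobenius f"
  proof
    fix d
    show "g d ^ a * h d ^ b = shift_frobenius f d"
    proof (cases d)
      case 0
      then show ?thesis using f(2) by (simp add: g_def yu_def shift_frobenius_def power_0_left)
    next
      case (Suc e)
      have "shift_frobenius f d = (y e ^ ?q) ^ a * (u e ^ ?q) ^ b"
        using Suc by (simp add: f(1) shift_frobenius_def yu_def power_mult_distrib mult.commute flip: power_mult)
      also have "y e ^ ?q = g d" unfolding y_frobenius[of e] Suc g_def yu_def by simp
      also have "u e ^ ?q = h d" unfolding u_frobenius[of e] Suc h_def g_def yu_def by (simp add: mult.assoc)
      finally show ?thesis by simp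
    qed
  qed
  finally show "shift_frobenius f \<in> rspan (YU 1 1 (?q * w))" .
qed (auto simp: shift_frobenius_def fun_eq_iff frobenius_add power_mult_distrib R_power split: nat.split)

text \<open>If m = q^k, this is 1 / \<open>Dc k\<close> times the k-fold
  \<open>shift_frobenius\<close> of \<open>y\<close>; \<open>m\<close> at least 2 forces k at least
  1, which provides the factor \<open>u\<close>.\<close>

lemma Gc_YU:
  assumes "m \<ge> 2" shows "Gc m \<in> rspan (YU 1 1 m)"
proof (cases "\<exists>k. m = CARD('k) ^ k")
  case False
  then have "Gc m = (\<lambda>_. 0)" by (auto intro: Gc_other)
  then show ?thesis by (simp add: rspan_zero)
next
  case True
  then obtain k where k: "m = CARD('k) ^ k" by blast
  then obtain l where l: "k = Suc l" using assms by (cases k) auto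
  define h where "h k d = (if k \<le> d then y (d - k) ^ CARD('k) ^ k else 0)" for k d
  have h_Suc: "h (Suc k) = shift_frobenius (h k)" for k
    by (auto simp: h_def shift_frobenius_def fun_eq_iff mult.commute power_0_left split: nat.split simp flip: power_mult)
  have h: "h (Suc k) \<in> rspan (YU 1 1 (CARD('k) ^ Suc k))" for k
  proof (induction k)
    case 0
    have "h 0 = yu 1 0" by (simp add: h_def yu_def fun_eq_iff)
    then have "h 0 \<in> rspan (YU 1 0 1)" using YU_memI[of 1 1 0 0 1] by simp
    from shift_frobenius_YU[OF this] show ?case by (simp add: h_Suc)
  next
    case (Suc k)
    have "h (Suc k) \<in> rspan (YU 1 0 (CARD('k) ^ Suc k))" by (rule YU_weaken[OF Suc]) auto
    from shift_frobenius_YU[OF this] show ?case by (simp add: h_Suc[of "Suc k"])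
  qed
  have "Gc m = (\<lambda>d. inverse (Dc k) * h k d)"
    unfolding k Gc_power by (auto simp: gc_def h_def divide_inverse)
  moreover have "(\<lambda>d. inverse (Dc k) * h k d) \<in> rspan (YU 1 1 m)"
    unfolding k l by (intro rspan_smult h Dc_inverse_R)
  ultimately show ?thesis by simp
qed

text \<open>In \<open>S_val_rec\<close> the term \<open>m = 1\<close> is \<open>y\<close> times the
  previous power sum and yields the main term; the others contain \<open>y * u\<close> by
  \<open>Gc_YU\<close>. Since every error term contains \<open>u\<close>, its power of
  \<open>y\<close> is below \<open>s\<close>, on which the inversion in \<open>y_power_W\<close>
  rests.\<close>

lemma S_val_expansion:
  assumes "s \<ge> 1" shows "(\<lambda>d. S_val j d s - y d ^ s) \<in> rspan (YU 1 1 s)"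
  using assms
proof (induction s rule: less_induct)
  case (less s)
  then obtain n where n: "s = Suc n" by (cases s) auto
  show ?case
  proof (cases "n = 0")
    case True
    then show ?thesis using n S_val_1 by (simp add: rspan_zero)
  next
    case False
    have IH: "(\<lambda>d. S_val j d (Suc n - m) - y d ^ (Suc n - m)) \<in> rspan (YU 1 1 (Suc n - m))"
      if "m \<in> {1..n}" for m
      using less.IH[of "Suc n - m"] that n by auto
    have S: "(\<lambda>d. S_val j d (Suc n - m)) \<in> rspan (YU 1 0 (Suc n - m))" if "m \<in> {1..n}" for m
    proof -
      have "yu (Suc n - m) 0 \<in> rspan (YU 1 0 (Suc n - m))" using that by (intro YU_memI) auto
      from rspan_add[OF YU_weaken[OF IH[OF that]] this] show ?thesis by (simp add: yu_def)
    qed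
    have "(\<lambda>d. \<Sum>m\<in>{2..n}. Gc m d * S_val j d (Suc n - m)) \<in> rspan (YU 1 1 s)"
    proof (rule rspan_sum)
      fix m assume m: "m \<in> {2..n}"
      have "(\<lambda>d. Gc m d * S_val j d (Suc n - m)) \<in> rspan (YU (1 + 1) (1 + 0) (m + (Suc n - m)))"
        using m by (intro YU_mult Gc_YU S) auto
      then have "(\<lambda>d. Gc m d * S_val j d (Suc n - m)) \<in> rspan (YU 1 1 (m + (Suc n - m)))"
        by (rule YU_weaken) auto
      then show "(\<lambda>d. Gc m d * S_val j d (Suc n - m)) \<in> rspan (YU 1 1 s)" using m n by simp
    qed
    moreover have "(\<lambda>d. y d * (S_val j d n - y d ^ n)) \<in> rspan (YU 1 1 s)"
    proof -
      have "yu 1 0 \<in> rspan (YU 1 0 1)" by (intro YU_memI) auto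
      from YU_mult[OF this IH[of 1]] have "(\<lambda>d. y d * (S_val j d n - y d ^ n)) \<in> rspan (YU (1 + 1) (0 + 1) (1 + n))"
        using False by (simp add: yu_def)
      from YU_weaken[OF this, of 1 1] show ?thesis by (simp add: n)
    qed
    moreover have "(\<lambda>d. S_val j d s - y d ^ s) =
      (\<lambda>d. y d * (S_val j d n - y d ^ n) + (\<Sum>m\<in>{2..n}. Gc m d * S_val j d (Suc n - m)))"
    proof
      fix d
      have "S_val j d s = y d * S_val j d n + (\<Sum>m\<in>{2..n}. Gc m d * S_val j d (Suc n - m))"
        unfolding n using S_val_rec[of n d] False Gc_1[of d]
        by (simp add: sum.atLeast_Suc_atMost numeral_2_eq_2)
      then show "S_val j d s - y d ^ s = y d * (S_val j d n - y d ^ n) + (\<Sum>m\<in>{2..n}. Gc m d * S_val j d (Suc n - m))"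
        by (simp add: n algebra_simps)
    qed
    ultimately show ?thesis by (simp add: rspan_add)
  qed
qed

text \<open>An error term would contain \<open>y * u\<close>, which already has weight q. Hence the
  limit of \<open>u\<close> is the zeta value at q - 1.\<close>

lemma S_val_q_minus_1: "S_val j d (CARD('k) - 1) = y d ^ (CARD('k) - 1)"
proof -
  have "YU 1 1 (CARD('k) - 1) = {}"
  proof -
    have False if "1 \<le> a" "1 \<le> b" "a + (CARD('k) - 1) * b = CARD('k) - 1" for a b
      using that mult_le_mono2[OF that(2), of "CARD('k) - 1"] unfolding mult_1_right by linarith
    then show ?thesis unfolding YU_def by blast
  qed
  moreover have "f = (\<lambda>_. 0)" if "f \<in> rspan {}" for f using that by induction auto
  ultimately have "(\<lambda>d. S_val j d (CARD('k) - 1) - y d ^ (CARD('k) - 1)) = (\<lambda>_. 0)"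
    using S_val_expansion[of "CARD('k) - 1"] q_ge_2 by auto
  then show ?thesis by (simp add: fun_eq_iff)
qed

section \<open>Truncated multiple zeta values and their stability under multiplication by
  \<open>u\<close>\<close>

definition S_word :: "nat list \<Rightarrow> (nat \<Rightarrow> 'c) list"
  where "S_word s = map (\<lambda>n d. S_val j d n) s"

text \<open>Combinations of truncated multiple zeta values of weight \<open>w\<close>, as functions
  of the truncation bound.\<close>

definition W :: "nat \<Rightarrow> (nat \<Rightarrow> 'c) set"
  where "W w = rspan {nsum (S_word s) | s. s \<in> indices \<and> sum_list s = w}"

text \<open>The contributions of a fixed largest index \<open>d\<close>; summing over the index
  leads back to \<open>W\<close>.\<close>

definition Wd :: "nat \<Rightarrow> (nat \<Rightarrow> 'c) set"
  where "Wd w = rspan {\<lambda>d. S_val j d t * nsum (S_word s) d | t s. t \<ge> 1 \<and> s \<in> indices \<and> t + sum_list s = w}"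

lemma S_mult_W:
  assumes "t \<ge> 1" "f \<in> W w" shows "(\<lambda>d. S_val j d t * f d) \<in> Wd (t + w)"
proof -
  have "(\<lambda>d. f d * S_val j d t) \<in> Wd (t + w)"
    using assms(2) unfolding W_def Wd_def
  proof (rule rspan_mult_fixed)
    fix b assume "b \<in> {nsum (S_word s) | s. s \<in> indices \<and> sum_list s = w}"
    then obtain s where "b = nsum (S_word s)" "s \<in> indices" "sum_list s = w" by blast
    then show "(\<lambda>d. b d * S_val j d t) \<in> rspan {\<lambda>d. S_val j d t' * nsum (S_word s) d | t' s.
        t' \<ge> 1 \<and> s \<in> indices \<and> t' + sum_list s = t + w}"
      using assms(1) by (intro rspan_base CollectI exI[of _ t] exI[of _ s]) (simp add: mult.commute)
  qed
  then show ?thesis by (simp add: mult.commute)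
qed

lemma sum_Wd:
  assumes "f \<in> Wd w" shows "(\<lambda>N. \<Sum>e<N. f e) \<in> W w"
  unfolding W_def
proof (rule rspan_semilinear[OF assms[unfolded Wd_def], where \<sigma> = "\<lambda>r. r" and \<Phi> = "\<lambda>f N. \<Sum>e<N. f e"])
  fix b assume "b \<in> {\<lambda>d. S_val j d t * nsum (S_word s) d | t s. t \<ge> 1 \<and> s \<in> indices \<and> t + sum_list s = w}"
  then obtain t s where b: "b = (\<lambda>d. S_val j d t * nsum (S_word s) d)" "t \<ge> 1" "s \<in> indices" "t + sum_list s = w"
    by blast
  have "(\<lambda>N. \<Sum>e<N. b e) = nsum (S_word (t # s))" by (auto simp: b S_word_def)
  moreover have "t # s \<in> indices" "sum_list (t # s) = w" using b by (auto simp: indices_def)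
  ultimately show "(\<lambda>N. \<Sum>e<N. b e) \<in> rspan {nsum (S_word s) | s. s \<in> indices \<and> sum_list s = w}"
    by (auto intro!: rspan_base)
qed (auto simp: sum.distrib sum_distrib_left)

text \<open>
  Induction on the weight: multiplying a nested sum by \<open>u\<close> leads to products with powers of \<open>y\<close>, and
  these involve products with \<open>u\<close> in strictly smaller weights only.
\<close>

definition u_stable_below :: "nat \<Rightarrow> bool"
  where "u_stable_below n \<longleftrightarrow>
    (\<forall>w f. w + (CARD('k) - 1) < n \<longrightarrow> f \<in> W w \<longrightarrow> (\<lambda>d. u d * f d) \<in> W (w + (CARD('k) - 1)))"

lemma u_power_W:
  assumes "u_stable_below n" "f \<in> W w" "w + (CARD('k) - 1) * b < n"
  shows "(\<lambda>d. u d ^ b * f d) \<in> W (w + (CARD('k) - 1) * b)"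
  using assms(3)
proof (induction b)
  case 0
  then show ?case using assms by simp
next
  case (Suc b)
  have eq: "w + (CARD('k) - 1) * Suc b = w + (CARD('k) - 1) * b + (CARD('k) - 1)"
    unfolding mult_Suc_right by linarith
  have "w + (CARD('k) - 1) * b + (CARD('k) - 1) < n" using Suc.prems unfolding eq .
  moreover from this have "(\<lambda>d. u d ^ b * f d) \<in> W (w + (CARD('k) - 1) * b)" by (intro Suc.IH) linarith
  ultimately have "(\<lambda>d. u d * (u d ^ b * f d)) \<in> W (w + (CARD('k) - 1) * b + (CARD('k) - 1))"
    using assms(1) unfolding u_stable_below_def by blast
  then show ?case unfolding eq by (simp add: mult.assoc)
qed

text \<open>Replace \<open>y ^ s\<close> by the power sum. The error terms
  \<open>y ^ a * u ^ b\<close> have \<open>1 \<le> a\<close> and \<open>a < s\<close>, and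
  \<open>u ^ b\<close> is absorbed into \<open>f\<close> in weight below \<open>n\<close>.\<close>

lemma y_power_W:
  assumes "u_stable_below n" "f \<in> W w" "s \<ge> 1" "s + w = n"
  shows "(\<lambda>d. y d ^ s * f d) \<in> Wd n"
  using assms(2-)
proof (induction s arbitrary: w f rule: less_induct)
  case (less s)
  have "(\<lambda>d. (S_val j d s - y d ^ s) * f d) \<in> Wd n"
    unfolding Wd_def
  proof (rule rspan_mult_fixed[OF S_val_expansion[OF less.prems(2)]], fold Wd_def)
    fix g assume "g \<in> YU 1 1 s"
    then obtain a b where g: "g = yu a b" "1 \<le> a" "1 \<le> b" "a + (CARD('k) - 1) * b = s"
      unfolding YU_def by blast
    have "a < s" using g q_ge_2 by auto
    have "w + (CARD('k) - 1) * b < n" using g less.prems by linarith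
    from u_power_W[OF assms(1) less.prems(1) this]
    have "(\<lambda>d. y d ^ a * (u d ^ b * f d)) \<in> Wd n"
      using \<open>a < s\<close> g less.prems by (intro less.IH) auto
    then show "(\<lambda>d. g d * f d) \<in> Wd n" by (simp add: g(1) yu_def mult.assoc)
  qed
  with S_mult_W[OF less.prems(2,1)] less.prems(3)
  have "(\<lambda>d. S_val j d s * f d - (S_val j d s - y d ^ s) * f d) \<in> Wd n"
    unfolding Wd_def by (intro rspan_diff) auto
  then show ?case by (simp add: algebra_simps)
qed

lemma yu_W:
  assumes "u_stable_below n" "f \<in> W w" "a \<ge> 1" "a + (CARD('k) - 1) * b + w = n"
  shows "(\<lambda>d. yu a b d * f d) \<in> Wd n"
proof -
  have "(\<lambda>d. y d ^ a * (u d ^ b * f d)) \<in> Wd n"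
    by (rule y_power_W[OF assms(1) u_power_W[OF assms(1,2)] assms(3)]) (use assms in auto)
  then show ?thesis by (simp add: yu_def mult.assoc)
qed

lemma u_W: "f \<in> W w \<Longrightarrow> (\<lambda>d. u d * f d) \<in> W (w + (CARD('k) - 1))"
proof (induction w arbitrary: f rule: less_induct)
  case (less w)
  define p where "p = CARD('k) - 1"
  note IH = less.IH[folded p_def] and S_p = S_val_q_minus_1[folded p_def]
  have p: "p \<ge> 1" using q_ge_2 unfolding p_def by simp
  have stable: "u_stable_below (w + p)" unfolding u_stable_below_def p_def[symmetric] using IH by auto
  have base: "(\<lambda>d. nsum (S_word s) d * u d) \<in> W (w + p)" if s: "s \<in> indices" "sum_list s = w" for s
  proof (cases s)
    case Nil
    have "nsum (S_word [p]) = u" 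
      by (rule ext) (simp add: S_word_def u_def[folded p_def] S_p)
    moreover have "[p] \<in> indices" using p by (simp add: indices_def)
    ultimately have "u \<in> W p" unfolding W_def
      by (intro rspan_base CollectI exI[of _ "[p]"]) simp
    moreover have "(\<lambda>d. nsum (S_word s) d * u d) = u" using Nil by (simp add: S_word_def)
    moreover have "w = 0" using Nil s by simp
    ultimately show ?thesis by simp
  next
    case (Cons t s')
    have t: "t \<ge> 1" "s' \<in> indices" "t + sum_list s' = w" using s Cons by (auto simp: indices_def)
    define f' where "f' = nsum (S_word s')"
    have f': "f' \<in> W (sum_list s')" unfolding W_def f'_def using t by (intro rspan_base) auto
    have ns: "nsum (S_word s) \<in> W w" unfolding W_def using s by (intro rspan_base) auto
    \<comment> \<open>The index from \<open>u\<close> is below the largest index of the word: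
      induction on the tail, whose weight is smaller because \<open>t\<close> is positive.\<close>
    have "(\<lambda>d. S_val j d t * (u d * f' d)) \<in> Wd (t + (sum_list s' + p))"
      using t by (intro S_mult_W IH f') auto
    then have 1: "(\<lambda>d. S_val j d t * (u d * f' d)) \<in> Wd (w + p)" unfolding t(3)[symmetric] by (simp only: add.assoc)
    \<comment> \<open>The index from \<open>u\<close> is above all indices of the word.\<close>
    have "(\<lambda>d. S_val j d p * nsum (S_word s) d) \<in> Wd (p + w)" using p by (intro S_mult_W ns)
    then have 2: "(\<lambda>d. y d ^ p * nsum (S_word s) d) \<in> Wd (w + p)"
      by (simp only: S_p add.commute)
    \<comment> \<open>Equal indices: the power sum is expanded first, so that only monomials in
      \<open>y\<close> and \<open>u\<close> are multiplied by \<open>y ^ p\<close>.\<close>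
    have "(\<lambda>d. (S_val j d t - y d ^ t) * (y d ^ p * f' d)) \<in> Wd (w + p)"
      unfolding Wd_def
    proof (rule rspan_mult_fixed[OF S_val_expansion[OF t(1)]], fold Wd_def)
      fix g assume "g \<in> YU 1 1 t"
      then obtain a b where g: "g = yu a b" "1 \<le> a" "1 \<le> b" "a + p * b = t" unfolding YU_def p_def by blast
      have "(\<lambda>d. yu (a + p) b d * f' d) \<in> Wd (w + p)"
        by (rule yu_W[OF stable f', folded p_def]) (use g t in auto)
      then show "(\<lambda>d. g d * (y d ^ p * f' d)) \<in> Wd (w + p)"
        by (simp add: g(1) yu_def power_add mult_ac)
    qed
    moreover have "(\<lambda>d. y d ^ (t + p) * f' d) \<in> Wd (w + p)"
      by (rule y_power_W[OF stable f']) (use t in auto)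
    ultimately have 3: "(\<lambda>d. (S_val j d t - y d ^ t) * (y d ^ p * f' d) + y d ^ (t + p) * f' d) \<in> Wd (w + p)"
      unfolding Wd_def by (rule rspan_add)
    have "(\<lambda>N. \<Sum>e<N. S_val j e t * (u e * f' e) + y e ^ p * nsum (S_word s) e
        + ((S_val j e t - y e ^ t) * (y e ^ p * f' e) + y e ^ (t + p) * f' e)) \<in> W (w + p)"
      by (intro sum_Wd) (use 1 2 3 in \<open>auto simp: Wd_def intro!: rspan_add\<close>)
    also have "(\<lambda>N. \<Sum>e<N. S_val j e t * (u e * f' e) + y e ^ p * nsum (S_word s) e
        + ((S_val j e t - y e ^ t) * (y e ^ p * f' e) + y e ^ (t + p) * f' e)) = (\<lambda>d. nsum (S_word s) d * u d)"
    proof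
      fix N
      have step: "nsum (S_word s) (Suc N) = nsum (S_word s) N + S_val j N t * f' N" for N
        by (simp add: Cons S_word_def f'_def)
      show "(\<Sum>e<N. S_val j e t * (u e * f' e) + y e ^ p * nsum (S_word s) e
        + ((S_val j e t - y e ^ t) * (y e ^ p * f' e) + y e ^ (t + p) * f' e)) = nsum (S_word s) N * u N"
      proof (induction N)
        case (Suc N)
        show ?case unfolding sum.lessThan_Suc Suc step u_Suc[folded p_def] by (simp add: algebra_simps power_add)
      qed simp
    qed
    finally show ?thesis .
  qed
  have "(\<lambda>d. f d * u d) \<in> W (w + p)"
    using less.prems base unfolding W_def
    by (elim rspan_mult_fixed) auto
  then show ?case by (simp add: mult.commute p_def)
qed

text \<open>By \<open>u_W\<close> the stability assumption holds in every weight, so letters can be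
  attached one by one from the right.\<close>

lemma nsum_yu_W:
  assumes "\<forall>(a, b)\<in>set w. a \<ge> 1" shows "\<exists>n. nsum (map (\<lambda>(a, b). yu a b) w) \<in> W n"
  using assms
proof (induction w)
  case Nil
  have "nsum (S_word []) \<in> W 0" unfolding W_def by (rule rspan_base) (force simp: indices_def)
  then show ?case unfolding S_word_def list.map by blast
next
  case (Cons l w)
  obtain a b where l: "l = (a, b)" by fastforce
  obtain n where n: "nsum (map (\<lambda>(a, b). yu a b) w) \<in> W n" using Cons by auto
  let ?n = "a + (CARD('k) - 1) * b + n"
  have "u_stable_below ?n" unfolding u_stable_below_def using u_W by blast
  from yu_W[OF this n, of a b] have "(\<lambda>d. yu a b d * nsum (map (\<lambda>(a, b). yu a b) w) d) \<in> Wd ?n"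
    using Cons.prems l by auto
  from sum_Wd[OF this] show ?case unfolding l by (auto intro!: exI[of _ ?n])
qed

end

section \<open>Limits of nested sums in the algebra of multiple zeta values\<close>

lemma nsum_at_0: "nsum w 0 = (if w = [] then 1 else 0)"
  by (cases w) simp_all

context C_infinity
begin

lemma nlim_star_nlim_convolution:
  assumes "null_word w"
  shows "(\<Sum>i\<le>length w. nlim_star (take i w) * nlim (drop i w)) = (if w = [] then 1 else 0)"
proof -
  have null: "null_word (take i w)" "null_word (drop i w)" for i
    using assms in_set_takeD in_set_dropD unfolding null_word_def by fast+
  have "(\<lambda>N. \<Sum>i\<le>length w. nsum_star (take i w) 0 N * nsum (drop i w) N) \<longlonglongrightarrow>
      (\<Sum>i\<le>length w. nlim_star (take i w) * nlim (drop i w))"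
    by (intro tendsto_sum_C tendsto_mult_C nsum_star_tendsto nsum_tendsto null)
  then have "(\<lambda>N. if w = [] then 1 else 0) \<longlonglongrightarrow> (\<Sum>i\<le>length w. nlim_star (take i w) * nlim (drop i w))"
    by (simp add: nsum_star_nsum_convolution nsum_at_0)
  then show ?thesis by (rule LIMSEQ_unique[OF _ tendsto_const])
qed

lemma nlim_eqI: "null_word w \<Longrightarrow> nsum w \<longlonglongrightarrow> x \<Longrightarrow> nlim w = x"
  using LIMSEQ_unique nsum_tendsto by blast

lemma nlim_star_eqI: "null_word w \<Longrightarrow> nsum_star w 0 \<longlonglongrightarrow> x \<Longrightarrow> nlim_star w = x"
  using LIMSEQ_unique nsum_star_tendsto by blast

lemma nlim_Nil [simp]: "nlim [] = 1" and nlim_star_Nil [simp]: "nlim_star [] = 1"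
proof -
  have "nsum [] = (\<lambda>N. 1 :: 'c)" "nsum_star [] 0 = (\<lambda>N. 1 :: 'c)" by (simp_all add: fun_eq_iff)
  then show "nlim [] = 1" "nlim_star [] = 1" by (auto intro!: nlim_eqI nlim_star_eqI)
qed

lemma nlim_zero:
  assumes "null_word (p @ w)"
  shows "nlim (p @ (\<lambda>d. 0) # w) = 0" "nlim_star (p @ (\<lambda>d. 0) # w) = 0"
proof -
  have "nsum (p @ (\<lambda>d. 0) # w) = (\<lambda>_. 0)" "nsum_star (p @ (\<lambda>d. 0) # w) 0 = (\<lambda>_. 0)"
    by (simp_all add: fun_eq_iff nsum_zero nsum_star_zero)
  then show "nlim (p @ (\<lambda>d. 0) # w) = 0" "nlim_star (p @ (\<lambda>d. 0) # w) = 0"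
    using assms by (auto intro!: nlim_eqI nlim_star_eqI)
qed

lemma tendsto_linear_C:
  fixes f h :: "nat \<Rightarrow> 'c"
  assumes "f \<longlonglongrightarrow> x" "h \<longlonglongrightarrow> z"
  shows "(\<lambda>d. f d + r * h d) \<longlonglongrightarrow> x + r * z"
  by (intro tendsto_add_C tendsto_mult_left_C assms)

lemma nlim_linear:
  assumes "null_word (p @ f # w)" "null_word (p @ h # w)"
  shows "nlim (p @ (\<lambda>d. f d + r * h d) # w) = nlim (p @ f # w) + r * nlim (p @ h # w)"
    and "nlim_star (p @ (\<lambda>d. f d + r * h d) # w) = nlim_star (p @ f # w) + r * nlim_star (p @ h # w)"
proof -
  have null: "null_word (p @ (\<lambda>d. f d + r * h d) # w)"
    using assms tendsto_linear_C[of f 0 h 0 r] by simp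
  have "nsum (p @ (\<lambda>d. f d + r * h d) # w) = (\<lambda>N. nsum (p @ f # w) N + r * nsum (p @ h # w) N)"
    "nsum_star (p @ (\<lambda>d. f d + r * h d) # w) 0 = (\<lambda>N. nsum_star (p @ f # w) 0 N + r * nsum_star (p @ h # w) 0 N)"
    by (simp_all add: fun_eq_iff nsum_linear nsum_star_linear)
  then show "nlim (p @ (\<lambda>d. f d + r * h d) # w) = nlim (p @ f # w) + r * nlim (p @ h # w)"
    "nlim_star (p @ (\<lambda>d. f d + r * h d) # w) = nlim_star (p @ f # w) + r * nlim_star (p @ h # w)"
    by (auto intro!: nlim_eqI nlim_star_eqI null tendsto_linear_C nsum_tendsto nsum_star_tendsto assms)
qed

lemma null_word_qshuffle:
  assumes "g \<longlonglongrightarrow> 0" "null_word w" "x \<in> set (qshuffle g w)"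
  shows "null_word x"
  using assms(2,3)
proof (induction w arbitrary: x)
  case (Cons f w)
  have "(\<lambda>d. f d * g d) \<longlonglongrightarrow> 0 * 0" using Cons.prems assms(1) by (intro tendsto_mult_C) auto
  then show ?case using Cons assms(1) by auto
qed (use assms(1) in simp)

text \<open>Both insertion formulas in the limit; for the letter \<open>y ^ (q - 1)\<close> the
  correction factor \<open>nlim [g]\<close> is the zeta value at q - 1.\<close>

lemma nlim_qshuffle:
  assumes "g \<longlonglongrightarrow> 0" "null_word p" "f \<longlonglongrightarrow> 0" "null_word w"
  shows "nlim (p @ (\<lambda>e. f e * (\<Sum>e'<e. g e')) # w) = (\<Sum>x\<leftarrow>qshuffle g w. nlim (p @ f # x))"
    and "nlim_star (p @ (\<lambda>e. f e * (\<Sum>e'<e. g e')) # w) =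
      (\<Sum>x\<leftarrow>qshuffle g w. nlim_star (p @ f # x)) + nlim [g] * nlim_star (p @ f # w)"
proof -
  have g: "(\<lambda>N. \<Sum>e<N. g e) \<longlonglongrightarrow> nlim [g]"
  proof -
    have "nsum [g] = (\<lambda>N. \<Sum>e<N. g e)" by (simp add: fun_eq_iff)
    then show ?thesis using nsum_tendsto[of "[g]"] assms(1) by simp
  qed
  have "(\<lambda>e. f e * (\<Sum>e'<e. g e')) \<longlonglongrightarrow> 0 * nlim [g]" by (intro tendsto_mult_C assms g)
  then have null: "null_word (p @ (\<lambda>e. f e * (\<Sum>e'<e. g e')) # w)" using assms by simp
  have null': "null_word (p @ f # x)" if "x \<in> set (qshuffle g w)" for x
    using null_word_qshuffle[OF assms(1,4) that] assms by simp
  have nullf: "null_word (p @ f # w)" using assms by simp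
  have "nsum (p @ (\<lambda>e. f e * (\<Sum>e'<e. g e')) # w) = (\<lambda>N. \<Sum>x\<leftarrow>qshuffle g w. nsum (p @ f # x) N)"
    by (rule ext) (rule nsum_qshuffle_insert)
  then show "nlim (p @ (\<lambda>e. f e * (\<Sum>e'<e. g e')) # w) = (\<Sum>x\<leftarrow>qshuffle g w. nlim (p @ f # x))"
    by (intro nlim_eqI null) (simp only:, intro tendsto_sum_list_C nsum_tendsto null')
  have "nsum_star (p @ (\<lambda>e. f e * (\<Sum>e'<e. g e')) # w) 0 =
      (\<lambda>N. (\<Sum>x\<leftarrow>qshuffle g w. nsum_star (p @ f # x) 0 N) + (\<Sum>e<N. g e) * nsum_star (p @ f # w) 0 N)"
    by (rule ext) (simp add: nsum_star_qshuffle_insert)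
  then show "nlim_star (p @ (\<lambda>e. f e * (\<Sum>e'<e. g e')) # w) =
      (\<Sum>x\<leftarrow>qshuffle g w. nlim_star (p @ f # x)) + nlim [g] * nlim_star (p @ f # w)"
    by (intro nlim_star_eqI null)
      (simp only:, intro tendsto_add_C tendsto_mult_C tendsto_sum_list_C nsum_star_tendsto null' nullf g)
qed

lemma y_power_tendsto_0: "n \<ge> 1 \<Longrightarrow> (\<lambda>d. y d ^ n) \<longlonglongrightarrow> 0"
proof (induction n rule: dec_induct)
  case (step n)
  have "(\<lambda>d. y d * y d ^ n) \<longlonglongrightarrow> 0 * 0" by (intro tendsto_mult_C y_tendsto_0 step)
  then show ?case by simp
qed (use y_tendsto_0 in simp)

lemma u_tendsto: "u \<longlonglongrightarrow> nlim [\<lambda>d. y d ^ (CARD('k) - 1)]"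
proof -
  have "nsum [\<lambda>d. y d ^ (CARD('k) - 1)] = u" by (simp add: u_def fun_eq_iff)
  then show ?thesis
    using nsum_tendsto[of "[\<lambda>d. y d ^ (CARD('k) - 1)]"] y_power_tendsto_0[of "CARD('k) - 1"] q_ge_2 by simp
qed

end

context coefficient_C_infinity
begin

lemma yu_tendsto_0: "a \<ge> 1 \<Longrightarrow> yu a b \<longlonglongrightarrow> 0"
proof (induction b)
  case 0
  then show ?case using y_power_tendsto_0[of a] by (simp add: yu_def)
next
  case (Suc b)
  then have "(\<lambda>d. yu a b d * u d) \<longlonglongrightarrow> 0 * nlim [\<lambda>d. y d ^ (CARD('k) - 1)]"
    by (intro tendsto_mult_C u_tendsto) auto
  then show ?case by (simp add: yu_def mult_ac)
qed

lemma rspan_YU_tendsto_0: "f \<in> rspan (YU 1 0 w) \<Longrightarrow> f \<longlonglongrightarrow> 0"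
proof (induction rule: rspan.induct)
  case (rspan_step f r b)
  then show ?case using tendsto_linear_C[of f 0 b 0 r] yu_tendsto_0 by (auto simp: YU_def)
qed simp

lemma S_val_YU: "s \<ge> 1 \<Longrightarrow> (\<lambda>d. S_val j d s) \<in> rspan (YU 1 0 s)"
proof -
  assume s: "s \<ge> 1"
  have "(\<lambda>d. S_val j d s - y d ^ s) \<in> rspan (YU 1 0 s)"
    by (rule YU_weaken[OF S_val_expansion[OF s]]) auto
  moreover have "yu s 0 \<in> rspan (YU 1 0 s)" using s by (intro YU_memI) auto
  ultimately show ?thesis using rspan_add[of "\<lambda>d. S_val j d s - y d ^ s" _ "yu s 0"] by (simp add: yu_def)
qed

lemma null_word_S_word: "s \<in> indices \<Longrightarrow> null_word (S_word s)"
  using rspan_YU_tendsto_0[OF S_val_YU] unfolding null_word_def S_word_def indices_def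
  by (auto simp: Suc_le_eq)

lemma zeta_A_eq: "zeta_A j s = nlim (S_word s)"
  and zeta_A_star_inv_eq: "zeta_A_star_inv j s = nlim_star (S_word s)"
  by (simp_all add: zeta_A_def zeta_A_star_inv_def nested_sum_eq nested_sum_star_inv_eq S_word_def)

definition yu_word :: "(nat \<times> nat) list \<Rightarrow> (nat \<Rightarrow> 'c) list"
  where "yu_word w = map (\<lambda>(a, b). yu a b) w"

text \<open>A positive exponent of \<open>y\<close> makes a letter tend to 0, as \<open>u\<close>
  converges.\<close>

definition pos_word :: "(nat \<times> nat) list \<Rightarrow> bool"
  where "pos_word w \<longleftrightarrow> (\<forall>(a, b)\<in>set w. a \<ge> 1)"

lemma pos_word_simps [simp]:
  "pos_word []" "pos_word ((a, b) # w) \<longleftrightarrow> a \<ge> 1 \<and> pos_word w"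
  "pos_word (w @ w') \<longleftrightarrow> pos_word w \<and> pos_word w'"
  by (auto simp: pos_word_def)

lemma null_word_yu_word: "pos_word w \<Longrightarrow> null_word (yu_word w)"
  using yu_tendsto_0 by (fastforce simp: pos_word_def null_word_def yu_word_def)

lemma Li_one_eq: "Li_one j s = nlim (yu_word (map (\<lambda>n. (n, 0)) s))"
  and Li_one_star_inv_eq: "Li_one_star_inv j s = nlim_star (yu_word (map (\<lambda>n. (n, 0)) s))"
  by (simp_all add: Li_one_def Li_one_star_inv_def nested_sum_eq nested_sum_star_inv_eq yu_word_def yu_def
      y_def power_inverse comp_def)

section \<open>Membership of the limits in the algebra of values\<close>

abbreviation Z :: "('c, 'c) module" where "Z \<equiv> Z_alg j R"

lemma Z_simps [simp]:
  "x \<otimes>\<^bsub>Z\<^esub> x' = x * x'" "x \<oplus>\<^bsub>Z\<^esub> x' = x + x'" "\<one>\<^bsub>Z\<^esub> = 1" "\<zero>\<^bsub>Z\<^esub> = 0" "r \<odot>\<^bsub>Z\<^esub> x = r * x"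
  by (simp_all add: Z_alg_def)

lemma Z_add: "x \<in> carrier Z \<Longrightarrow> x' \<in> carrier Z \<Longrightarrow> x + x' \<in> carrier Z"
  and Z_mult: "x \<in> carrier Z \<Longrightarrow> x' \<in> carrier Z \<Longrightarrow> x * x' \<in> carrier Z"
  and Z_uminus: "x \<in> carrier Z \<Longrightarrow> - x \<in> carrier Z"
  and Z_1: "1 \<in> carrier Z"
  and R_subset_Z: "r \<in> R \<Longrightarrow> r \<in> carrier Z"
  and zeta_Z: "s \<in> indices \<Longrightarrow> zeta_A j s \<in> carrier Z"
  unfolding Z_alg_def partial_object.simps
  using generate_ring.intros[where R = ring_of_type_algebra and H = "R \<union> zeta_A j ` indices"]
  by simp_all

lemma Z_0: "0 \<in> carrier Z"
  using Z_add[OF Z_1 Z_uminus[OF Z_1]] by simp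

lemma Z_sum: "(\<And>i. i \<in> A \<Longrightarrow> f i \<in> carrier Z) \<Longrightarrow> sum f A \<in> carrier Z"
  by (induction A rule: infinite_finite_induct) (simp_all add: Z_0 Z_add)

lemma W_limit_Z: "f \<in> W n \<Longrightarrow> \<exists>x\<in>carrier Z. f \<longlonglongrightarrow> x"
  unfolding W_def
proof (induction rule: rspan.induct)
  case rspan_zero
  then show ?case using Z_0 by blast
next
  case (rspan_step f r b)
  then obtain x s where x: "x \<in> carrier Z" "f \<longlonglongrightarrow> x" and s: "b = nsum (S_word s)" "s \<in> indices" by blast
  have "b \<longlonglongrightarrow> zeta_A j s" unfolding s zeta_A_eq by (intro nsum_tendsto null_word_S_word s)
  from tendsto_linear_C[OF x(2) this, of r] show ?case
    using Z_add[OF x(1) Z_mult[OF R_subset_Z[OF \<open>r \<in> R\<close>] zeta_Z[OF s(2)]]] by blast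
qed

text \<open>At finite level the sum is an \<open>R\<close>-combination of truncated zeta values with
  constant coefficients, and this passes to the limit.\<close>

lemma nlim_yu_Z:
  assumes "pos_word w" shows "nlim (yu_word w) \<in> carrier Z"
proof -
  obtain n where "nsum (yu_word w) \<in> W n" using nsum_yu_W assms unfolding yu_word_def pos_word_def by blast
  then obtain x where "x \<in> carrier Z" "nsum (yu_word w) \<longlonglongrightarrow> x" using W_limit_Z by blast
  then show ?thesis using nlim_eqI[OF null_word_yu_word[OF assms]] by simp
qed

lemma convolution_solve:
  assumes "null_word w" "w \<noteq> []"
  shows "nlim_star w = - (\<Sum>i<length w. nlim_star (take i w) * nlim (drop i w))"
  using nlim_star_nlim_convolution[OF assms(1)] assms(2)
  by (simp add: lessThan_Suc_atMost[symmetric] add_eq_0_iff)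

lemma pos_word_take_drop: "pos_word w \<Longrightarrow> pos_word (take i w)" "pos_word w \<Longrightarrow> pos_word (drop i w)"
  unfolding pos_word_def using in_set_takeD in_set_dropD by fast+

text \<open>The convolution identity expresses a star value through star values of shorter words and
  ordinary limits.\<close>

lemma nlim_star_yu_Z: "pos_word w \<Longrightarrow> nlim_star (yu_word w) \<in> carrier Z"
proof (induction w rule: length_induct)
  case (1 w)
  show ?case
  proof (cases "w = []")
    case True
    then show ?thesis using Z_1 by (simp add: yu_word_def)
  next
    case False
    have "nlim_star (take i (yu_word w)) * nlim (drop i (yu_word w)) \<in> carrier Z" if "i < length w" for i
    proof -
      have "nlim_star (yu_word (take i w)) \<in> carrier Z" "nlim (yu_word (drop i w)) \<in> carrier Z"
        using 1 that by (auto intro!: nlim_yu_Z simp: pos_word_take_drop)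
      then show ?thesis by (simp add: yu_word_def take_map drop_map Z_mult)
    qed
    moreover have "yu_word w \<noteq> []" "length (yu_word w) = length w" using False by (simp_all add: yu_word_def)
    ultimately show ?thesis
      using convolution_solve[OF null_word_yu_word[OF 1(2)]] by (auto intro!: Z_uminus Z_sum)
  qed
qed

lemma Z_algebra:
  assumes "cring (ring_on R)" shows "algebra (ring_on R) Z"
proof -
  have "cring Z"
  proof (intro cringI abelian_groupI comm_monoidI)
    fix x assume "x \<in> carrier Z"
    then show "\<exists>x'\<in>carrier Z. x' \<oplus>\<^bsub>Z\<^esub> x = \<zero>\<^bsub>Z\<^esub>" by (intro bexI[of _ "- x"]) (auto simp: Z_uminus)
  qed (auto simp: Z_add Z_mult Z_0 Z_1 algebra_simps)
  then show ?thesis using assms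
    by (intro algebraI) (auto simp: ring_on_def R_subset_Z Z_mult algebra_simps)
qed

end

section \<open>The antipode on the quotient\<close>

locale hopf_C_infinity = coefficient_C_infinity j R
  for j :: "'k::finite_field fls alg_closure \<Rightarrow> 'c::{field,complete_space}" and R :: "'c set" +
  fixes D :: "'c \<Rightarrow> ('c \<times> 'c set \<Rightarrow> 'c) set"
    and \<Delta> :: "'c set \<Rightarrow> ('c set \<times> 'c set \<Rightarrow> 'c) set"
    and \<epsilon> :: "'c set \<Rightarrow> 'c"
    and S :: "'c set \<Rightarrow> 'c set"
  assumes coaction: "is_coaction j R D"
    and coproduct: "is_coproduct j R D \<Delta>"
    and hopf: "hopf_algebra (ring_on R) (Zbar_alg j R) \<Delta> \<epsilon> S"
begin

abbreviation "RR \<equiv> ring_on R"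
abbreviation "Zb \<equiv> Zbar_alg j R"
abbreviation "\<pi> \<equiv> pi_inf j R"
abbreviation "I \<equiv> zeta_ideal j R"
abbreviation "zq \<equiv> zeta_A j [CARD('k) - 1]"

sublocale H: hopf_algebra RR Zb \<Delta> \<epsilon> S by (rule hopf)

sublocale ZA: algebra RR Z
  by (rule Z_algebra) (rule H.R.is_cring)

lemma carrier_RR [simp]: "carrier RR = R"
  by (simp add: ring_on_def)

lemma zq_Z: "zq \<in> carrier Z"
  using q_ge_2 by (intro zeta_Z) (simp add: indices_def)

lemma I_ideal: "ideal I Z"
  unfolding zeta_ideal_def by (rule ZA.cgenideal_ideal) (rule zq_Z)

lemma pi_hom: "\<pi> \<in> ring_hom Z Zb"
proof -
  have "\<pi> = a_r_coset Z I" by (simp add: fun_eq_iff pi_inf_def)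
  then show ?thesis using ZA.quotient_algebra_is_algebra(2)[OF I_ideal] by (simp add: Zbar_alg_def)
qed

lemma pi_closed: "x \<in> carrier Z \<Longrightarrow> \<pi> x \<in> carrier Zb"
  using ring_hom_closed[OF pi_hom] .

lemma pi_add: "x \<in> carrier Z \<Longrightarrow> x' \<in> carrier Z \<Longrightarrow> \<pi> (x + x') = \<pi> x \<oplus>\<^bsub>Zb\<^esub> \<pi> x'"
  using ring_hom_add[OF pi_hom] by simp

lemma pi_mult: "x \<in> carrier Z \<Longrightarrow> x' \<in> carrier Z \<Longrightarrow> \<pi> (x * x') = \<pi> x \<otimes>\<^bsub>Zb\<^esub> \<pi> x'"
  using ring_hom_mult[OF pi_hom] by simp

lemma pi_1: "\<pi> 1 = \<one>\<^bsub>Zb\<^esub>"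
  using ring_hom_one[OF pi_hom] by simp

lemma pi_smult: "r \<in> R \<Longrightarrow> x \<in> carrier Z \<Longrightarrow> \<pi> (r * x) = r \<odot>\<^bsub>Zb\<^esub> \<pi> x"
  using ZA.quotient_algebra_smult[OF I_ideal, of r x] by (simp add: Zbar_alg_def pi_inf_def)

lemma pi_0: "\<pi> 0 = \<zero>\<^bsub>Zb\<^esub>"
  using pi_smult[OF R_0 Z_1] H.smult_l_null[OF pi_closed[OF Z_1]] by (simp add: ring_on_def)

lemma pi_zq_mult:
  assumes "x \<in> carrier Z" "z \<in> carrier Z" shows "\<pi> (x + zq * z) = \<pi> x"
proof -
  have "\<pi> zq = \<zero>\<^bsub>Zb\<^esub>"
  proof -
    have "zq \<in> I" unfolding zeta_ideal_def by (rule ZA.cgenideal_self) (rule zq_Z)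
    then have "\<pi> zq = I" unfolding pi_inf_def
      by (intro ZA.a_coset_join2 zq_Z) (rule additive_subgroup.a_subgroup[OF ideal.axioms(1)[OF I_ideal]])
    also have "\<dots> = \<zero>\<^bsub>Zb\<^esub>" by (simp add: Zbar_alg_def quotient_algebra_def FactRing_def)
    finally show ?thesis .
  qed
  then show ?thesis using assms zq_Z by (simp add: pi_add pi_mult Z_mult pi_closed)
qed

lemma pi_sum:
  assumes "finite A" "\<And>i. i \<in> A \<Longrightarrow> x i \<in> carrier Z"
  shows "\<pi> (\<Sum>i\<in>A. x i) = (\<Oplus>\<^bsub>Zb\<^esub>i\<in>A. \<pi> (x i))"
  using assms
proof induction
  case (insert i A)
  then show ?case by (simp add: pi_add Z_sum pi_closed H.finsum_insert Pi_def)
qed (simp add: pi_0)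

lemma S_closed: "x \<in> carrier Zb \<Longrightarrow> S x \<in> carrier Zb"
  and S_add: "x \<in> carrier Zb \<Longrightarrow> x' \<in> carrier Zb \<Longrightarrow> S (x \<oplus>\<^bsub>Zb\<^esub> x') = S x \<oplus>\<^bsub>Zb\<^esub> S x'"
  and S_smult: "r \<in> R \<Longrightarrow> x \<in> carrier Zb \<Longrightarrow> S (r \<odot>\<^bsub>Zb\<^esub> x) = r \<odot>\<^bsub>Zb\<^esub> S x"
  using H.antipode_linear by (auto simp: linear_maps_def ring_on_def)

lemma eps_closed: "x \<in> carrier Zb \<Longrightarrow> \<epsilon> x \<in> R"
  and eps_add: "x \<in> carrier Zb \<Longrightarrow> x' \<in> carrier Zb \<Longrightarrow> \<epsilon> (x \<oplus>\<^bsub>Zb\<^esub> x') = \<epsilon> x \<oplus>\<^bsub>RR\<^esub> \<epsilon> x'"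
  and eps_1: "\<epsilon> \<one>\<^bsub>Zb\<^esub> = \<one>\<^bsub>RR\<^esub>"
  using ring_hom_closed[OF H.counit_hom] ring_hom_add[OF H.counit_hom] ring_hom_one[OF H.counit_hom]
  by auto

lemma Li_Z: "s \<in> indices \<Longrightarrow> Li_one j s \<in> carrier Z"
  unfolding Li_one_eq by (rule nlim_yu_Z) (auto simp: pos_word_def indices_def)

lemma take_indices: "s \<in> indices \<Longrightarrow> take i s \<in> indices"
  and drop_indices: "s \<in> indices \<Longrightarrow> drop i s \<in> indices"
  unfolding indices_def using in_set_takeD in_set_dropD by fast+

sublocale T2: tensor_product_locale RR Zb Zb ..

text \<open>The bilinear map inducing the tensor product of \<open>\<pi>\<close> with the
  identity.\<close>

sublocale T1: tensor_lift_locale RR Z Zb "tensor_product RR Zb Zb" "\<lambda>x x'. pure_tensor RR Zb Zb (\<pi> x) x'"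
proof unfold_locales
  fix x x' z assume "x \<in> carrier Z" "x' \<in> carrier Z" "z \<in> carrier Zb"
  then show "pure_tensor RR Zb Zb (\<pi> (x \<oplus>\<^bsub>Z\<^esub> x')) z =
      pure_tensor RR Zb Zb (\<pi> x) z \<oplus>\<^bsub>tensor_product RR Zb Zb\<^esub> pure_tensor RR Zb Zb (\<pi> x') z"
    by (simp add: pi_add T2.pt_add_left pi_closed)
next
  fix r x z assume "r \<in> carrier RR" "x \<in> carrier Z" "z \<in> carrier Zb"
  then show "pure_tensor RR Zb Zb (\<pi> (r \<odot>\<^bsub>Z\<^esub> x)) z = r \<odot>\<^bsub>tensor_product RR Zb Zb\<^esub> pure_tensor RR Zb Zb (\<pi> x) z"
    by (simp add: pi_smult T2.pt_smult pi_closed)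
qed (simp_all add: T2.pt_closed T2.pt_add_right T2.pt_smult pi_closed)

lemma coproduct_Li:
  assumes "s \<in> indices"
  shows "\<Delta> (\<pi> (Li_one j s)) = (\<Oplus>\<^bsub>tensor_product RR Zb Zb\<^esub>i\<in>{..length s}.
    pure_tensor RR Zb Zb (\<pi> (Li_one j (take i s))) (\<pi> (Li_one j (drop i s))))"
proof -
  have "\<Delta> (\<pi> (Li_one j s)) = tensor_map RR Zb Zb \<pi> (\<lambda>x. x) (D (Li_one j s))"
    using coproduct Li_Z[OF assms] by (simp add: is_coproduct_def)
  also have "D (Li_one j s) = (\<Oplus>\<^bsub>tensor_product RR Z Zb\<^esub>i\<in>{..length s}.
      pure_tensor RR Z Zb (Li_one j (take i s)) (\<pi> (Li_one j (drop i s))))"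
    using coaction assms by (simp add: is_coaction_def)
  also have "tensor_map RR Zb Zb \<pi> (\<lambda>x. x) \<dots> = (\<Oplus>\<^bsub>tensor_product RR Zb Zb\<^esub>i\<in>{..length s}.
      pure_tensor RR Zb Zb (\<pi> (Li_one j (take i s))) (\<pi> (Li_one j (drop i s))))"
    unfolding tensor_map_def
    by (rule T1.tensor_lift_finsum_pt) (auto intro!: Li_Z pi_closed take_indices drop_indices assms)
  finally show ?thesis .
qed

lemma lift_coproduct_Li:
  assumes "tensor_lift_locale RR Zb Zb Zb b" "s \<in> indices"
  shows "tensor_lift RR Zb b (\<Delta> (\<pi> (Li_one j s))) =
    (\<Oplus>\<^bsub>Zb\<^esub>i\<in>{..length s}. b (\<pi> (Li_one j (take i s))) (\<pi> (Li_one j (drop i s))))"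
  unfolding coproduct_Li[OF assms(2)]
  by (rule tensor_lift_locale.tensor_lift_finsum_pt[OF assms(1)])
    (auto intro!: Li_Z pi_closed take_indices drop_indices assms(2))

lemma antipode_lift: "tensor_lift_locale RR Zb Zb Zb (\<lambda>x x'. S x \<otimes>\<^bsub>Zb\<^esub> x')"
  by unfold_locales
    (auto simp: S_closed S_add S_smult H.l_distr H.r_distr H.smult_assoc2 H.m_comm[of "S _"])

lemma counit_lift: "tensor_lift_locale RR Zb Zb Zb (\<lambda>x x'. \<epsilon> x \<odot>\<^bsub>Zb\<^esub> x')"
proof unfold_locales
  fix r x z assume a: "r \<in> carrier RR" "x \<in> carrier Zb" "z \<in> carrier Zb"
  then show "\<epsilon> (r \<odot>\<^bsub>Zb\<^esub> x) \<odot>\<^bsub>Zb\<^esub> z = r \<odot>\<^bsub>Zb\<^esub> (\<epsilon> x \<odot>\<^bsub>Zb\<^esub> z)"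
    using eps_closed[OF a(2)] by (simp add: H.counit_smult H.smult_assoc1)
  have "r \<odot>\<^bsub>Zb\<^esub> (\<epsilon> x \<odot>\<^bsub>Zb\<^esub> z) = (r \<otimes>\<^bsub>RR\<^esub> \<epsilon> x) \<odot>\<^bsub>Zb\<^esub> z"
    "\<epsilon> x \<odot>\<^bsub>Zb\<^esub> (r \<odot>\<^bsub>Zb\<^esub> z) = (\<epsilon> x \<otimes>\<^bsub>RR\<^esub> r) \<odot>\<^bsub>Zb\<^esub> z"
    using a eps_closed[OF a(2)] by (simp_all add: H.smult_assoc1)
  then show "\<epsilon> x \<odot>\<^bsub>Zb\<^esub> (r \<odot>\<^bsub>Zb\<^esub> z) = r \<odot>\<^bsub>Zb\<^esub> (\<epsilon> x \<odot>\<^bsub>Zb\<^esub> z)"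
    using a eps_closed[OF a(2)] by (simp add: ring_on_def mult.commute)
qed (auto simp: eps_closed eps_add H.smult_l_distr H.smult_r_distr)

text \<open>
  For a deconcatenation coproduct the counit axiom forces \<open>\<epsilon>\<close> to vanish in positive depth.
\<close>

lemma counit_Li:
  assumes "s \<in> indices" "s \<noteq> []"
  shows "\<epsilon> (\<pi> (Li_one j s)) \<odot>\<^bsub>Zb\<^esub> \<one>\<^bsub>Zb\<^esub> = \<zero>\<^bsub>Zb\<^esub>"
  using assms
proof (induction s rule: length_induct)
  case (1 s)
  let ?t = "\<lambda>i. \<epsilon> (\<pi> (Li_one j (take i s))) \<odot>\<^bsub>Zb\<^esub> \<pi> (Li_one j (drop i s))"
  let ?L = "\<lambda>s. \<pi> (Li_one j s)"
  have c: "?L (take i s) \<in> carrier Zb" "?L (drop i s) \<in> carrier Zb" for i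
    using 1 by (auto intro!: pi_closed Li_Z take_indices drop_indices)
  have L[simp]: "?L [] = \<one>\<^bsub>Zb\<^esub>" using pi_1 by (simp add: Li_one_def)
  have t: "?t i \<in> carrier Zb" for i using c eps_closed by auto
  have mid: "?t i = \<zero>\<^bsub>Zb\<^esub>" if "i \<in> {..length s} - {0, length s}" for i
  proof -
    have "take i s \<in> indices" "take i s \<noteq> []" "length (take i s) < length s"
      using 1 that by (auto simp: take_indices)
    then have "\<epsilon> (?L (take i s)) \<odot>\<^bsub>Zb\<^esub> \<one>\<^bsub>Zb\<^esub> = \<zero>\<^bsub>Zb\<^esub>" using 1(1) by blast
    then have "(\<epsilon> (?L (take i s)) \<odot>\<^bsub>Zb\<^esub> \<one>\<^bsub>Zb\<^esub>) \<otimes>\<^bsub>Zb\<^esub> ?L (drop i s) = \<zero>\<^bsub>Zb\<^esub>" using c by simp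
    then show ?thesis using c[of i] eps_closed[OF c(1)[of i]] by (simp add: H.smult_assoc2)
  qed
  have "?L s = (\<Oplus>\<^bsub>Zb\<^esub>i\<in>{..length s}. ?t i)"
    using H.counit_left[of "?L s"] lift_coproduct_Li[OF counit_lift 1(2)] c(1)[of "length s"] by simp
  also have "\<dots> = (\<Oplus>\<^bsub>Zb\<^esub>i\<in>{0, length s}. ?t i)"
    by (rule H.add.finprod_mono_neutral_cong_right) (use mid t in auto)
  also have "\<dots> = ?L s \<oplus>\<^bsub>Zb\<^esub> \<epsilon> (?L s) \<odot>\<^bsub>Zb\<^esub> \<one>\<^bsub>Zb\<^esub>"
    using 1(3) t[of 0] t[of "length s"] c(1)[of "length s"] eps_1 by simp
  \<comment> \<open>The term \<open>i = 0\<close> is already the left-hand side, so the other end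
    term must vanish.\<close>
  finally show ?case
    using c(1)[of "length s"] t[of "length s"] by (simp add: H.add.r_cancel_one')
qed

text \<open>A relation between representatives, so that the second one may be changed by multiples
  of \<open>zq\<close>.\<close>

definition good :: "'c \<Rightarrow> 'c \<Rightarrow> bool"
  where "good x x' \<longleftrightarrow> x \<in> carrier Z \<and> x' \<in> carrier Z \<and> S (\<pi> x) = \<pi> x'"

lemma good_linear:
  assumes "good x x'" "good z z'" "r \<in> R" shows "good (x + r * z) (x' + r * z')"
  using assms by (auto simp: good_def Z_add Z_mult R_subset_Z pi_add pi_smult S_add S_smult pi_closed)

lemma good_0: "good 0 0"
proof -
  have "S (\<zero>\<^bsub>RR\<^esub> \<odot>\<^bsub>Zb\<^esub> \<pi> 0) = \<zero>\<^bsub>RR\<^esub> \<odot>\<^bsub>Zb\<^esub> S (\<pi> 0)"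
    by (rule S_smult) (auto simp: ring_on_def R_0 Z_0 pi_closed)
  then show ?thesis by (simp add: good_def Z_0 pi_0 S_closed)
qed

lemma good_sum_list: "(\<And>i. i \<in> set xs \<Longrightarrow> good (x i) (x' i)) \<Longrightarrow> good (\<Sum>i\<leftarrow>xs. x i) (\<Sum>i\<leftarrow>xs. x' i)"
proof (induction xs)
  case (Cons i xs)
  then show ?case using good_linear[of "x i" "x' i" "\<Sum>i\<leftarrow>xs. x i" "\<Sum>i\<leftarrow>xs. x' i" 1] R_1 by simp
qed (simp add: good_0)

lemma good_zq: "good x x' \<Longrightarrow> z \<in> carrier Z \<Longrightarrow> good x (x' + zq * z)"
  by (simp add: good_def pi_zq_mult Z_add Z_mult zq_Z del: One_nat_def)

text \<open>For nonempty \<open>s\<close> the counit term is zero by \<open>counit_Li\<close>, and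
  the antipode axiom on a deconcatenation becomes the recursion that
  \<open>convolution_solve\<close> gives for the star values.\<close>

lemma good_Li:
  assumes "s \<in> indices" shows "good (Li_one j s) (Li_one_star_inv j s)"
  using assms
proof (induction s rule: length_induct)
  case (1 s)
  let ?L = "\<lambda>s. \<pi> (Li_one j s)"
  let ?w = "yu_word (map (\<lambda>n. (n, 0)) s)"
  have pos: "pos_word (map (\<lambda>n. (n, 0)) s)" using 1(2) by (auto simp: pos_word_def indices_def)
  have star: "Li_one_star_inv j s \<in> carrier Z"
    unfolding Li_one_star_inv_eq by (rule nlim_star_yu_Z[OF pos])
  have c: "?L (take i s) \<in> carrier Zb" "?L (drop i s) \<in> carrier Zb" for i
    using 1 by (auto intro!: pi_closed Li_Z take_indices drop_indices)
  have L[simp]: "?L [] = \<one>\<^bsub>Zb\<^esub>" using pi_1 by (simp add: Li_one_def)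
  let ?t = "\<lambda>i. S (?L (take i s)) \<otimes>\<^bsub>Zb\<^esub> ?L (drop i s)"
  have t: "?t i \<in> carrier Zb" for i using c S_closed by auto
  have sum: "(\<Oplus>\<^bsub>Zb\<^esub>i\<in>{..length s}. ?t i) = \<epsilon> (?L s) \<odot>\<^bsub>Zb\<^esub> \<one>\<^bsub>Zb\<^esub>"
    using H.antipode_left[of "?L s"] lift_coproduct_Li[OF antipode_lift 1(2)] c(1)[of "length s"] by simp
  show ?case
  proof (cases "s = []")
    case True
    have "S \<one>\<^bsub>Zb\<^esub> = \<one>\<^bsub>Zb\<^esub>" using sum True eps_1 S_closed by simp
    then show ?thesis using True by (simp add: good_def Li_one_def Li_one_star_inv_def pi_1 Z_1)
  next
    case False
    let ?x = "\<lambda>i. Li_one_star_inv j (take i s) * Li_one j (drop i s)"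
    have x: "?x i \<in> carrier Z \<and> ?t i = \<pi> (?x i)" if "i < length s" for i
    proof -
      have "good (Li_one j (take i s)) (Li_one_star_inv j (take i s))"
        using 1 that by (auto simp: take_indices)
      then show ?thesis
        using Li_Z[OF drop_indices[OF 1(2)], of i] by (simp add: good_def Z_mult pi_mult)
    qed
    have "Li_one_star_inv j s = - (\<Sum>i<length s. ?x i)"
      using convolution_solve[OF null_word_yu_word[OF pos]] False
      by (simp add: Li_one_eq Li_one_star_inv_eq yu_word_def take_map drop_map)
    then have neg: "(\<Sum>i<length s. ?x i) = - Li_one_star_inv j s" by simp
    have "\<zero>\<^bsub>Zb\<^esub> = (\<Oplus>\<^bsub>Zb\<^esub>i\<in>insert (length s) {..<length s}. ?t i)"
      using sum counit_Li[OF 1(2) False] by (simp flip: lessThan_Suc_atMost lessThan_Suc)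
    also have "\<dots> = ?t (length s) \<oplus>\<^bsub>Zb\<^esub> (\<Oplus>\<^bsub>Zb\<^esub>i\<in>{..<length s}. ?t i)"
      by (rule H.finsum_insert) (use t t[of "length s"] in auto)
    also have "(\<Oplus>\<^bsub>Zb\<^esub>i\<in>{..<length s}. ?t i) = (\<Oplus>\<^bsub>Zb\<^esub>i\<in>{..<length s}. \<pi> (?x i))"
      by (rule H.finsum_cong') (use x pi_closed in auto)
    also have "\<dots> = \<pi> (- Li_one_star_inv j s)"
      unfolding neg[symmetric] by (rule pi_sum[symmetric]) (use x in auto)
    finally have z: "S (?L s) \<oplus>\<^bsub>Zb\<^esub> \<pi> (- Li_one_star_inv j s) = \<zero>\<^bsub>Zb\<^esub>"
      using c(1)[of "length s"] S_closed by simp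
    have "\<pi> (Li_one_star_inv j s) \<oplus>\<^bsub>Zb\<^esub> \<pi> (- Li_one_star_inv j s) = \<zero>\<^bsub>Zb\<^esub>"
      using pi_add[OF star Z_uminus[OF star]] pi_0 by simp
    then have "S (?L s) = \<pi> (Li_one_star_inv j s)"
      using z c(1)[of "length s"] S_closed pi_closed star Z_uminus[OF star]
      by (metis H.add.r_cancel take_all_iff order_refl)
    then show ?thesis using star Li_Z[OF 1(2)] by (simp add: good_def)
  qed
qed

text \<open>Shuffling in \<open>y ^ (q - 1)\<close> affects exponents of \<open>y\<close> only. As
  the total exponent of \<open>u\<close> is preserved, an induction on it can remove one factor
  \<open>u\<close> and shuffle.\<close>

lemma qsh_pos_word:
  assumes "pos_word w" "x \<in> set (qsh (\<lambda>(a, b). (a + (CARD('k) - 1), b)) (CARD('k) - 1, 0) w)"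
  shows "pos_word x \<and> (\<Sum>l\<leftarrow>x. snd l) = (\<Sum>l\<leftarrow>w. snd l)"
  using assms
proof (induction w arbitrary: x)
  case Nil
  then show ?case using q_ge_2 by auto
next
  case (Cons l w)
  obtain a b where l: "l = (a, b)" by fastforce
  show ?case using Cons.prems Cons.IH q_ge_2 unfolding l by auto
qed

text \<open>
  The quasi-shuffle expansions of the two kinds of nested sums differ by a multiple of the limit
  \<open>\<zeta>\<^sub>A(q - 1)\<close> of \<open>u\<close>, which \<open>\<pi>\<close> kills; this removes the factors \<open>u\<close> one at a time.
\<close>

lemma good_yu_word: "pos_word w \<Longrightarrow> good (nlim (yu_word w)) (nlim_star (yu_word w))"
proof (induction "\<Sum>l\<leftarrow>w. snd l" arbitrary: w rule: less_induct)
  case less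
  show ?case
  proof (cases "\<forall>l\<in>set w. snd l = 0")
    case True
    then have "w = map (\<lambda>n. (n, 0)) (map fst w)" by (auto intro!: map_idI[symmetric] simp: prod_eq_iff)
    moreover have "map fst w \<in> indices" using less.prems by (auto simp: pos_word_def indices_def)
    ultimately show ?thesis using good_Li[of "map fst w"] unfolding Li_one_eq Li_one_star_inv_eq by simp
  next
    case False
    then obtain p l w0 where w: "w = p @ l # w0" "snd l \<noteq> 0" by (metis split_list)
    then obtain a b where l: "l = (a, Suc b)" by (metis prod.collapse not0_implies_Suc)
    define m where "m = CARD('k) - 1"
    have m: "m \<ge> 1" using q_ge_2 by (simp add: m_def)
    let ?g = "\<lambda>d. y d ^ m"
    let ?Q = "qsh (\<lambda>(a, b). (a + m, b)) (m, 0) w0"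
    have pos: "pos_word p" "a \<ge> 1" "pos_word w0" using less.prems w l by auto
    have Q: "pos_word x \<and> (\<Sum>l\<leftarrow>x. snd l) = (\<Sum>l\<leftarrow>w0. snd l)" if "x \<in> set ?Q" for x
      using qsh_pos_word[OF pos(3)] that unfolding m_def by blast
    have letter: "yu a (Suc b) = (\<lambda>e. yu a b e * (\<Sum>e'<e. ?g e'))"
      by (simp add: yu_def u_def m_def mult_ac)
    have sh: "qshuffle ?g (yu_word w0) = map yu_word ?Q"
    proof -
      have "map (map (\<lambda>(a, b). yu a b)) ?Q =
          qsh (\<lambda>f d. f d * ?g d) (case (m, 0) of (a, b) \<Rightarrow> yu a b) (map (\<lambda>(a, b). yu a b) w0)"
        by (rule map_qsh) (auto simp: yu_def power_add mult_ac)
      moreover have "yu m 0 = ?g" by (simp add: yu_def)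
      ultimately show ?thesis by (simp add: yu_word_def[abs_def])
    qed
    have g: "nlim [?g] = zq" unfolding zeta_A_eq by (simp add: S_word_def m_def S_val_q_minus_1 del: One_nat_def)
    have yw: "yu_word (p @ (a, b) # x) = yu_word p @ yu a b # yu_word x" for b x by (simp add: yu_word_def)
    note lim = nlim_qshuffle[of ?g "yu_word p" "yu a b" "yu_word w0", folded letter, unfolded sh g,
        OF y_power_tendsto_0[OF m] null_word_yu_word[OF pos(1)] yu_tendsto_0[OF pos(2)] null_word_yu_word[OF pos(3)]]
    have "good (\<Sum>x\<leftarrow>?Q. nlim (yu_word (p @ (a, b) # x))) (\<Sum>x\<leftarrow>?Q. nlim_star (yu_word (p @ (a, b) # x)))"
    proof (rule good_sum_list)
      fix x assume "x \<in> set ?Q"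
      then show "good (nlim (yu_word (p @ (a, b) # x))) (nlim_star (yu_word (p @ (a, b) # x)))"
        using Q pos by (intro less.hyps) (auto simp: w l)
    qed
    from good_zq[OF this nlim_star_yu_Z[of "p @ (a, b) # w0"]] pos
    show ?thesis by (simp add: w l yw lim comp_def)
  qed
qed

text \<open>Power sums are expanded into letters \<open>y ^ a * u ^ b\<close> from left to right by
  multilinearity; \<open>p\<close> is the part already expanded.\<close>

lemma good_zeta_word:
  assumes "pos_word p" "s \<in> indices"
  shows "good (nlim (yu_word p @ S_word s)) (nlim_star (yu_word p @ S_word s))"
  using assms
proof (induction s arbitrary: p)
  case Nil
  then show ?case using good_yu_word by (simp add: S_word_def)
next
  case (Cons t s)
  have t: "t \<ge> 1" "s \<in> indices" using Cons.prems by (auto simp: indices_def)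
  have null: "null_word (yu_word p)" "null_word (S_word s)"
    using Cons.prems t null_word_yu_word null_word_S_word by auto
  \<comment> \<open>Convergence to 0 is carried along because linearity of the limits asks for null
    words.\<close>
  have "f \<longlonglongrightarrow> 0 \<and> good (nlim (yu_word p @ f # S_word s)) (nlim_star (yu_word p @ f # S_word s))"
    if "f \<in> rspan (YU 1 0 t)" for f
    using that
  proof induction
    case rspan_zero
    then show ?case using nlim_zero[of "yu_word p" "S_word s"] null good_0 by simp
  next
    case (rspan_step f r b)
    obtain a b' where b: "b = yu a b'" "a \<ge> 1" using rspan_step.hyps by (auto simp: YU_def)
    have b0: "b \<longlonglongrightarrow> 0" using yu_tendsto_0 b by simp
    have "good (nlim (yu_word (p @ [(a, b')]) @ S_word s)) (nlim_star (yu_word (p @ [(a, b')]) @ S_word s))"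
      using Cons.prems b t by (intro Cons.IH) auto
    then have "good (nlim (yu_word p @ b # S_word s)) (nlim_star (yu_word p @ b # S_word s))"
      by (simp add: b yu_word_def)
    then show ?case
      using rspan_step b0 null nlim_linear[of "yu_word p" f "S_word s" b r]
        tendsto_linear_C[of f 0 b 0 r] by (simp add: good_linear)
  qed
  from this[OF S_val_YU[OF t(1)]] show ?case by (simp add: S_word_def)
qed

lemma good_zeta: "s \<in> indices \<Longrightarrow> good (zeta_A j s) (zeta_A_star_inv j s)"
  using good_zeta_word[of "[]" s] by (simp add: zeta_A_eq zeta_A_star_inv_eq yu_word_def)

end

theorem theorem1p4:
  fixes j :: "'k::finite_field fls alg_closure \<Rightarrow> 'c::{field,complete_space}"
    and R :: "'c set"
    and D :: "'c \<Rightarrow> ('c \<times> 'c set \<Rightarrow> 'c) set"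
    and \<Delta> :: "'c set \<Rightarrow> ('c set \<times> 'c set \<Rightarrow> 'c) set"
    and \<epsilon> :: "'c set \<Rightarrow> 'c"
    and S :: "'c set \<Rightarrow> 'c set"
  assumes "C_infinity j"
    and "coefficient_algebra j R"
    and "is_coaction j R D"
    and "is_coproduct j R D \<Delta>"
    and "is_degree_zero_projection j R \<epsilon>"
    and "hopf_algebra (ring_on R) (Zbar_alg j R) \<Delta> \<epsilon> S"
  shows "\<forall>s\<in>indices.
    S (pi_inf j R (zeta_A j s)) = pi_inf j R (zeta_A_star_inv j s) \<and>
    S (pi_inf j R (Li_one j s)) = pi_inf j R (Li_one_star_inv j s)"
proof -
  interpret hopf_C_infinity j R D \<Delta> \<epsilon> S
    using assms
    by (intro hopf_C_infinity.intro coefficient_C_infinity.intro coefficient_C_infinity_axioms.intro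
        hopf_C_infinity_axioms.intro)
  show ?thesis using good_zeta good_Li by (auto simp: good_def)
qed

end
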